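(* Let $b\in\{1,\dots,d-1\}$ and let $N_{n,b}=\#\{h\in\mathcal S: a(h)=b\}$ for a multi-base representation $a$ of $n$ chosen uniformly at random among all $P(n)$ representations. Then \[ \mathbb E[N_{n,b}]=\frac{\kappa}{d\log d}(\log n)^m+O\big((\log n)^{m-1}\log\log n\big),\qquad \operatorname{Var}[N_{n,b}]=\frac{\kappa(d-1)}{d^2\log d}(\log n)^m+O\big((\log n)^{m-1}\log\log n\big), \] and $(N_{n,b}-\mathbb E[N_{n,b}])/\sqrt{\operatorname{Var}[N_{n,b}]}$ converges in distribution to a standard Gaussian random variable as $n\to\infty$.
   Context: Fix integers $d\geq 2$ and $m\geq 2$, and integers $1<p_1<p_2<\dots<p_m$ with $\gcd(p_i,p_j)=1$ for $i\neq j$. Let $\mathcal S=\{p_1^{\alpha_1}p_2^{\alpha_2}\cdots p_m^{\alpha_m}:\alpha_1,\dots,\alpha_m\in\mathbb Z_{\ge 0}\}$. A multi-base representation of a positive integer $n$ (with bases $p_1,\dots,p_m$ and digit set $\{0,1,\dots,d-1\}$) is a function $a:\mathcal S\to\{0,1,\dots,d-1\}$ with finite support such that $\sum_{h\in\mathcal S}a(h)\,h=n$. Let $P(n)$ be the (finite) number of multi-base representations of $n$. Set $\kappa=\frac{\log d}{m!}\prod_{j=1}^m\frac{1}{\log p_j}$. *)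

theory Defs
  imports "HOL-Probability.Probability" "HOL-Library.Landau_Symbols"
begin

text \<open>The bases are p 0 < p 1 < ... < p (m-1) (i.e. p_1,...,p_m of the paper).
  S is the multiplicative semigroup they generate.\<close>
definition mb_S :: "nat \<Rightarrow> (nat \<Rightarrow> nat) \<Rightarrow> nat set" where
  "mb_S m p = {h. \<exists>\<alpha>::nat \<Rightarrow> nat. h = (\<Prod>i<m. p i ^ \<alpha> i)}"

definition mb_reps :: "nat \<Rightarrow> nat \<Rightarrow> (nat \<Rightarrow> nat) \<Rightarrow> nat \<Rightarrow> (nat \<Rightarrow> nat) set" where
  "mb_reps d m p n = {a. (\<forall>h. a h \<noteq> 0 \<longrightarrow> h \<in> mb_S m p) \<and> (\<forall>h. a h < d)
      \<and> finite {h. a h \<noteq> 0} \<and> (\<Sum>h\<in>{h. a h \<noteq> 0}. a h * h) = n}"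

definition mb_P :: "nat \<Rightarrow> nat \<Rightarrow> (nat \<Rightarrow> nat) \<Rightarrow> nat \<Rightarrow> nat" where
  "mb_P d m p n = card (mb_reps d m p n)"

definition mb_N :: "nat \<Rightarrow> (nat \<Rightarrow> nat) \<Rightarrow> nat \<Rightarrow> (nat \<Rightarrow> nat) \<Rightarrow> nat" where
  "mb_N m p b a = card {h \<in> mb_S m p. a h = b}"

definition mb_unif :: "nat \<Rightarrow> nat \<Rightarrow> (nat \<Rightarrow> nat) \<Rightarrow> nat \<Rightarrow> (nat \<Rightarrow> nat) pmf" where
  "mb_unif d m p n = pmf_of_set (mb_reps d m p n)"

definition mb_mean :: "nat \<Rightarrow> nat \<Rightarrow> (nat \<Rightarrow> nat) \<Rightarrow> nat \<Rightarrow> nat \<Rightarrow> real" where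
  "mb_mean d m p b n = measure_pmf.expectation (mb_unif d m p n) (\<lambda>a. real (mb_N m p b a))"

definition mb_var :: "nat \<Rightarrow> nat \<Rightarrow> (nat \<Rightarrow> nat) \<Rightarrow> nat \<Rightarrow> nat \<Rightarrow> real" where
  "mb_var d m p b n = measure_pmf.variance (mb_unif d m p n) (\<lambda>a. real (mb_N m p b a))"

definition mb_kappa :: "nat \<Rightarrow> nat \<Rightarrow> (nat \<Rightarrow> nat) \<Rightarrow> real" where
  "mb_kappa d m p = ln (real d) / fact m * (\<Prod>j<m. 1 / ln (real (p j)))"

end

theory Submission
  imports Defs
begin

text \<open>
  Give the digit \<open>a(h)\<close> the law proportional to \<open>exp (- z h a(h))\<close>, independently for all \<open>h \<le> n\<close>, with \<open>z\<close> chosen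
  such that \<open>W = \<Sum> a(h) h\<close> has mean \<open>n\<close>.  All representations of \<open>n\<close> have the same weight, so a uniformly random
  representation is this product law conditioned on \<open>W = n\<close>.  Fourier inversion writes \<open>P(W = n)\<close> and the conditioned
  moments and characteristic function of the digit count as integrals over \<open>[-\<pi>, \<pi>]\<close> of products of characteristic
  functions, each of modulus at most \<open>exp (- c (1 - cos (h t)))\<close> for \<open>h \<le> X = 1/z\<close>.  A centred factor contributes
  an additional \<open>O(h |t|)\<close>, and this makes the digits of the conditioned law uncorrelated to sufficient precision.

  Everything thus rests on bounds for \<open>\<integral> |t|\<^sup>k exp (- c \<Sum> (1 - cos (h t))) dt\<close>, the sum running over \<open>h \<le> X\<close> in the semigroup.
  For \<open>|t| \<le> \<pi>/X\<close> the exponent is quadratic, because a window below \<open>X\<close> contains about \<open>(log X)\<^sup>m\<^sup>-\<^sup>1\<close> elements.  For larger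
  \<open>t\<close> only products \<open>p\<^sup>i q\<^sup>j\<close> of two bases are used: by coprimality at least \<open>c log X\<close> of them keep \<open>h t\<close> away from \<open>2\<pi>\<int>\<close>, a
  saving of a fixed power of \<open>X\<close>; and since \<open>t \<mapsto> p t\<close> preserves the measure of the circle, the integral of the remaining
  exponential is at most \<open>X\<close> to a power as close to \<open>-1\<close> as desired.
\<close>

section \<open>The semigroup generated by the bases\<close>

text \<open>Two scales govern all error terms: \<open>ell = ln X\<close> and
  \<open>s = sqrt (ell ^ (m - 1))\<close>. The variance of W is at most a constant times (X s)^2 and
  P(W = n) is at least a constant times 1/(X s), so the relevant t have size 1/(X s). Summed over h,
  the gain from centring one digit is of order s^2 X|t|, hence about s there: conditioning moves the
  mean of the digit count by O(s) and its variance by O(s^2), both within O((log n)^(m-1)). The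
  factor log log n comes from comparing tilted digits with uniform ones: this is useless for h
  between X/(log n)^m and n, a range of O(log log n) dyadic scales. The obstacle is that only
  polylogarithmically many elements lie below X. On the minor arcs the exponent saves pointwise only
  a small power of X, while the main term is itself nearly 1/X. Therefore half of the exponent is
  spent on the pointwise saving and the other half on the integral, whose loss X^\<beta> is chosen
  smaller than that saving.\<close>

lemma power_diff_bounds:
  fixes u v :: real
  assumes "0 \<le> u" "u \<le> v"
  shows "real (Suc k) * (v - u) * u ^ k \<le> v ^ Suc k - u ^ Suc k"
    and "v ^ Suc k - u ^ Suc k \<le> real (Suc k) * (v - u) * v ^ k"
proof -
  have eq: "v ^ Suc k - u ^ Suc k = (v - u) * (\<Sum>i<Suc k. v ^ i * u ^ (k - i))"
    using diff_power_eq_sum[of v k u] by (simp add: algebra_simps)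
  have le: "u ^ k \<le> v ^ i * u ^ (k - i)" "v ^ i * u ^ (k - i) \<le> v ^ k" if "i < Suc k" for i
  proof -
    have "u ^ k = u ^ i * u ^ (k - i)" "v ^ k = v ^ i * v ^ (k - i)"
      using that by (simp_all flip: power_add)
    moreover have "u ^ i * u ^ (k - i) \<le> v ^ i * u ^ (k - i)"
      using assms by (intro mult_right_mono power_mono) auto
    moreover have "v ^ i * u ^ (k - i) \<le> v ^ i * v ^ (k - i)"
      using assms by (intro mult_left_mono power_mono) auto
    ultimately show "u ^ k \<le> v ^ i * u ^ (k - i)" "v ^ i * u ^ (k - i) \<le> v ^ k" by auto
  qed
  have "real (card {..<Suc k}) * u ^ k \<le> (\<Sum>i<Suc k. v ^ i * u ^ (k - i))"
    using le by (intro sum_bounded_below) auto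
  hence "(v - u) * (real (Suc k) * u ^ k) \<le> v ^ Suc k - u ^ Suc k"
    unfolding eq using assms by (intro mult_left_mono) auto
  thus "real (Suc k) * (v - u) * u ^ k \<le> v ^ Suc k - u ^ Suc k" by (simp only: mult_ac)
  have "(\<Sum>i<Suc k. v ^ i * u ^ (k - i)) \<le> real (card {..<Suc k}) * v ^ k"
    using le by (intro sum_bounded_above) auto
  hence "v ^ Suc k - u ^ Suc k \<le> (v - u) * (real (Suc k) * v ^ k)"
    unfolding eq using assms by (intro mult_left_mono) auto
  thus "v ^ Suc k - u ^ Suc k \<le> real (Suc k) * (v - u) * v ^ k" by (simp only: mult_ac)
qed

definition mb_le :: "nat \<Rightarrow> (nat \<Rightarrow> nat) \<Rightarrow> real \<Rightarrow> nat set" where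
  "mb_le m p x = {h \<in> mb_S m p. real h \<le> x}"

lemma finite_mb_le [simp, intro]: "finite (mb_le m p x)"
proof (rule finite_subset)
  show "mb_le m p x \<subseteq> {..nat \<lfloor>x\<rfloor>}"
    by (auto simp: mb_le_def le_nat_floor)
qed auto

section \<open>Recursion on the bases, counting, and sums over the semigroup\<close>

locale coprime_bases =
  fixes m :: nat and p :: "nat \<Rightarrow> nat"
  assumes base_gt_1: "i < m \<Longrightarrow> 1 < p i"
    and bases_coprime: "i < m \<Longrightarrow> j < m \<Longrightarrow> i \<noteq> j \<Longrightarrow> coprime (p i) (p j)"
begin

lemma base_ge_2: "i < m \<Longrightarrow> 2 \<le> real (p i)"
  using base_gt_1[of i] by simp

lemma ln_base_pos: "i < m \<Longrightarrow> 0 < ln (real (p i))"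
  using base_gt_1[of i] by simp

lemma mb_S_pos: "k \<le> m \<Longrightarrow> h \<in> mb_S k p \<Longrightarrow> 1 \<le> h"
proof -
  assume k: "k \<le> m" and "h \<in> mb_S k p"
  then obtain \<alpha> where "h = (\<Prod>i<k. p i ^ \<alpha> i)" by (auto simp: mb_S_def)
  moreover have "0 < (\<Prod>i<k. p i ^ \<alpha> i)"
    using k base_gt_1 by (intro prod_pos zero_less_power) (metis less_trans lessThan_iff order_less_le_trans zero_less_one)
  ultimately show "1 \<le> h" by (simp only: One_nat_def Suc_le_eq)
qed

lemma mb_le_pos: "k \<le> m \<Longrightarrow> h \<in> mb_le k p x \<Longrightarrow> 1 \<le> h"
  using mb_S_pos by (auto simp: mb_le_def)

lemma mb_le_empty: "k \<le> m \<Longrightarrow> x < 1 \<Longrightarrow> mb_le k p x = {}"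
  using mb_le_pos[of k] by (force simp: mb_le_def)

lemma mb_S_0: "mb_S 0 p = {1}"
  by (auto simp: mb_S_def)

lemma mb_S_mult:
  assumes "h \<in> mb_S (Suc k) p" shows "p k * h \<in> mb_S (Suc k) p"
proof -
  obtain \<alpha> where h: "h = (\<Prod>i<Suc k. p i ^ \<alpha> i)" using assms by (auto simp: mb_S_def)
  have "(\<Prod>i<k. p i ^ \<alpha> i) = (\<Prod>i<k. p i ^ (\<alpha>(k := Suc (\<alpha> k))) i)"
    by (intro prod.cong) auto
  hence "p k * h = (\<Prod>i<Suc k. p i ^ (\<alpha>(k := Suc (\<alpha> k))) i)"
    unfolding h by (simp add: mult_ac)
  thus ?thesis unfolding mb_S_def by blast
qed

lemma mb_S_subset_Suc: "mb_S k p \<subseteq> mb_S (Suc k) p"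
proof
  fix h assume "h \<in> mb_S k p"
  then obtain \<alpha> where h: "h = (\<Prod>i<k. p i ^ \<alpha> i)" by (auto simp: mb_S_def)
  have "(\<Prod>i<k. p i ^ \<alpha> i) = (\<Prod>i<k. p i ^ (\<alpha>(k := 0)) i)"
    by (intro prod.cong) auto
  hence "h = (\<Prod>i<Suc k. p i ^ (\<alpha>(k := 0)) i)" unfolding h by simp
  thus "h \<in> mb_S (Suc k) p" unfolding mb_S_def by blast
qed

lemma mb_S_mono: "k \<le> k' \<Longrightarrow> mb_S k p \<subseteq> mb_S k' p"
  by (induction k' rule: dec_induct) (use mb_S_subset_Suc in blast)+

lemma mb_S_Suc:
  "mb_S (Suc k) p = mb_S k p \<union> (\<lambda>h. p k * h) ` mb_S (Suc k) p"
proof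
  show "mb_S (Suc k) p \<subseteq> mb_S k p \<union> (\<lambda>h. p k * h) ` mb_S (Suc k) p"
  proof
    fix h assume "h \<in> mb_S (Suc k) p"
    then obtain \<alpha> where h: "h = (\<Prod>i<Suc k. p i ^ \<alpha> i)" by (auto simp: mb_S_def)
    show "h \<in> mb_S k p \<union> (\<lambda>h. p k * h) ` mb_S (Suc k) p"
    proof (cases "\<alpha> k")
      case 0
      hence "h = (\<Prod>i<k. p i ^ \<alpha> i)" using h by simp
      thus ?thesis unfolding mb_S_def by blast
    next
      case (Suc e)
      have "(\<Prod>i<k. p i ^ \<alpha> i) = (\<Prod>i<k. p i ^ (\<alpha>(k := e)) i)"
        by (intro prod.cong) auto
      hence "h = p k * (\<Prod>i<Suc k. p i ^ (\<alpha>(k := e)) i)"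
        unfolding h using Suc by (simp add: mult_ac)
      thus ?thesis unfolding mb_S_def by blast
    qed
  qed
qed (use mb_S_subset_Suc mb_S_mult in blast)

lemma mb_S_not_dvd:
  assumes "k < m" "h \<in> mb_S k p" shows "\<not> p k dvd h"
proof
  assume dvd: "p k dvd h"
  obtain \<alpha> where h: "h = (\<Prod>i<k. p i ^ \<alpha> i)" using assms by (auto simp: mb_S_def)
  have "coprime (p k) h"
    unfolding h using assms bases_coprime
    by (intro prod_coprime_right) (auto intro!: coprime_power_right_iff[THEN iffD2])
  with dvd have "p k dvd 1" by (metis coprime_common_divisor dvd_refl)
  thus False using base_gt_1[OF assms(1)] by simp
qed

text \<open>Splitting off the elements not divisible by the last base turns every sum over the semigroup
  into a recursion on the number of bases and on the cutoff; coprimality makes the union disjoint.\<close>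
lemma sum_mb_le_Suc:
  fixes f :: "nat \<Rightarrow> 'a::comm_monoid_add"
  assumes "k < m"
  shows "sum f (mb_le (Suc k) p x) =
    sum f (mb_le k p x) + (\<Sum>h\<in>mb_le (Suc k) p (x / real (p k)). f (p k * h))"
proof -
  have pk: "0 < p k" using base_gt_1[OF assms] by simp
  have "real (p k * h) \<le> x \<longleftrightarrow> real h \<le> x / real (p k)" for h
    using pk by (simp add: field_simps)
  hence split: "mb_le (Suc k) p x = mb_le k p x \<union> (\<lambda>h. p k * h) ` mb_le (Suc k) p (x / real (p k))"
    unfolding mb_le_def by (subst mb_S_Suc) auto
  have disj: "mb_le k p x \<inter> (\<lambda>h. p k * h) ` mb_le (Suc k) p (x / real (p k)) = {}"
    using mb_S_not_dvd[OF assms] dvd_triv_left by (fastforce simp: mb_le_def)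
  have inj: "inj_on (\<lambda>h. p k * h) A" for A using pk by (auto intro: inj_onI)
  have "sum f (mb_le (Suc k) p x) =
      sum f (mb_le k p x) + sum f ((\<lambda>h. p k * h) ` mb_le (Suc k) p (x / real (p k)))"
    unfolding split using disj by (intro sum.union_disjoint) auto
  thus ?thesis by (subst (asm) sum.reindex[OF inj]) (simp add: o_def)
qed

lemma card_mb_le_Suc:
  assumes "k < m"
  shows "card (mb_le (Suc k) p x) = card (mb_le k p x) + card (mb_le (Suc k) p (x / real (p k)))"
  using sum_mb_le_Suc[OF assms, of "\<lambda>_. 1::nat" x] by simp

text \<open>The exponent vectors counted are the lattice points of a simplex. Unit cubes attached to
  them cover the simplex and fit into the one with \<open>ln x\<close> enlarged by the sum of the
  \<open>ln (p i)\<close>, which explains both bounds. The proof avoids volumes: the recursion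
  \<open>card_mb_le_Suc\<close> becomes a telescoping sum of (k+1)-th powers with step
  \<open>ln (p k)\<close>, controlled by \<open>power_diff_bounds\<close>.\<close>

lemma card_mb_le_bounds:
  assumes "k \<le> m" "1 \<le> x"
  shows "ln x ^ k / (fact k * (\<Prod>i<k. ln (real (p i)))) \<le> real (card (mb_le k p x))"
    and "real (card (mb_le k p x))
      \<le> (ln x + (\<Sum>i<k. ln (real (p i)))) ^ k / (fact k * (\<Prod>i<k. ln (real (p i))))"
proof -
  have "ln x ^ k / (fact k * (\<Prod>i<k. ln (real (p i)))) \<le> real (card (mb_le k p x)) \<and>
      real (card (mb_le k p x))
      \<le> (ln x + (\<Sum>i<k. ln (real (p i)))) ^ k / (fact k * (\<Prod>i<k. ln (real (p i))))"
    using assms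
  proof (induction k arbitrary: x)
    case 0
    have "mb_le 0 p x = {1}" using 0 by (auto simp: mb_le_def mb_S_0)
    thus ?case by simp
  next
    case (Suc k)
    define a where "a = ln (real (p k))"
    define s where "s = (\<Sum>i<k. ln (real (p i)))"
    define c where "c = 1 / (fact k * (\<Prod>i<k. ln (real (p i))))"
    define c' where "c' = c / (real (Suc k) * a)"
    have km: "k < m" using Suc.prems by simp
    have a: "a > 0" using ln_base_pos[OF km] by (simp add: a_def)
    have s: "s \<ge> 0" unfolding s_def using km ln_base_pos by (intro sum_nonneg) (simp add: less_imp_le)
    have c: "c > 0" unfolding c_def using km ln_base_pos by (intro divide_pos_pos mult_pos_pos prod_pos) auto
    have c'0: "c' > 0" unfolding c'_def using a c by simp
    have cc': "c = c' * (real (Suc k) * a)" using a by (simp add: c'_def del: of_nat_Suc)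
    have c'_eq: "1 / (fact (Suc k) * (\<Prod>i<Suc k. ln (real (p i)))) = c'"
      by (simp add: c'_def c_def a_def field_simps)
    have IH: "c * ln y ^ k \<le> real (card (mb_le k p y))" "real (card (mb_le k p y)) \<le> c * (ln y + s) ^ k"
      if "1 \<le> y" for y
      using Suc.IH[of y] that km by (auto simp: c_def s_def)
    \<comment> \<open>Inner induction on a bound for the number of times the cutoff can be divided
      by \<open>p k\<close>; \<open>n = 0\<close> is vacuous.\<close>
    have "1 \<le> y \<Longrightarrow> y < real (p k) ^ n \<Longrightarrow> c' * ln y ^ Suc k \<le> real (card (mb_le (Suc k) p y)) \<and>
       real (card (mb_le (Suc k) p y)) \<le> c' * (ln y + (s + a)) ^ Suc k" for n y
    proof (induction n arbitrary: y)
      case 0 thus ?case by simp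
    next
      case (Suc n)
      have pk: "real (p k) > 1" using base_gt_1[OF km] by simp
      have l0: "ln y \<ge> 0" using Suc.prems by simp
      note low = power_diff_bounds(2)[of "ln y - a" "ln y" k]
      note upp = power_diff_bounds(1)[of "ln y + s" "ln y + (s + a)" k]
      have upp': "real (Suc k) * a * (ln y + s) ^ k \<le> (ln y + (s + a)) ^ Suc k - (ln y + s) ^ Suc k"
        using upp a l0 s by simp
      have "c * (ln y + s) ^ k = c' * (real (Suc k) * a * (ln y + s) ^ k)" by (simp only: cc' mult_ac)
      also have "\<dots> \<le> c' * ((ln y + (s + a)) ^ Suc k - (ln y + s) ^ Suc k)"
        using upp' c'0 by (intro mult_left_mono) auto
      finally have U: "c * (ln y + s) ^ k \<le> c' * (ln y + (s + a)) ^ Suc k - c' * (ln y + s) ^ Suc k"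
        by (simp only: right_diff_distrib)
      show ?case
      proof (cases "y < real (p k)")
        case True
        have "y / real (p k) < 1" using True pk by (simp add: field_simps)
        hence "card (mb_le (Suc k) p y) = card (mb_le k p y)"
          using card_mb_le_Suc[OF km, of y] mb_le_empty[of "Suc k" "y / real (p k)"] km by simp
        \<comment> \<open>The recursion has ended, so there is no earlier power to subtract;
          \<open>ln y \<le> a\<close> makes the whole leading term small enough.\<close>
        moreover have "c' * ln y ^ Suc k \<le> c * ln y ^ k"
        proof -
          have "ln y \<le> a" using True Suc.prems by (simp add: a_def)
          hence "ln y * 1 \<le> a * real (Suc k)" using l0 a by (intro mult_mono) auto
          hence "ln y * ln y ^ k \<le> (real (Suc k) * a) * ln y ^ k"
            using l0 by (intro mult_right_mono) (simp_all add: mult_ac del: of_nat_Suc)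
          hence "c' * (ln y * ln y ^ k) \<le> c' * ((real (Suc k) * a) * ln y ^ k)"
            using c'0 by (intro mult_left_mono) auto
          thus ?thesis by (simp only: cc' power_Suc mult_ac)
        qed
        moreover have "0 \<le> c' * (ln y + s) ^ Suc k" using c'0 l0 s by (intro mult_nonneg_nonneg zero_le_power) auto
        ultimately show ?thesis using IH[of y] Suc.prems U by auto
      next
        case False
        define y' where "y' = y / real (p k)"
        have y': "1 \<le> y'" "y' < real (p k) ^ n"
          using False Suc.prems pk by (auto simp: y'_def field_simps)
        have ly': "ln y' = ln y - a" using Suc.prems pk by (simp add: y'_def a_def ln_div)
        have "0 \<le> ln y - a" using y'(1) ly' by (metis ln_ge_zero)
        hence "ln y ^ Suc k - (ln y - a) ^ Suc k \<le> real (Suc k) * a * ln y ^ k"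
          using low a by (simp del: power_Suc of_nat_Suc)
        hence "c' * (ln y ^ Suc k - (ln y - a) ^ Suc k) \<le> c' * (real (Suc k) * a * ln y ^ k)"
          using c'0 by (intro mult_left_mono) auto
        also have "\<dots> = c * ln y ^ k" by (simp only: cc' mult_ac)
        finally have L: "c' * ln y ^ Suc k - c' * ln y' ^ Suc k \<le> c * ln y ^ k"
          by (simp only: right_diff_distrib ly')
        have "ln y' + (s + a) = ln y + s" using ly' by simp
        hence "real (card (mb_le (Suc k) p y')) \<le> c' * (ln y + s) ^ Suc k"
          using Suc.IH[OF y'] by (simp only:)
        thus ?thesis using Suc.IH[OF y'] IH[of y] L U card_mb_le_Suc[OF km, of y] Suc.prems(1)
          unfolding y'_def[symmetric] by (auto simp del: power_Suc)
      qed
    qed note * = this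
    have "real (p k) > 1" using base_gt_1[OF km] by simp
    then obtain n where "x < real (p k) ^ n" using real_arch_pow by blast
    from *[OF \<open>1 \<le> x\<close> this] show ?case
      unfolding c'_eq[symmetric] by (simp add: s_def a_def)
  qed
  thus "ln x ^ k / (fact k * (\<Prod>i<k. ln (real (p i)))) \<le> real (card (mb_le k p x))"
    and "real (card (mb_le k p x))
      \<le> (ln x + (\<Sum>i<k. ln (real (p i)))) ^ k / (fact k * (\<Prod>i<k. ln (real (p i))))" by auto
qed

text \<open>Dividing the cutoff by a base while multiplying the dilation by it preserves
  \<open>x * c\<close>, so a bound for one base that is uniform in the dilation passes through the
  recursion. Every further base costs only the number \<open>K\<close> of dyadic scales. This yields
  the exponent m - 1 in place of the m of plain counting.\<close>

lemma sum_mb_le_bound: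
  fixes g :: "real \<Rightarrow> real"
  assumes one: "\<And>x c. 0 < c \<Longrightarrow> x * c \<le> R \<Longrightarrow> (\<Sum>h\<in>mb_le 1 p x. g (c * real h)) \<le> D"
    and "Suc k \<le> m" "0 \<le> D"
  shows "0 < c \<Longrightarrow> x * c \<le> R \<Longrightarrow> x < 2 ^ K \<Longrightarrow>
    (\<Sum>h\<in>mb_le (Suc k) p x. g (c * real h)) \<le> D * real K ^ k"
  using assms(2)
proof (induction k arbitrary: x c K)
  case 0
  thus ?case using one[of c x] by simp
next
  case (Suc k)
  note IHk = Suc.IH
  have km: "Suc k < m" using Suc.prems by simp
  have p2: "2 \<le> real (p (Suc k))" using base_ge_2[OF km] .
  show ?case using Suc.prems(1-3)
  proof (induction K arbitrary: x c)
    case 0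
    thus ?case using mb_le_empty[of "Suc (Suc k)" x] km by simp
  next
    case (Suc K)
    have "x / real (p (Suc k)) < 2 ^ K"
    proof (cases "0 \<le> x")
      case True
      hence "x / real (p (Suc k)) \<le> x / 2" using p2 by (intro divide_left_mono) auto
      also have "\<dots> < 2 ^ K" using Suc.prems by simp
      finally show ?thesis .
    next
      case False
      hence "x / real (p (Suc k)) < 0" using p2 by (simp add: field_simps)
      thus ?thesis by (smt (verit) zero_less_power)
    qed
    moreover have "x / real (p (Suc k)) * (c * real (p (Suc k))) \<le> R" using p2 Suc.prems by simp
    moreover have "0 < c * real (p (Suc k))" using p2 Suc.prems by simp
    ultimately have "(\<Sum>h\<in>mb_le (Suc (Suc k)) p (x / real (p (Suc k))). g (c * real (p (Suc k)) * real h))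
        \<le> D * real K ^ Suc k"
      using Suc.IH by blast
    moreover have "(\<Sum>h\<in>mb_le (Suc k) p x. g (c * real h)) \<le> D * real (Suc K) ^ k"
      using Suc.prems km by (intro IHk) auto
    moreover have "D * real K ^ Suc k + D * real (Suc K) ^ k \<le> D * real (Suc K) ^ Suc k"
    proof -
      have "real K ^ Suc k \<le> real K * real (Suc K) ^ k" by (auto intro!: mult_left_mono power_mono)
      hence "D * (real K ^ Suc k + real (Suc K) ^ k) \<le> D * (real K * real (Suc K) ^ k + real (Suc K) ^ k)"
        using \<open>0 \<le> D\<close> by (intro mult_left_mono) auto
      thus ?thesis by (simp add: algebra_simps)
    qed
    ultimately show ?case using sum_mb_le_Suc[OF km, of "\<lambda>h. g (c * real h)" x] by (simp add: mult_ac)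
  qed
qed

lemma mb_S_1: "mb_S 1 p = range (\<lambda>i. p 0 ^ i)"
  unfolding mb_S_def by (auto intro: exI[of _ "\<lambda>_. _"])

lemma sum_mb_le_1:
  assumes "0 < m" "0 \<le> x"
  shows "finite {i. real (p 0) ^ i \<le> x}"
    and "sum f (mb_le 1 p x) = (\<Sum>i\<in>{i. real (p 0) ^ i \<le> x}. f (p 0 ^ i))"
proof -
  have inj: "inj_on (\<lambda>i. p 0 ^ i) A" for A
    using base_gt_1[OF assms(1)] by (intro inj_onI) (auto simp: power_inject_exp)
  have eq: "mb_le 1 p x = (\<lambda>i. p 0 ^ i) ` {i. real (p 0) ^ i \<le> x}"
    unfolding mb_le_def mb_S_1 by auto
  have "finite ((\<lambda>i. p 0 ^ i) ` {i. real (p 0) ^ i \<le> x})" unfolding eq[symmetric] by simp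
  thus "finite {i. real (p 0) ^ i \<le> x}" using finite_imageD inj by blast
  show "sum f (mb_le 1 p x) = (\<Sum>i\<in>{i. real (p 0) ^ i \<le> x}. f (p 0 ^ i))"
    unfolding eq by (subst sum.reindex[OF inj]) simp
qed

end

text \<open>The largest term dominates, since every term is at least the sum of all earlier ones.
  The index set is arbitrary because it later consists of the exponents selected by a
  threshold.\<close>

lemma sum_geometric_up_le:
  fixes p c :: real
  assumes "2 \<le> p" "finite A" "0 < c" "\<And>i. i \<in> A \<Longrightarrow> c * p ^ i \<le> B" "0 \<le> B"
  shows "(\<Sum>i\<in>A. c * p ^ i) \<le> 2 * B"
  using assms(2,4)
proof (induction A rule: finite_linorder_max_induct)
  case empty
  thus ?case using assms by simp
next
  case (insert b A)
  have less: "(\<Sum>i<n. c * p ^ i) \<le> c * p ^ n" for n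
  proof (induction n)
    case (Suc n)
    have "c * p ^ n + c * p ^ n \<le> p * (c * p ^ n)" using assms mult_right_mono[of 2 p "c * p ^ n"] by simp
    thus ?case using Suc by (simp add: mult_ac)
  qed (use assms in simp)
  have "(\<Sum>i\<in>A. c * p ^ i) \<le> (\<Sum>i<b. c * p ^ i)"
    using insert assms by (intro sum_mono2) auto
  also have "\<dots> \<le> c * p ^ b" by (rule less)
  finally show ?case using insert by force
qed

lemma sum_geometric_down_le:
  fixes p c :: real
  assumes "2 \<le> p" "finite A" "0 < c" "\<And>i. i \<in> A \<Longrightarrow> c / p ^ i \<le> B" "0 \<le> B"
  shows "(\<Sum>i\<in>A. c / p ^ i) \<le> 2 * B"
  using assms(2,4)
proof (induction A rule: finite_linorder_min_induct)
  case empty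
  thus ?case using assms by simp
next
  case (insert b A)
  have less: "(\<Sum>i\<in>{b<..b+n}. c / p ^ i) \<le> c / p ^ b - c / p ^ (b + n)" for n
  proof (induction n)
    case (Suc n)
    have "{b<..b + Suc n} = insert (b + Suc n) {b<..b + n}" by auto
    moreover have "2 * (c / p ^ (b + Suc n)) \<le> p * (c / p ^ (b + Suc n))"
      using assms by (intro mult_right_mono) auto
    hence "c / p ^ (b + Suc n) + c / p ^ (b + Suc n) \<le> c / p ^ (b + n)"
      using assms by (simp add: field_simps)
    ultimately show ?case using Suc by simp
  qed simp
  have "A \<subseteq> {b<..b + Max (insert 0 A)}"
    using insert by (auto intro!: trans_le_add2)
  hence "(\<Sum>i\<in>A. c / p ^ i) \<le> (\<Sum>i\<in>{b<..b + Max (insert 0 A)}. c / p ^ i)"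
    using assms by (intro sum_mono2) auto
  also have "\<dots> \<le> c / p ^ b - c / p ^ (b + Max (insert 0 A))" by (rule less)
  also have "\<dots> \<le> c / p ^ b" using assms by simp
  finally show ?case using insert by force
qed

context coprime_bases begin

text \<open>Along one base, \<open>min u (1 / u)\<close> decays geometrically on both sides of u =
  1, so the sum is at most 2 + 2 at every dilation; the other bases contribute the power of
  \<open>K\<close>.\<close>

lemma sum_min_mb_le:
  assumes "0 < m" "0 < c" "x < 2 ^ K"
  shows "(\<Sum>h\<in>mb_le m p x. min (c * real h) (1 / (c * real h))) \<le> 4 * real K ^ (m - 1)"
proof -
  have one: "(\<Sum>h\<in>mb_le 1 p y. min (e * real h) (1 / (e * real h))) \<le> 4" if "0 < e" for e y
  proof (cases "0 \<le> y")
    case False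
    hence "mb_le 1 p y = {}" using mb_le_empty[of 1 y] assms by simp
    thus ?thesis by simp
  next
    case True
    note fin = sum_mb_le_1(1)[OF assms(1) True]
    define P where "P = real (p 0)"
    have P: "2 \<le> P" using base_ge_2[OF assms(1)] by (simp add: P_def)
    let ?A = "{i. P ^ i \<le> y}"
    have finA: "finite ?A" using fin by (simp add: P_def)
    have "(\<Sum>h\<in>mb_le 1 p y. min (e * real h) (1 / (e * real h)))
        = (\<Sum>i\<in>?A. min (e * P ^ i) (1 / (e * P ^ i)))"
      by (subst sum_mb_le_1(2)[OF assms(1) True]) (simp add: P_def)
    also have "\<dots> = (\<Sum>i\<in>{i\<in>?A. e * P ^ i \<le> 1}. min (e * P ^ i) (1 / (e * P ^ i)))
        + (\<Sum>i\<in>{i\<in>?A. \<not> e * P ^ i \<le> 1}. min (e * P ^ i) (1 / (e * P ^ i)))"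
      using finA by (subst sum.union_disjoint[symmetric]) (auto intro!: sum.cong)
    also have "\<dots> \<le> (\<Sum>i\<in>{i\<in>?A. e * P ^ i \<le> 1}. e * P ^ i)
        + (\<Sum>i\<in>{i\<in>?A. \<not> e * P ^ i \<le> 1}. (1 / e) / P ^ i)"
      by (intro add_mono sum_mono) auto
    also have "\<dots> \<le> 2 * 1 + 2 * 1"
    proof (intro add_mono)
      show "(\<Sum>i\<in>{i\<in>?A. e * P ^ i \<le> 1}. e * P ^ i) \<le> 2 * 1"
        using P finA that by (intro sum_geometric_up_le) auto
      show "(\<Sum>i\<in>{i\<in>?A. \<not> e * P ^ i \<le> 1}. (1 / e) / P ^ i) \<le> 2 * 1"
        using P finA that by (intro sum_geometric_down_le) (auto simp: field_simps)
    qed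
    finally show ?thesis by simp
  qed
  show ?thesis
    using sum_mb_le_bound[of "x * c" "\<lambda>y. min y (1 / y)" 4 "m - 1" c x K] one assms by auto
qed

text \<open>Along one base, at most \<open>R\<close> powers lie between bounds of ratio at most 2^R.
  It is applied with a ratio that is a power of log n, so that \<open>R\<close> is of order log log
  n: this is where the log log n of the theorem enters.\<close>

lemma card_mb_le_greater:
  assumes "0 < m" "0 < y" "x \<le> y * 2 ^ R" "x < 2 ^ K"
  shows "real (card {h \<in> mb_le m p x. y < real h}) \<le> real R * real K ^ (m - 1)"
proof -
  define g :: "real \<Rightarrow> real" where "g = (\<lambda>u. if 1 < u then 1 else 0)"
  have one: "(\<Sum>h\<in>mb_le 1 p x'. g (c * real h)) \<le> real R" if "0 < c" "x' * c \<le> 2 ^ R" for x' c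
  proof (cases "0 \<le> x'")
    case False
    hence "mb_le 1 p x' = {}" using mb_le_empty[of 1 x'] assms by simp
    thus ?thesis by simp
  next
    case True
    define P where "P = real (p 0)"
    have P: "2 \<le> P" using base_ge_2[OF assms(1)] by (simp add: P_def)
    let ?A = "{i. P ^ i \<le> x'}"
    let ?B = "{i\<in>?A. 1 < c * P ^ i}"
    have finA: "finite ?A" using sum_mb_le_1(1)[OF assms(1) True] by (simp add: P_def)
    have "(\<Sum>h\<in>mb_le 1 p x'. g (c * real h)) = (\<Sum>i\<in>?A. g (c * P ^ i))"
      by (subst sum_mb_le_1(2)[OF assms(1) True]) (simp add: P_def)
    also have "\<dots> = real (card ?B)"
      using finA by (simp add: g_def sum.If_cases Int_def)
    also have "card ?B \<le> R"
    proof (cases "?B = {}")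
      case False
      define lo where "lo = Min ?B"
      have finB: "finite ?B" using finA by auto
      have lo: "lo \<in> ?B" unfolding lo_def using False finB by (intro Min_in) auto
      have "?B \<subseteq> {lo..<lo + R}"
      proof
        fix i assume i: "i \<in> ?B"
        have "lo \<le> i" unfolding lo_def using finB i by (intro Min_le) auto
        moreover have "i < lo + R"
        proof (rule ccontr)
          assume "\<not> i < lo + R"
          hence "P ^ (lo + R) \<le> P ^ i" using P by (intro power_increasing) auto
          hence "c * P ^ (lo + R) \<le> c * x'" using i \<open>0 < c\<close> by (intro mult_left_mono) auto
          also have "\<dots> \<le> 2 ^ R" using that by (simp add: mult_ac)
          also have "\<dots> \<le> P ^ R" using P by (intro power_mono) auto
          finally have "c * P ^ lo * P ^ R \<le> 1 * P ^ R" by (simp add: power_add mult_ac)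
          hence "c * P ^ lo \<le> 1" by (rule mult_right_le_imp_le) (use P in auto)
          thus False using lo by auto
        qed
        ultimately show "i \<in> {lo..<lo + R}" by simp
      qed
      from card_mono[OF _ this] show ?thesis by simp
    next
      case True
      thus ?thesis by (simp only: card.empty)
    qed
    finally show ?thesis by simp
  qed
  have "real (card {h \<in> mb_le m p x. y < real h}) = (\<Sum>h\<in>mb_le m p x. g (1 / y * real h))"
    using assms(2) by (simp add: g_def sum.If_cases Int_def)
  also have "\<dots> \<le> real R * real K ^ (m - 1)"
    using sum_mb_le_bound[of "2 ^ R" g "real R" "m - 1" "1 / y" x K] one assms
    by (auto simp: field_simps)
  finally show ?thesis .
qed

end

section \<open>Exponential sums over the semigroup\<close>

lemma one_minus_cos: "1 - cos x = 2 * (sin (x / 2))\<^sup>2" for x :: real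
  using cos_double_sin[of "x / 2"] by simp

text \<open>With y = |x| / 2 at most 2 (from pi < 4), the cubic Taylor bound gives sin y \<ge> y -
  y^3/6 \<ge> y/3; then 2 (y/3)^2 = x^2/18.\<close>

lemma one_minus_cos_ge:
  fixes x :: real
  assumes "\<bar>x\<bar> \<le> pi"
  shows "x\<^sup>2 / 18 \<le> 1 - cos x"
proof -
  define y where "y = \<bar>x\<bar> / 2"
  have y: "0 \<le> y" "y \<le> 2" using assms pi_less_4 by (auto simp: y_def)
  have "\<bar>sin y - y\<bar> \<le> inverse 6 * \<bar>y\<bar> ^ 3"
    using Maclaurin_sin_bound[of y 3] by (simp add: numeral_3_eq_3 sin_coeff_def fact_reduce)
  moreover have "inverse 6 * \<bar>y\<bar> ^ 3 = y ^ 3 / 6" using y by simp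
  ultimately have "y - y ^ 3 / 6 \<le> sin y" by linarith
  moreover have "y ^ 3 \<le> 2\<^sup>2 * y"
    using y mult_right_mono[of "y\<^sup>2" "2\<^sup>2" y] power_mono[of y 2 2] by (simp add: power3_eq_cube power2_eq_square)
  ultimately have "y / 3 \<le> sin y" by simp
  hence "(y / 3)\<^sup>2 \<le> (sin y)\<^sup>2" using y by (intro power_mono) auto
  moreover have "1 - cos x = 2 * (sin y)\<^sup>2"
    using one_minus_cos[of "\<bar>x\<bar>"] by (simp add: y_def abs_if split: if_splits)
  ultimately show ?thesis by (simp add: y_def power_divide)
qed

lemma one_minus_cos_le: "1 - cos x \<le> x\<^sup>2 / 2" for x :: real
proof -
  have "(sin (x / 2))\<^sup>2 \<le> (x / 2)\<^sup>2"
    using abs_sin_x_le_abs_x abs_le_square_iff by blast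
  thus ?thesis using one_minus_cos[of x] by (simp add: power_divide)
qed

lemma power_le_fact_exp: "(x::real) ^ k \<le> fact k * exp x" if "0 \<le> x"
proof -
  have "x ^ k / fact k \<le> exp x"
  proof -
    have "(\<Sum>i\<in>{k}. x ^ i / fact i) \<le> (\<Sum>i. x ^ i / fact i)"
      using that summable_exp[of x] by (intro sum_le_suminf) (auto simp: field_simps)
    thus ?thesis by (simp add: exp_def field_simps)
  qed
  thus ?thesis by (simp add: field_simps)
qed

lemma power_mult_exp_bound:
  fixes x c :: real
  assumes "0 < c" "0 \<le> x"
  shows "x ^ k * exp (- (c * x)) \<le> fact k / c ^ k"
proof -
  have "(c * x) ^ k \<le> fact k * exp (c * x)" using assms by (intro power_le_fact_exp) auto
  hence "c ^ k * x ^ k * exp (- (c * x)) \<le> fact k * exp (c * x) * exp (- (c * x))"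
    by (intro mult_right_mono) (auto simp: power_mult_distrib)
  thus ?thesis using assms by (simp add: field_simps exp_minus)
qed

text \<open>Dominating by a Cauchy density replaces Gaussian moments by integrals with the
  elementary antiderivative arctan.\<close>

lemma gaussian_power_bound:
  fixes u :: real
  assumes "0 \<le> u"
  shows "u ^ k * exp (- u\<^sup>2) \<le> (2 + fact k + fact (Suc k)) / (1 + u\<^sup>2)"
proof -
  define v where "v = u\<^sup>2"
  have v: "0 \<le> v" by (simp add: v_def)
  have "u ^ k \<le> 1 + v ^ k"
  proof (cases "u \<le> 1")
    case True
    thus ?thesis using assms power_le_one[of u k] v by (simp add: add_increasing2)
  next
    case False
    hence "u ^ k \<le> u ^ (2 * k)" by (intro power_increasing) auto
    thus ?thesis by (simp add: v_def power_mult)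
  qed
  hence "u ^ k * (1 + v) \<le> (1 + v ^ k) * (1 + v)" using v by (intro mult_right_mono) auto
  also have "\<dots> = 1 + v + v ^ k + v ^ Suc k" by (simp add: algebra_simps)
  also have "\<dots> \<le> exp v + exp v + fact k * exp v + fact (Suc k) * exp v"
    using v by (intro add_mono power_le_fact_exp) (auto simp: one_le_exp_iff intro: order.trans[OF _ exp_ge_add_one_self])
  finally have "u ^ k * (1 + v) \<le> (2 + fact k + fact (Suc k)) * exp v" by (simp add: algebra_simps)
  hence "u ^ k * (1 + v) * exp (- v) \<le> (2 + fact k + fact (Suc k)) * exp v * exp (- v)"
    by (intro mult_right_mono) auto
  hence "u ^ k * exp (- v) * (1 + v) \<le> (2 + fact k + fact (Suc k)) * (exp v * exp (- v))"
    by (simp only: mult_ac)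
  hence "u ^ k * exp (- v) * (1 + v) \<le> 2 + fact k + fact (Suc k)"
    by (simp only: exp_minus_inverse mult_1_right)
  moreover have "0 < 1 + v" using v by simp
  ultimately show ?thesis unfolding v_def[symmetric] by (simp add: pos_le_divide_eq)
qed

lemma integral_cauchy_density_le:
  fixes G b :: real
  assumes "0 < G" "0 \<le> b"
  shows "(\<lambda>t. 1 / (1 + G * t\<^sup>2)) integrable_on {0..b}"
    and "integral {0..b} (\<lambda>t. 1 / (1 + G * t\<^sup>2)) \<le> 2 / sqrt G"
proof -
  have "((\<lambda>t. arctan (sqrt G * t) / sqrt G) has_real_derivative 1 / (1 + G * t\<^sup>2)) (at t within {0..b})" for t
  proof -
    have "((\<lambda>t. arctan (sqrt G * t) / sqrt G) has_real_derivative
        inverse (1 + (sqrt G * t)\<^sup>2) * sqrt G / sqrt G) (at t within {0..b})"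
      by (intro DERIV_cdivide DERIV_chain2[OF DERIV_arctan] DERIV_cmult_Id)
    thus ?thesis using assms by (simp add: power_mult_distrib inverse_eq_divide)
  qed
  hence *: "((\<lambda>t. 1 / (1 + G * t\<^sup>2)) has_integral
      (arctan (sqrt G * b) / sqrt G - arctan (sqrt G * 0) / sqrt G)) {0..b}"
    using assms by (intro fundamental_theorem_of_calculus) (auto simp: has_real_derivative_iff_has_vector_derivative)
  thus "(\<lambda>t. 1 / (1 + G * t\<^sup>2)) integrable_on {0..b}" by blast
  have "arctan (sqrt G * b) \<le> 2" using arctan_ubound[of "sqrt G * b"] pi_less_4 by simp
  thus "integral {0..b} (\<lambda>t. 1 / (1 + G * t\<^sup>2)) \<le> 2 / sqrt G"
    using integral_unique[OF *] assms by (simp add: divide_right_mono)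
qed

section \<open>Cosine sums along one base and the map t -> p t on the circle\<close>

lemma cos_le_cos_if_away:
  fixes x a :: real
  assumes "0 \<le> a" "a \<le> pi" "a \<le> x" "x \<le> 2 * pi - a"
  shows "cos x \<le> cos a"
proof (cases "x \<le> pi")
  case True
  thus ?thesis using assms by (intro cos_monotone_0_pi_le) auto
next
  case False
  have "cos x = cos (2 * pi - x)" by (simp add: cos_diff)
  also have "\<dots> \<le> cos a" using assms False by (intro cos_monotone_0_pi_le) auto
  finally show ?thesis .
qed

text \<open>Cut the circle into p arcs, each mapped onto the whole circle by t -> p t. The factor
  \<open>G\<close> sees only the image, and \<open>f\<close> is replaced by its mean over the p
  preimages: the transfer operator of the dilation.\<close>

lemma integral_dilate_periodic:
  fixes f G :: "real \<Rightarrow> real"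
  assumes f: "continuous_on UNIV f" and G: "continuous_on UNIV G"
    and per: "\<And>x. G (x + 2 * pi) = G x" and p: "0 < p"
  shows "integral {0..2*pi} (\<lambda>t. f t * G (real p * t)) =
    integral {0..2*pi} (\<lambda>u. (\<Sum>r<p. f ((u + 2 * pi * real r) / real p)) / real p * G u)"
proof -
  have perr: "G (x + 2 * pi * real r) = G x" for x and r :: nat
  proof (induction r)
    case (Suc r)
    have "G (x + 2 * pi * real (Suc r)) = G ((x + 2 * pi * real r) + 2 * pi)" by (simp add: algebra_simps)
    thus ?case using per Suc by simp
  qed simp
  let ?g = "\<lambda>t. f t * G (real p * t)"
  have "continuous_on {0..2*pi} ?g"
    by (intro continuous_intros continuous_on_compose2[OF f] continuous_on_compose2[OF G]) auto
  \<comment> \<open>One antiderivative on the whole circle makes the integrals over the arcs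
    telescope.\<close>
  then obtain F where F: "\<forall>u\<in>{0..2*pi}. \<forall>v\<in>{0..2*pi}. u \<le> v \<longrightarrow> (?g has_integral (F v - F u)) {u..v}"
    using antiderivative_integral_continuous by blast
  define x where "x = (\<lambda>r::nat. 2 * pi * real r / real p)"
  have piece: "((\<lambda>u. f ((u + 2 * pi * real r) / real p) / real p * G u) has_integral (F (x (Suc r)) - F (x r))) {0..2*pi}"
    if "r < p" for r
  proof -
    have bnd: "0 \<le> x r" "x r \<le> x (Suc r)" "x (Suc r) \<le> 2 * pi"
    proof -
      show "0 \<le> x r" "x r \<le> x (Suc r)" using p by (auto simp: x_def divide_simps)
      have "real (Suc r) / real p \<le> 1" using that p by (simp add: divide_simps)
      hence "2 * pi * (real (Suc r) / real p) \<le> 2 * pi * 1" by (intro mult_left_mono) auto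
      thus "x (Suc r) \<le> 2 * pi" by (simp add: x_def)
    qed
    have "(?g has_integral (F (x (Suc r)) - F (x r))) (cbox (x r) (x (Suc r)))"
      using F bnd by auto
    from has_integral_affinity[OF this, of "1 / real p" "x r"] p
    have "((\<lambda>u. ?g (1 / real p * u + x r)) has_integral (real p * (F (x (Suc r)) - F (x r))))
        ((\<lambda>u. real p * u - real p * x r) ` {x r..x (Suc r)})"
      by simp
    moreover have "(\<lambda>u. real p * u - real p * x r) ` {x r..x (Suc r)} = {0..2*pi}"
    proof -
      have "(\<lambda>u. real p * u - real p * x r) ` {x r..x (Suc r)}
          = (\<lambda>u. real p * u + (- (real p * x r))) ` {x r..x (Suc r)}" by simp
      also have "\<dots> = {0..2*pi}"
        using p bnd by (subst image_affinity_atLeastAtMost) (auto simp: x_def field_simps)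
      finally show ?thesis .
    qed
    ultimately have 1: "((\<lambda>u. ?g (1 / real p * u + x r)) has_integral (real p * (F (x (Suc r)) - F (x r)))) {0..2*pi}"
      by simp
    have 2: "?g (1 / real p * u + x r) = f ((u + 2 * pi * real r) / real p) * G u" for u
    proof -
      have "1 / real p * u + x r = (u + 2 * pi * real r) / real p" by (simp add: x_def add_divide_distrib)
      moreover have "real p * ((u + 2 * pi * real r) / real p) = u + 2 * pi * real r" using p by simp
      ultimately show ?thesis using perr by simp
    qed
    from has_integral_mult_right[OF 1[unfolded 2], of "1 / real p"] p
    show ?thesis by (simp add: mult_ac)
  qed
  have "((\<lambda>u. \<Sum>r<p. f ((u + 2 * pi * real r) / real p) / real p * G u) has_integral
      (\<Sum>r<p. F (x (Suc r)) - F (x r))) {0..2*pi}"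
    using piece by (intro has_integral_sum) auto
  also have "(\<Sum>r<p. F (x (Suc r)) - F (x r)) = F (2 * pi) - F 0"
    using p by (subst sum_lessThan_telescope[of "\<lambda>r. F (x r)"]) (simp add: x_def)
  finally have A: "integral {0..2*pi} (\<lambda>u. \<Sum>r<p. f ((u + 2 * pi * real r) / real p) / real p * G u) = F (2 * pi) - F 0"
    by (rule integral_unique)
  have "(?g has_integral (F (2 * pi) - F 0)) {0..2*pi}" using F by auto
  hence "integral {0..2*pi} ?g = F (2 * pi) - F 0" by (rule integral_unique)
  thus ?thesis using A by (simp add: sum_divide_distrib sum_distrib_right)
qed

text \<open>Among the \<open>p\<close> preimages of a point under \<open>t \<mapsto> p t\<close> on the circle, at most one lies within
  \<open>\<pi>/p\<close> of the origin.\<close>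
lemma sum_exp_cos_preimages_le:
  fixes c u :: real
  assumes c: "0 \<le> c" and p: "2 \<le> p" and u: "0 \<le> u" "u \<le> 2 * pi"
  shows "(\<Sum>r<p. exp (- c * (1 - cos ((u + 2 * pi * real r) / real p))))
    \<le> 1 + real (p - 1) * exp (- c * (1 - cos (pi / real p)))"
proof -
  define x where "x = (\<lambda>r. (u + 2 * pi * real r) / real p)"
  define e where "e = (\<lambda>r. exp (- c * (1 - cos (x r))))"
  \<comment> \<open>The preimage closest to the origin modulo 2 pi: for u > pi it is the last one,
    just below 2 pi.\<close>
  define r0 where "r0 = (if u \<le> pi then 0 else p - 1)"
  have r0: "r0 < p" using p by (auto simp: r0_def)
  have one: "e r \<le> 1" for r unfolding e_def using c by simp
  have far: "e r \<le> exp (- c * (1 - cos (pi / real p)))" if "r \<in> {..<p} - {r0}" for r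
  proof -
    have "pi \<le> u + 2 * pi * real r \<and> u + 2 * pi * real r \<le> 2 * pi * real p - pi"
    proof (cases "u \<le> pi")
      case True
      hence "1 \<le> real r" "real r + 1 \<le> real p" using that by (auto simp: r0_def)
      hence "2 * pi * 1 \<le> 2 * pi * real r" "2 * pi * (real r + 1) \<le> 2 * pi * real p"
        by (intro mult_left_mono; simp)+
      moreover have "2 * pi * (real r + 1) = 2 * pi * real r + 2 * pi" by (simp add: algebra_simps)
      ultimately show ?thesis using True u pi_gt_zero by linarith
    next
      case False
      have "r \<noteq> p - 1" "r < p" using that False by (auto simp: r0_def)
      hence "real r + 2 \<le> real p" by linarith
      hence "2 * pi * (real r + 2) \<le> 2 * pi * real p" by (intro mult_left_mono) auto
      moreover have "0 \<le> 2 * pi * real r" by simp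
      moreover have "2 * pi * (real r + 2) = 2 * pi * real r + 4 * pi" by (simp add: algebra_simps)
      ultimately show ?thesis using False u pi_gt_zero by linarith
    qed
    hence "pi / real p \<le> x r" "x r \<le> (2 * pi * real p - pi) / real p"
      unfolding x_def by (auto intro!: divide_right_mono)
    moreover have "(2 * pi * real p - pi) / real p = 2 * pi - pi / real p"
      using p by (simp add: diff_divide_distrib)
    moreover have "pi / real p \<le> pi" using p by (simp add: field_simps)
    ultimately have "cos (x r) \<le> cos (pi / real p)" by (intro cos_le_cos_if_away) auto
    thus ?thesis unfolding e_def using c by (auto intro!: mult_left_mono)
  qed
  have "(\<Sum>r<p. e r) = e r0 + (\<Sum>r\<in>{..<p} - {r0}. e r)"
    using r0 by (subst sum.remove[of _ r0]) auto
  also have "\<dots> \<le> 1 + real (card ({..<p} - {r0})) * exp (- c * (1 - cos (pi / real p)))"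
    using one far by (intro add_mono sum_bounded_above) auto
  finally show ?thesis using r0 by (simp add: e_def x_def)
qed

definition cos_deficit :: "nat \<Rightarrow> nat \<Rightarrow> real \<Rightarrow> real" where
  "cos_deficit p I t = (\<Sum>i<I. 1 - cos (real p ^ i * t))"

lemma continuous_cos_deficit [continuous_intros]:
  fixes f :: "real \<Rightarrow> real"
  shows "continuous_on A f \<Longrightarrow> continuous_on A (\<lambda>x. cos_deficit p I (f x))"
  unfolding cos_deficit_def by (intro continuous_intros)

lemma cos_nat_periodic: "cos (real n * (x + 2 * pi)) = cos (real n * x)"
  using cos.plus_of_nat[of "real n * x" n] by (simp add: algebra_simps)

lemma cos_deficit_periodic: "cos_deficit p I (x + 2 * pi) = cos_deficit p I x"
  unfolding cos_deficit_def by (simp only: of_nat_power[symmetric] cos_nat_periodic)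

text \<open>Peeling off the term i = 0 leaves a function of p t, and averaging over preimages costs
  one factor. For large c that factor tends to 1/p, so the bound is nearly p^(-I), the order of
  length of the arc on which every p^i t with i < I stays small.\<close>

lemma integral_exp_cos_deficit_le:
  fixes c :: real
  assumes c: "0 \<le> c" and p: "2 \<le> p"
  shows "integral {0..2*pi} (\<lambda>t. exp (- c * cos_deficit p I t))
    \<le> 2 * pi * ((1 + real (p - 1) * exp (- c * (1 - cos (pi / real p)))) / real p) ^ I"
proof (induction I)
  case 0
  thus ?case by (simp add: cos_deficit_def)
next
  case (Suc I)
  define \<rho> where "\<rho> = (1 + real (p - 1) * exp (- c * (1 - cos (pi / real p)))) / real p"
  define f where "f = (\<lambda>t. exp (- c * (1 - cos t)))"
  define G where "G = (\<lambda>t. exp (- c * cos_deficit p I t))"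
  have step: "cos_deficit p (Suc I) t = (1 - cos t) + cos_deficit p I (real p * t)" for t
    unfolding cos_deficit_def by (subst sum.lessThan_Suc_shift) (simp add: mult_ac)
  hence "(\<lambda>t. exp (- c * cos_deficit p (Suc I) t)) = (\<lambda>t. f t * G (real p * t))"
    unfolding f_def G_def exp_add[symmetric] step by (simp only: distrib_left)
  hence "integral {0..2*pi} (\<lambda>t. exp (- c * cos_deficit p (Suc I) t))
     = integral {0..2*pi} (\<lambda>u. (\<Sum>r<p. f ((u + 2 * pi * real r) / real p)) / real p * G u)"
    using p by (simp only:, intro integral_dilate_periodic)
      (auto simp: f_def G_def cos_deficit_periodic intro!: continuous_intros)
  also have "\<dots> \<le> integral {0..2*pi} (\<lambda>u. \<rho> * G u)"
  proof (rule integral_le)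
    show "(\<lambda>u. (\<Sum>r<p. f ((u + 2 * pi * real r) / real p)) / real p * G u) integrable_on {0..2*pi}"
      unfolding f_def G_def using p
      by (intro integrable_continuous_real continuous_intros) auto
    show "(\<lambda>u. \<rho> * G u) integrable_on {0..2*pi}"
      unfolding G_def by (intro integrable_continuous_real continuous_intros)
    fix u assume "u \<in> {0..2*pi}"
    hence "(\<Sum>r<p. f ((u + 2 * pi * real r) / real p)) / real p \<le> \<rho>"
      unfolding \<rho>_def f_def using sum_exp_cos_preimages_le[OF c p, of u]
      by (intro divide_right_mono) auto
    thus "(\<Sum>r<p. f ((u + 2 * pi * real r) / real p)) / real p * G u \<le> \<rho> * G u"
      by (intro mult_right_mono) (auto simp: G_def)
  qed
  also have "\<dots> = \<rho> * integral {0..2*pi} G" by simp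
  also have "\<dots> \<le> \<rho> * (2 * pi * \<rho> ^ I)"
    using Suc unfolding \<rho>_def[symmetric] G_def
    by (intro mult_left_mono) (auto simp: \<rho>_def)
  finally show ?case unfolding \<rho>_def[symmetric] by (simp add: mult_ac)
qed

lemma integral_exp_cos_deficit_dilate:
  assumes "0 < q"
  shows "integral {0..2*pi} (\<lambda>t. exp (- c * cos_deficit p I (real q * t)))
    = integral {0..2*pi} (\<lambda>t. exp (- c * cos_deficit p I t))"
proof -
  have "continuous_on UNIV (\<lambda>t. exp (- c * cos_deficit p I t))" by (intro continuous_intros)
  thus ?thesis
    using integral_dilate_periodic[of "\<lambda>_. 1" "\<lambda>t. exp (- c * cos_deficit p I t)" q] assms
    by (simp add: cos_deficit_periodic)
qed

section \<open>Pointwise lower bounds away from the origin from two coprime bases\<close>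

text \<open>If the distance of \<open>x\<close> to the nearest integer is below \<open>1/(2p)\<close>, multiplication by \<open>p\<close> multiplies it by \<open>p\<close>.\<close>
lemma exists_power_away:
  fixes x :: real and p :: nat
  assumes p: "2 \<le> p" and e: "0 < \<bar>x - of_int (round x)\<bar>"
  shows "\<exists>i. real p ^ i * (2 * \<bar>x - of_int (round x)\<bar>) \<le> 1 \<and> cos (2 * pi * (real p ^ i * x)) \<le> cos (pi / real p)"
proof -
  define n where "n = round x"
  define e where "e = \<bar>x - of_int n\<bar>"
  have e0: "0 < e" using assms by (simp add: e_def n_def)
  have e1: "e \<le> 1 / 2" using of_int_round_abs_le[of x] by (simp add: e_def n_def abs_minus_commute)
  have "1 < real p" using p by simp
  then obtain N where "1 / e < real p ^ N" using real_arch_pow by blast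
  hence "1 \<le> real p ^ N * e" using e0 by (simp add: field_simps)
  moreover have "1 / (2 * real p) \<le> 1" using p by (simp add: field_simps)
  ultimately have ex: "1 / (2 * real p) \<le> real p ^ N * e" by linarith
  \<comment> \<open>The first such exponent overshoots by a factor of at most p, which keeps p^i e
    between 1/(2p) and 1/2: the angle lies between pi/p and pi.\<close>
  define i where "i = (LEAST i. 1 / (2 * real p) \<le> real p ^ i * e)"
  have i: "1 / (2 * real p) \<le> real p ^ i * e" unfolding i_def using ex by (rule LeastI)
  have up: "real p ^ i * e \<le> 1 / 2"
  proof (cases i)
    case 0
    thus ?thesis using e1 by simp
  next
    case (Suc k)
    have "\<not> 1 / (2 * real p) \<le> real p ^ k * e" using Suc not_less_Least[of k "\<lambda>i. 1 / (2 * real p) \<le> real p ^ i * e"] unfolding i_def by simp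
    hence "real p * (real p ^ k * e) \<le> real p * (1 / (2 * real p))" by (intro mult_left_mono) auto
    thus ?thesis using p Suc by (simp add: mult_ac)
  qed
  have "cos (2 * pi * (real p ^ i * x)) = cos (2 * pi * (real p ^ i * e))"
  proof -
    have "2 * pi * (real p ^ i * x) = 2 * pi * (real p ^ i * (x - of_int n)) + of_int (int p ^ i * n) * (2 * pi)"
      by (simp add: algebra_simps)
    hence "cos (2 * pi * (real p ^ i * x)) = cos (2 * pi * (real p ^ i * (x - of_int n)))"
      using cos.plus_of_int[of "2 * pi * (real p ^ i * (x - of_int n))" "int p ^ i * n"] by simp
    also have "\<dots> = cos \<bar>2 * pi * (real p ^ i * (x - of_int n))\<bar>" by simp
    also have "\<bar>2 * pi * (real p ^ i * (x - of_int n))\<bar> = 2 * pi * (real p ^ i * e)"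
      by (simp add: e_def abs_mult)
    finally show ?thesis .
  qed
  also have "\<dots> \<le> cos (pi / real p)"
  proof (intro cos_monotone_0_pi_le)
    have "2 * pi * (1 / (2 * real p)) \<le> 2 * pi * (real p ^ i * e)" using i by (intro mult_left_mono) auto
    thus "pi / real p \<le> 2 * pi * (real p ^ i * e)" by simp
    have "2 * pi * (real p ^ i * e) \<le> 2 * pi * (1 / 2)" using up by (intro mult_left_mono) auto
    thus "2 * pi * (real p ^ i * e) \<le> pi" by simp
  qed auto
  finally show ?thesis using up unfolding e_def n_def by (intro exI[of _ i]) simp
qed

text \<open>If some \<open>q\<^sup>j y\<close> and some \<open>p\<^sup>i y\<close> are both extremely close to integers, then so is \<open>y\<close>, because the
  denominators are coprime.  Otherwise every row or every column contains a term that is bounded away.\<close>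
lemma many_terms_away:
  fixes y Y :: real and p q :: nat
  assumes p: "2 \<le> p" and q: "2 \<le> q" and cop: "coprime p q" and Y: "1 \<le> Y"
    and A: "real p ^ A \<le> Y" "real q ^ A \<le> Y"
    and y: "1 / (2 * Y ^ 8) \<le> y" "y \<le> 1 / 2"
  shows "(\<forall>j<A. \<exists>i. real p ^ i * real q ^ j \<le> Y ^ 8 \<and> cos (2 * pi * (real p ^ i * (real q ^ j * y))) \<le> cos (pi / real p))
    \<or> (\<forall>i<A. \<exists>j. real p ^ i * real q ^ j \<le> Y ^ 8 \<and> cos (2 * pi * (real q ^ j * (real p ^ i * y))) \<le> cos (pi / real q))"
proof -
  have Y8: "0 < Y ^ 8" using Y by simp
  have y0: "0 < y" using y Y8 by (meson less_le_trans divide_pos_pos mult_pos_pos zero_less_numeral zero_less_one)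
  have pA: "real p ^ i \<le> Y" if "i < A" for i
    using p that by (intro order.trans[OF power_increasing A(1)]) auto
  have qA: "real q ^ i \<le> Y" if "i < A" for i
    using q that by (intro order.trans[OF power_increasing A(2)]) auto
  define dist where "dist = (\<lambda>x::real. \<bar>x - of_int (round x)\<bar>)"
  \<comment> \<open>A distance of at least 1/(2 Y^4) forces the stopping exponent to satisfy a^i
    \<le> Y^4, so the product with b^j \<le> Y stays below Y^8.\<close>
  have good: "\<exists>i. real a ^ i * real b ^ j \<le> Y ^ 8 \<and> cos (2 * pi * (real a ^ i * (real b ^ j * y))) \<le> cos (pi / real a)"
    if a: "2 \<le> a" and b: "real b ^ j \<le> Y" and ds: "1 / (2 * Y ^ 4) \<le> dist (real b ^ j * y)" for a b j
  proof -
    have Y4: "0 < 1 / (2 * Y ^ 4)" using Y by simp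
    hence "0 < dist (real b ^ j * y)" using ds by linarith
    from exists_power_away[OF a this[unfolded dist_def]] obtain i
      where i: "real a ^ i * (2 * dist (real b ^ j * y)) \<le> 1"
        "cos (2 * pi * (real a ^ i * (real b ^ j * y))) \<le> cos (pi / real a)" unfolding dist_def by blast
    have "real a ^ i * (2 * (1 / (2 * Y ^ 4))) \<le> real a ^ i * (2 * dist (real b ^ j * y))"
      using ds by (intro mult_left_mono) auto
    with i have "real a ^ i / Y ^ 4 \<le> 1" by simp
    hence "real a ^ i \<le> Y ^ 4" using Y by (simp add: field_simps)
    hence "real a ^ i * real b ^ j \<le> Y ^ 4 * Y" using b Y by (intro mult_mono) auto
    also have "\<dots> = Y ^ 5" by (simp add: power_Suc[symmetric] mult.commute del: power_Suc)
    also have "\<dots> \<le> Y ^ 8" using Y by (intro power_increasing) auto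
    finally show ?thesis using i by blast
  qed
  show ?thesis
  \<comment> \<open>Small y: no q^j y with j < A passes 1/2, so its distance to the integers is q^j
    y itself and y \<ge> 1/(2 Y^8) bounds the exponent of p. Large y: one bad row together with one
    bad column gives a contradiction.\<close>
  proof (cases "y \<le> 1 / (2 * Y ^ 4)")
    case True
    have "\<exists>i. real p ^ i * real q ^ j \<le> Y ^ 8 \<and> cos (2 * pi * (real p ^ i * (real q ^ j * y))) \<le> cos (pi / real p)"
      if j: "j < A" for j
    proof -
      have x0: "0 < real q ^ j * y" using q y0 by simp
      show ?thesis
      proof (cases "real q ^ j * y < 1 / 2")
        case less: True
        have "round (real q ^ j * y) = 0" using x0 less unfolding round_def by (intro floor_unique) auto
        with exists_power_away[OF p, of "real q ^ j * y"] x0 obtain i where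
          i: "real p ^ i * (2 * (real q ^ j * y)) \<le> 1" "cos (2 * pi * (real p ^ i * (real q ^ j * y))) \<le> cos (pi / real p)"
          by auto
        have "real p ^ i * real q ^ j * (2 * (1 / (2 * Y ^ 8))) \<le> real p ^ i * real q ^ j * (2 * y)"
          using y by (intro mult_left_mono) auto
        with i have "real p ^ i * real q ^ j / Y ^ 8 \<le> 1" by (simp add: mult_ac)
        hence "real p ^ i * real q ^ j \<le> Y ^ 8" using Y8 by (simp add: field_simps)
        with i show ?thesis by blast
      next
        \<comment> \<open>Only q^j y = 1/2 can occur here. It is separate because
          \<open>round\<close> sends 1/2 to 1, though the distance is still 1/2.\<close>
        case False
        have "real q ^ j * y \<le> Y * (1 / (2 * Y ^ 4))" using qA[OF j] True Y y0 by (intro mult_mono) auto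
        also have "\<dots> = 1 / (2 * Y ^ 3)" using Y by (simp add: power3_eq_cube field_simps eval_nat_numeral)
        also have "\<dots> \<le> 1 / (2 * 1)" using Y by (intro divide_left_mono mult_left_mono) auto
        finally have eq: "real q ^ j * y = 1 / 2" using False by simp
        have "dist (1 / 2) = 1 / 2" by (simp add: dist_def round_def)
        moreover have "1 / (2 * Y ^ 4) \<le> 1 / (2 * 1)" using Y by (intro divide_left_mono mult_left_mono) auto
        ultimately have "1 / (2 * Y ^ 4) \<le> dist (real q ^ j * y)" unfolding eq by simp
        thus ?thesis using qA[OF j] by (intro good[OF p])
      qed
    qed
    thus ?thesis by blast
  next
    case large: False
    show ?thesis
    proof (rule ccontr)
      assume "\<not> ?thesis"
      then obtain i j where ij: "i < A" "j < A"
        and nj: "\<not> (\<exists>i. real p ^ i * real q ^ j \<le> Y ^ 8 \<and> cos (2 * pi * (real p ^ i * (real q ^ j * y))) \<le> cos (pi / real p))"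
        and ni: "\<not> (\<exists>j. real q ^ j * real p ^ i \<le> Y ^ 8 \<and> cos (2 * pi * (real q ^ j * (real p ^ i * y))) \<le> cos (pi / real q))"
        by (auto simp: mult_ac)
      define a b where "a = round (real p ^ i * y)" and "b = round (real q ^ j * y)"
      have dq: "\<bar>real q ^ j * y - of_int b\<bar> < 1 / (2 * Y ^ 4)"
        using good[OF p qA[OF ij(2)]] nj unfolding dist_def b_def by (meson not_less)
      have dp: "\<bar>real p ^ i * y - of_int a\<bar> < 1 / (2 * Y ^ 4)"
        using good[OF q pA[OF ij(1)]] ni unfolding dist_def a_def by (meson not_less)
      have small: "Y * (1 / (2 * Y ^ 4)) \<le> 1 / 2"
      proof -
        have "Y * (1 / (2 * Y ^ 4)) = 1 / (2 * Y ^ 3)" using Y by (simp add: power3_eq_cube field_simps eval_nat_numeral)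
        also have "\<dots> \<le> 1 / (2 * 1)" using Y by (intro divide_left_mono mult_left_mono) auto
        finally show ?thesis by simp
      qed
      have p0: "0 < real p ^ i" "0 < real q ^ j" using p q by auto
      have "real p ^ i * \<bar>real q ^ j * y - of_int b\<bar> < real p ^ i * (1 / (2 * Y ^ 4))"
        using dq p0 by (intro mult_strict_left_mono) auto
      also have "\<dots> \<le> Y * (1 / (2 * Y ^ 4))" using pA[OF ij(1)] Y by (intro mult_right_mono) auto
      finally have 1: "\<bar>real p ^ i * (real q ^ j * y - of_int b)\<bar> < 1 / 2" using small by (simp add: abs_mult)
      have "real q ^ j * \<bar>real p ^ i * y - of_int a\<bar> < real q ^ j * (1 / (2 * Y ^ 4))"
        using dp p0 by (intro mult_strict_left_mono) auto
      also have "\<dots> \<le> Y * (1 / (2 * Y ^ 4))" using qA[OF ij(2)] Y by (intro mult_right_mono) auto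
      finally have 2: "\<bar>real q ^ j * (real p ^ i * y - of_int a)\<bar> < 1 / 2" using small by (simp add: abs_mult)
      \<comment> \<open>Eliminating y leaves an integer of absolute value below 1, hence q^j a = p^i
        b. Coprimality makes b divisible by q^j, and dividing by q^j shows that y itself is near the
        integer k.\<close>
      have "real_of_int (int q ^ j * a - int p ^ i * b)
        = real p ^ i * (real q ^ j * y - of_int b) - real q ^ j * (real p ^ i * y - of_int a)"
        by (simp add: algebra_simps)
      hence "\<bar>real_of_int (int q ^ j * a - int p ^ i * b)\<bar> < 1" using 1 2 by linarith
      hence "int q ^ j * a = int p ^ i * b" by linarith
      hence "int q ^ j dvd int p ^ i * b" by (metis dvd_triv_left)
      moreover have "coprime (int q ^ j) (int p ^ i)" using cop by (simp add: coprime_commute)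
      ultimately have "int q ^ j dvd b" by (simp add: coprime_dvd_mult_right_iff)
      then obtain k where k: "b = int q ^ j * k" by blast
      have "real q ^ j * \<bar>y - of_int k\<bar> = \<bar>real q ^ j * (y - of_int k)\<bar>" using p0 by (simp add: abs_mult)
      also have "\<dots> = \<bar>real q ^ j * y - of_int b\<bar>" by (simp add: k algebra_simps)
      finally have "real q ^ j * \<bar>y - of_int k\<bar> < 1 / (2 * Y ^ 4)" using dq by simp
      moreover have "1 * \<bar>y - of_int k\<bar> \<le> real q ^ j * \<bar>y - of_int k\<bar>"
        using q by (intro mult_right_mono) auto
      ultimately have yk: "\<bar>y - of_int k\<bar> < 1 / (2 * Y ^ 4)" by simp
      have "1 / (2 * Y ^ 4) \<le> 1 / (2 * 1)" using Y by (intro divide_left_mono mult_left_mono) auto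
      hence half: "\<bar>y - of_int k\<bar> < 1 / 2" using yk by simp
      \<comment> \<open>Since y \<le> 1/2, the integer k is at most 0; then y < 1/(2 Y^4), against
        the case assumption.\<close>
      have "k \<le> 0"
      proof (rule ccontr)
        assume "\<not> k \<le> 0"
        hence "1 \<le> real_of_int k" by simp
        thus False using half y(2) by linarith
      qed
      hence "real_of_int k \<le> 0" by simp
      thus False using yk large y0 by linarith
    qed
  qed
qed

definition semi_deficit :: "nat \<Rightarrow> (nat \<Rightarrow> nat) \<Rightarrow> real \<Rightarrow> real \<Rightarrow> real" where
  "semi_deficit m p X t = (\<Sum>h\<in>mb_le m p X. 1 - cos (real h * t))"

lemma semi_deficit_minus [simp]: "semi_deficit m p X (- t) = semi_deficit m p X t"
  unfolding semi_deficit_def by simp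

lemma continuous_semi_deficit [continuous_intros]:
  fixes f :: "real \<Rightarrow> real"
  shows "continuous_on A f \<Longrightarrow> continuous_on A (\<lambda>x. semi_deficit m p X (f x))"
  unfolding semi_deficit_def by (intro continuous_intros)

lemma semi_deficit_ge:
  assumes "H \<subseteq> mb_le m p X"
  shows "(\<Sum>h\<in>H. 1 - cos (real h * t)) \<le> semi_deficit m p X t"
  unfolding semi_deficit_def using assms by (intro sum_mono2) auto

lemma coprime_powers_inj:
  fixes p q :: nat
  assumes "1 < p" "1 < q" "coprime p q" and eq: "p ^ i * q ^ j = p ^ i' * q ^ j'"
  shows "i = i' \<and> j = j'"
proof -
  have "p ^ i dvd p ^ i' * q ^ j'" by (metis dvd_triv_left eq)
  hence "p ^ i dvd p ^ i'" using assms(3) by (simp add: coprime_dvd_mult_left_iff)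
  moreover have "p ^ i' dvd p ^ i * q ^ j" by (metis dvd_triv_left eq)
  hence "p ^ i' dvd p ^ i" using assms(3) by (simp add: coprime_dvd_mult_left_iff)
  ultimately have "p ^ i = p ^ i'" by (rule dvd_antisym)
  hence "i = i'" using assms(1) by (simp add: power_inject_exp)
  moreover from this have "q ^ j = q ^ j'" using eq assms(1) by simp
  hence "j = j'" using assms(2) by (simp add: power_inject_exp)
  ultimately show ?thesis by simp
qed

section \<open>Major arc, minor arcs and weighted integrals for the whole semigroup\<close>

context coprime_bases begin

text \<open>The two bounds of \<open>card_mb_le_bounds\<close> differ by a shift of the logarithm by
  the sum of the \<open>ln (p i)\<close>. Exceeding this shift by 1 makes the upper bound at X /
  window smaller than the lower bound at X.\<close>

definition window :: real where "window = exp ((\<Sum>i<m. ln (real (p i))) + 1)"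
text \<open>This is \<open>mb_kappa\<close> divided by ln d: the leading constant of the counting
  function.\<close>

definition mb_density :: real where "mb_density = 1 / (fact m * (\<Prod>i<m. ln (real (p i))))"

lemma window_ge_1: "1 \<le> window"
proof -
  have "0 \<le> (\<Sum>i<m. ln (real (p i)))" using ln_base_pos by (intro sum_nonneg) (simp add: less_imp_le)
  thus ?thesis by (simp add: window_def)
qed

lemma mb_density_pos: "0 < mb_density"
  unfolding mb_density_def using ln_base_pos by (intro divide_pos_pos mult_pos_pos prod_pos) auto

lemma card_mb_le_window:
  assumes m: "0 < m" and X: "window \<le> X"
  shows "mb_density * ln X ^ (m - 1) \<le> real (card {h \<in> mb_le m p X. X / window < real h})"
proof -
  define s where "s = (\<Sum>i<m. ln (real (p i)))"
  have s: "0 \<le> s" unfolding s_def using ln_base_pos by (intro sum_nonneg) (simp add: less_imp_le)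
  have w: "window > 0" "ln window = s + 1" by (auto simp: window_def s_def)
  have X1: "1 \<le> X" "0 < X" using window_ge_1 X by auto
  have Xw: "1 \<le> X / window" using X w by (simp add: field_simps)
  have l1: "1 \<le> ln X"
  proof -
    have "ln window \<le> ln X" using w(1) X X1 by (subst ln_le_cancel_iff) auto
    thus ?thesis using w s by simp
  qed
  have sub: "mb_le m p (X / window) \<subseteq> mb_le m p X"
  proof -
    have "X / window \<le> X / 1" using X1 window_ge_1 by (intro divide_left_mono) auto
    thus ?thesis by (auto simp: mb_le_def)
  qed
  have "{h \<in> mb_le m p X. X / window < real h} = mb_le m p X - mb_le m p (X / window)"
    by (auto simp: mb_le_def)
  hence "real (card {h \<in> mb_le m p X. X / window < real h})
      = real (card (mb_le m p X)) - real (card (mb_le m p (X / window)))"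
    using sub by (simp add: card_Diff_subset card_mono of_nat_diff)
  moreover have "mb_density * ln X ^ m \<le> real (card (mb_le m p X))"
    using card_mb_le_bounds(1)[of m X] X1 by (simp add: mb_density_def)
  moreover have "real (card (mb_le m p (X / window))) \<le> mb_density * (ln X - 1) ^ m"
  proof -
    have "ln (X / window) + s = ln X - 1" using X1 w by (simp add: ln_div)
    thus ?thesis using card_mb_le_bounds(2)[of m "X / window"] Xw by (simp add: mb_density_def s_def)
  qed
  moreover have "mb_density * ln X ^ (m - 1) \<le> mb_density * (ln X ^ m - (ln X - 1) ^ m)"
  proof (intro mult_left_mono)
    obtain k where k: "m = Suc k" using m by (cases m) auto
    have "(ln X - 1) ^ k \<le> ln X ^ k" using l1 by (intro power_mono) auto
    hence "(ln X - 1) * (ln X - 1) ^ k \<le> (ln X - 1) * ln X ^ k" using l1 by (intro mult_left_mono) auto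
    thus "ln X ^ (m - 1) \<le> ln X ^ m - (ln X - 1) ^ m" by (simp add: k algebra_simps)
  qed (use mb_density_pos in simp)
  ultimately show ?thesis by (simp add: right_diff_distrib)
qed

text \<open>On this arc every h \<le> X has |h t| \<le> pi, so \<open>one_minus_cos_ge\<close>
  applies; the elements of the window are within a constant factor of X and supply the quadratic
  term.\<close>

lemma semi_deficit_major:
  assumes m: "0 < m" and X: "window \<le> X" and t: "\<bar>t\<bar> \<le> pi / X"
  shows "mb_density / (18 * window\<^sup>2) * ln X ^ (m - 1) * (X * t)\<^sup>2 \<le> semi_deficit m p X t"
proof -
  have X0: "0 < X" using X window_ge_1 by linarith
  have w: "0 < window" using window_ge_1 by linarith
  define H where "H = {h \<in> mb_le m p X. X / window < real h}"
  have each: "(X * t)\<^sup>2 / (18 * window\<^sup>2) \<le> 1 - cos (real h * t)" if "h \<in> H" for h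
  proof -
    have h: "X / window < real h" "real h \<le> X" using that by (auto simp: H_def mb_le_def)
    have "\<bar>real h * t\<bar> \<le> X * (pi / X)" unfolding abs_mult using h t X0 by (intro mult_mono) auto
    hence "(real h * t)\<^sup>2 / 18 \<le> 1 - cos (real h * t)" using X0 by (intro one_minus_cos_ge) simp
    moreover have "(X / window)\<^sup>2 \<le> (real h)\<^sup>2" using h X0 w by (intro power_mono) auto
    hence "(X / window)\<^sup>2 * t\<^sup>2 / 18 \<le> (real h * t)\<^sup>2 / 18"
      unfolding power_mult_distrib by (intro divide_right_mono mult_right_mono) auto
    ultimately show ?thesis by (simp add: power_divide power_mult_distrib mult_ac)
  qed
  have "mb_density * ln X ^ (m - 1) * ((X * t)\<^sup>2 / (18 * window\<^sup>2)) \<le> real (card H) * ((X * t)\<^sup>2 / (18 * window\<^sup>2))"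
    using card_mb_le_window[OF m X] unfolding H_def by (intro mult_right_mono) auto
  also have "\<dots> \<le> (\<Sum>h\<in>H. 1 - cos (real h * t))" using each by (intro sum_bounded_below)
  also have "\<dots> \<le> semi_deficit m p X t" by (intro semi_deficit_ge) (auto simp: H_def)
  finally show ?thesis by (simp add: mult_ac)
qed

lemma two_base_product_mem:
  assumes "2 \<le> m" shows "p 0 ^ i * p 1 ^ j \<in> mb_S m p"
proof -
  have "p 0 ^ i * p 1 ^ j = (\<Prod>k<2. p k ^ (if k = 0 then i else j))"
    by (simp add: numeral_2_eq_2)
  hence "p 0 ^ i * p 1 ^ j \<in> mb_S 2 p"
    unfolding mb_S_def by (intro CollectI exI[of _ "\<lambda>k. if k = 0 then i else j"]) simp
  thus ?thesis using mb_S_mono[OF assms] by blast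
qed

lemma two_bases:
  assumes "2 \<le> m"
  shows "2 \<le> p 0" "2 \<le> p 1" "coprime (p 0) (p 1)"
  using base_gt_1[of 0] base_gt_1[of 1] bases_coprime[of 0 1] assms by auto

lemma semi_deficit_pairs:
  assumes m: "2 \<le> m" and fin: "finite Q"
    and Q: "\<And>i j. (i, j) \<in> Q \<Longrightarrow> real (p 0) ^ i * real (p 1) ^ j \<le> X"
  shows "(\<Sum>(i,j)\<in>Q. 1 - cos (real (p 0) ^ i * real (p 1) ^ j * t)) \<le> semi_deficit m p X t"
proof -
  let ?g = "\<lambda>(i,j). p 0 ^ i * p 1 ^ j"
  have inj: "inj_on ?g Q"
  proof (rule inj_onI)
    fix x y assume "?g x = ?g y"
    hence "p 0 ^ fst x * p 1 ^ snd x = p 0 ^ fst y * p 1 ^ snd y" by (simp add: case_prod_unfold)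
    from coprime_powers_inj[OF _ _ _ this] two_bases[OF m] show "x = y" by (simp add: prod_eq_iff)
  qed
  have "?g ` Q \<subseteq> mb_le m p X"
    using Q two_base_product_mem[OF m] by (fastforce simp: mb_le_def)
  from semi_deficit_ge[OF this, of t] show ?thesis
    by (subst (asm) sum.reindex[OF inj]) (simp add: case_prod_unfold)
qed

lemma semi_deficit_ge_card:
  assumes m: "2 \<le> m" and inj: "inj_on e {..<A}"
    and le: "\<And>k. k < A \<Longrightarrow> real (p 0) ^ fst (e k) * real (p 1) ^ snd (e k) \<le> X"
    and away: "\<And>k. k < A \<Longrightarrow> cos (real (p 0) ^ fst (e k) * real (p 1) ^ snd (e k) * t) \<le> 1 - \<kappa>"
  shows "real A * \<kappa> \<le> semi_deficit m p X t"
proof -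
  have "real (card {..<A}) * \<kappa> \<le> (\<Sum>k<A. 1 - cos (real (p 0) ^ fst (e k) * real (p 1) ^ snd (e k) * t))"
  proof (intro sum_bounded_below)
    fix k assume "k \<in> {..<A}"
    thus "\<kappa> \<le> 1 - cos (real (p 0) ^ fst (e k) * real (p 1) ^ snd (e k) * t)" using away[of k] by simp
  qed
  also have "\<dots> = (\<Sum>(i,j)\<in>e ` {..<A}. 1 - cos (real (p 0) ^ i * real (p 1) ^ j * t))"
    by (subst sum.reindex[OF inj]) (simp add: case_prod_unfold)
  also have "\<dots> \<le> semi_deficit m p X t"
  proof (rule semi_deficit_pairs[OF m])
    fix i j assume "(i, j) \<in> e ` {..<A}"
    then obtain k where "k < A" "e k = (i, j)" by auto
    thus "real (p 0) ^ i * real (p 1) ^ j \<le> X" using le[of k] by simp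
  qed simp
  finally show ?thesis by simp
qed

lemma cos_pi_div_less_1: "2 \<le> n \<Longrightarrow> cos (pi / real n) < 1"
  using cos_monotone_0_pi[of 0 "pi / real n"] by (simp add: field_simps)

text \<open>With t = 2 pi y and Y = X^(1/8), the range of t becomes the range of y in
  \<open>many_terms_away\<close>. That lemma supplies one term bounded away from 0 in each of A
  rows, or in each of A columns, and these terms belong to distinct elements.\<close>

lemma semi_deficit_minor:
  assumes m: "2 \<le> m"
  shows "\<exists>c>0. \<exists>X0. \<forall>X\<ge>X0. \<forall>t. pi / X \<le> t \<and> t \<le> pi \<longrightarrow> c * ln X \<le> semi_deficit m p X t"
proof -
  define P Q where "P = p 0" and "Q = p 1"
  note pq = two_bases[OF m, folded P_def Q_def]
  define M where "M = real (max P Q)"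
  have M: "2 \<le> M" using pq by (auto simp: M_def)
  define l where "l = ln M"
  have l: "0 < l" using M by (simp add: l_def)
  define \<kappa> where "\<kappa> = 1 - max (cos (pi / real P)) (cos (pi / real Q))"
  have \<kappa>: "0 < \<kappa>" using cos_pi_div_less_1 pq by (simp add: \<kappa>_def)
  define X0 where "X0 = exp (16 * l)"
  have main: "\<kappa> / (16 * l) * ln X \<le> semi_deficit m p X t"
    if X: "X0 \<le> X" and t: "pi / X \<le> t" "t \<le> pi" for X t
  proof -
    have Xpos: "0 < X" using X by (metis X0_def exp_gt_zero less_le_trans)
    have lX: "16 * l \<le> ln X" using X Xpos unfolding X0_def by (metis ln_exp ln_le_cancel_iff exp_gt_zero)
    \<comment> \<open>Up to rounding the largest choice with M^A \<le> Y. \<open>X0 \<le> X\<close>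
      keeps the quotient above 2, so that rounding loses at most half.\<close>
    define A where "A = nat \<lfloor>ln X / (8 * l)\<rfloor>"
    define Y where "Y = exp (ln X / 8)"
    have Y8: "Y ^ 8 = X" using Xpos by (simp add: Y_def flip: exp_of_nat_mult)
    have Y1: "1 \<le> Y" using lX l by (simp add: Y_def)
    have A_le: "real A \<le> ln X / (8 * l)" using lX l unfolding A_def by (intro of_nat_floor) auto
    have "ln X / (8 * l) - 1 \<le> real A" unfolding A_def by linarith
    moreover have "2 \<le> ln X / (8 * l)" using lX l by (simp add: field_simps)
    ultimately have A_ge: "ln X / (16 * l) \<le> real A" by (simp add: field_simps)
    have MA: "M ^ A \<le> Y"
    proof -
      have "M ^ A = exp (real A * l)" using M by (simp add: l_def exp_of_nat_mult)
      also have "real A * l \<le> ln X / 8" using mult_right_mono[OF A_le, of l] l by simp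
      finally show ?thesis by (simp add: Y_def)
    qed
    have "real P ^ A \<le> M ^ A" "real Q ^ A \<le> M ^ A" by (intro power_mono; simp add: M_def)+
    hence PA: "real P ^ A \<le> Y" "real Q ^ A \<le> Y" using MA by auto
    define y where "y = t / (2 * pi)"
    have ty: "t = 2 * pi * y" by (simp add: y_def)
    have y: "1 / (2 * Y ^ 8) \<le> y" "y \<le> 1 / 2"
      using t Xpos by (auto simp: y_def Y8 field_simps)
    have e1: "2 * pi * (real P ^ i * (real Q ^ j * y)) = real P ^ i * real Q ^ j * t" for i j by (simp add: ty)
    have e2: "2 * pi * (real Q ^ j * (real P ^ i * y)) = real P ^ i * real Q ^ j * t" for i j by (simp add: ty)
    have "real A * \<kappa> \<le> semi_deficit m p X t"
      using many_terms_away[OF pq Y1 PA y, unfolded e1 e2 Y8]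
    proof
      assume "\<forall>j<A. \<exists>i. real P ^ i * real Q ^ j \<le> X \<and> cos (real P ^ i * real Q ^ j * t) \<le> cos (pi / real P)"
      moreover have "cos (pi / real P) \<le> 1 - \<kappa>" by (simp add: \<kappa>_def)
      ultimately have "\<forall>j<A. \<exists>i. real P ^ i * real Q ^ j \<le> X \<and> cos (real P ^ i * real Q ^ j * t) \<le> 1 - \<kappa>"
        by (meson order.trans)
      then obtain i where "\<And>j. j < A \<Longrightarrow> real P ^ i j * real Q ^ j \<le> X"
        "\<And>j. j < A \<Longrightarrow> cos (real P ^ i j * real Q ^ j * t) \<le> 1 - \<kappa>" by metis
      thus ?thesis unfolding P_def Q_def
        by (intro semi_deficit_ge_card[OF m, of "\<lambda>j. (i j, j)"]) (auto intro: inj_onI)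
    next
      assume "\<forall>i<A. \<exists>j. real P ^ i * real Q ^ j \<le> X \<and> cos (real P ^ i * real Q ^ j * t) \<le> cos (pi / real Q)"
      moreover have "cos (pi / real Q) \<le> 1 - \<kappa>" by (simp add: \<kappa>_def)
      ultimately have "\<forall>i<A. \<exists>j. real P ^ i * real Q ^ j \<le> X \<and> cos (real P ^ i * real Q ^ j * t) \<le> 1 - \<kappa>"
        by (meson order.trans)
      then obtain j where "\<And>i. i < A \<Longrightarrow> real P ^ i * real Q ^ j i \<le> X"
        "\<And>i. i < A \<Longrightarrow> cos (real P ^ i * real Q ^ j i * t) \<le> 1 - \<kappa>" by metis
      thus ?thesis unfolding P_def Q_def
        by (intro semi_deficit_ge_card[OF m, of "\<lambda>i. (i, j i)"]) (auto intro: inj_onI)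
    qed
    moreover have "ln X / (16 * l) * \<kappa> \<le> real A * \<kappa>" using A_ge \<kappa> by (intro mult_right_mono) auto
    ultimately show ?thesis by (simp add: mult_ac)
  qed
  have "0 < \<kappa> / (16 * l)" using \<kappa> l by simp
  thus ?thesis using main by blast
qed

text \<open>A product over rows is at most the worst row raised to the number of rows, and each row is a
  dilate of the first one, so it has the same integral over a period.\<close>
lemma integral_exp_semi_deficit_le:
  fixes c :: real
  assumes m: "2 \<le> m" and c: "0 \<le> c" and J: "0 < J" and IJ: "real (p 0) ^ I * real (p 1) ^ J \<le> X"
  shows "integral {0..2*pi} (\<lambda>t. exp (- c * semi_deficit m p X t))
    \<le> real J * (2 * pi * ((1 + real (p 0 - 1) * exp (- (c * real J) * (1 - cos (pi / real (p 0))))) / real (p 0)) ^ I)"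
proof -
  note pq = two_bases[OF m]
  define E where "E = (\<lambda>j t. cos_deficit (p 0) I (real (p 1 ^ j) * t))"
  have pt: "exp (- c * semi_deficit m p X t) \<le> (\<Sum>j<J. exp (- (c * real J) * E j t))" for t
  proof -
    have "(\<Sum>(i,j)\<in>{..<I} \<times> {..<J}. 1 - cos (real (p 0) ^ i * real (p 1) ^ j * t)) \<le> semi_deficit m p X t"
    proof (rule semi_deficit_pairs[OF m])
      fix i j assume "(i, j) \<in> {..<I} \<times> {..<J}"
      hence "real (p 0) ^ i * real (p 1) ^ j \<le> real (p 0) ^ I * real (p 1) ^ J"
        using pq by (intro mult_mono power_increasing) auto
      thus "real (p 0) ^ i * real (p 1) ^ j \<le> X" using IJ by linarith
    qed auto
    moreover have "(\<Sum>(i,j)\<in>{..<I} \<times> {..<J}. 1 - cos (real (p 0) ^ i * real (p 1) ^ j * t)) = (\<Sum>j<J. E j t)"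
      unfolding E_def cos_deficit_def
      by (subst sum.cartesian_product[symmetric], subst sum.swap) (simp add: mult_ac)
    ultimately have sumE: "(\<Sum>j<J. E j t) \<le> semi_deficit m p X t" by simp
    obtain j0 where j0: "j0 < J" "\<And>j. j < J \<Longrightarrow> E j0 t \<le> E j t"
    proof -
      have "finite ((\<lambda>j. E j t) ` {..<J})" "(\<lambda>j. E j t) ` {..<J} \<noteq> {}" using J by auto
      from Min_in[OF this] Min_le[OF this(1)] show ?thesis using that by force
    qed
    have "real (card {..<J}) * E j0 t \<le> (\<Sum>j<J. E j t)" using j0 by (intro sum_bounded_below) auto
    hence "c * (real J * E j0 t) \<le> c * semi_deficit m p X t" using sumE c by (intro mult_left_mono) auto
    hence "exp (- c * semi_deficit m p X t) \<le> exp (- (c * real J) * E j0 t)" by (simp add: mult_ac)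
    also have "\<dots> \<le> (\<Sum>j<J. exp (- (c * real J) * E j t))" using j0(1) by (intro member_le_sum) auto
    finally show ?thesis .
  qed
  have "integral {0..2*pi} (\<lambda>t. exp (- c * semi_deficit m p X t))
      \<le> integral {0..2*pi} (\<lambda>t. \<Sum>j<J. exp (- (c * real J) * E j t))"
    unfolding E_def
    by (intro integral_le integrable_continuous_real continuous_intros) (use pt in \<open>auto simp: E_def\<close>)
  also have "\<dots> = (\<Sum>j<J. integral {0..2*pi} (\<lambda>t. exp (- (c * real J) * E j t)))"
    unfolding E_def by (intro integral_sum integrable_continuous_real continuous_intros) auto
  also have "\<dots> = (\<Sum>j<J. integral {0..2*pi} (\<lambda>t. exp (- (c * real J) * cos_deficit (p 0) I t)))"
    unfolding E_def using pq by (intro sum.cong refl integral_exp_cos_deficit_dilate) auto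
  also have "\<dots> = real J * integral {0..2*pi} (\<lambda>t. exp (- (c * real J) * cos_deficit (p 0) I t))" by simp
  also have "\<dots> \<le> real J * (2 * pi * ((1 + real (p 0 - 1) * exp (- (c * real J) * (1 - cos (pi / real (p 0))))) / real (p 0)) ^ I)"
    using c pq by (intro mult_left_mono integral_exp_cos_deficit_le) auto
  finally show ?thesis .
qed

text \<open>The number J is a small multiple of ln X: small enough that \<open>p 1 ^ J\<close> is at
  most X^\<beta>, so that \<open>p 0 ^ I\<close> can still be as large as X^(1-\<beta>) up to a
  constant; yet growing, so that \<eta> is at most a negative power of X and the excess factor (1 +
  (P - 1) \<eta>)^I stays bounded.\<close>

lemma integral_exp_semi_deficit_asymp:
  fixes c \<beta> :: real
  assumes m: "2 \<le> m" and c: "0 < c" and \<beta>: "0 < \<beta>"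
  shows "\<exists>C>0. \<exists>X0. \<forall>X\<ge>X0. integral {0..2*pi} (\<lambda>t. exp (- c * semi_deficit m p X t))
    \<le> C * ln X * exp (\<beta> * ln X) / X"
proof -
  define P Q where "P = real (p 0)" and "Q = real (p 1)"
  have P: "2 \<le> P" "2 \<le> Q" using two_bases[OF m] by (auto simp: P_def Q_def)
  define lP lQ where "lP = ln P" and "lQ = ln Q"
  have l: "0 < lP" "0 < lQ" using P by (auto simp: lP_def lQ_def)
  \<comment> \<open>The cap at 1 also guarantees Q^J \<le> X, which leaves a nonnegative exponent
    for P.\<close>
  define \<epsilon> where "\<epsilon> = min \<beta> 1 / lQ"
  have \<epsilon>: "0 < \<epsilon>" "\<epsilon> * lQ \<le> \<beta>" "\<epsilon> * lQ \<le> 1" using l \<beta> by (auto simp: \<epsilon>_def)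
  define \<kappa> where "\<kappa> = 1 - cos (pi / P)"
  have \<kappa>: "0 < \<kappa>" using cos_pi_div_less_1[of "p 0"] two_bases[OF m] by (simp add: \<kappa>_def P_def)
  define \<gamma> where "\<gamma> = c * \<kappa> * \<epsilon> / 2"
  have \<gamma>: "0 < \<gamma>" using c \<kappa> \<epsilon> by (simp add: \<gamma>_def)
  define K where "K = exp (P / (\<gamma> * lP))"
  define C where "C = \<epsilon> * (2 * pi * (P * K))"
  have C: "0 < C" using \<epsilon> P by (simp add: C_def K_def)
  have "integral {0..2*pi} (\<lambda>t. exp (- c * semi_deficit m p X t)) \<le> C * ln X * exp (\<beta> * ln X) / X"
    if X: "exp (2 / \<epsilon>) \<le> X" for X
  proof -
    define ell where "ell = ln X"
    have X0: "0 < X" using X by (metis exp_gt_zero less_le_trans)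
    have ell: "2 / \<epsilon> \<le> ell" using X X0 unfolding ell_def by (metis ln_exp ln_le_cancel_iff exp_gt_zero)
    have ell0: "0 < ell" using ell \<epsilon> by (meson divide_pos_pos less_le_trans zero_less_numeral)
    have Xe: "X = exp ell" using X0 by (simp add: ell_def)
    have el: "2 \<le> \<epsilon> * ell" using ell \<epsilon> by (simp add: field_simps)
    define J where "J = nat \<lfloor>\<epsilon> * ell\<rfloor>"
    have J: "real J \<le> \<epsilon> * ell" "\<epsilon> * ell - 1 \<le> real J" using el unfolding J_def by linarith+
    have J0: "0 < J" "\<epsilon> * ell / 2 \<le> real J" using J el by linarith+
    have JQ: "real J * lQ \<le> min \<beta> 1 * ell"
    proof -
      have "real J * lQ \<le> \<epsilon> * ell * lQ" using J l by (intro mult_right_mono) auto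
      also have "\<dots> = min \<beta> 1 * ell" using l by (simp add: \<epsilon>_def)
      finally show ?thesis .
    qed
    have JQ1: "real J * lQ \<le> ell" "real J * lQ \<le> \<beta> * ell"
    proof -
      have "min \<beta> 1 * ell \<le> 1 * ell" "min \<beta> 1 * ell \<le> \<beta> * ell" using ell0 by (intro mult_right_mono; simp)+
      thus "real J * lQ \<le> ell" "real J * lQ \<le> \<beta> * ell" using JQ by auto
    qed
    define v where "v = (ell - real J * lQ) / lP"
    have v: "0 \<le> v" using JQ1 l by (simp add: v_def)
    define I where "I = nat \<lfloor>v\<rfloor>"
    have I: "real I \<le> v" "v \<le> real I + 1" using v unfolding I_def by linarith+
    have PI: "P ^ I = exp (real I * lP)" "Q ^ J = exp (real J * lQ)"
      using P by (simp_all add: lP_def lQ_def exp_of_nat_mult)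
    have vl: "v * lP = ell - real J * lQ" using l by (simp add: v_def)
    have Ile: "real I * lP \<le> ell - real J * lQ" using mult_right_mono[OF I(1), of lP] l vl by simp
    have Ige: "ell - real J * lQ \<le> real I * lP + lP" using mult_right_mono[OF I(2), of lP] l vl by (simp add: algebra_simps)
    have IJ: "P ^ I * Q ^ J \<le> X" using Ile by (simp add: PI Xe flip: exp_add)
    have invP: "1 / P ^ I \<le> P * exp (\<beta> * ell) / X"
    proof -
      have "1 / P ^ I = exp (- (real I * lP))" by (simp add: PI exp_minus inverse_eq_divide)
      also have "\<dots> \<le> exp (lP + \<beta> * ell - ell)" using Ige JQ1 by simp
      also have "\<dots> = P * exp (\<beta> * ell) / X" using P by (simp add: exp_add exp_diff Xe lP_def)
      finally show ?thesis .
    qed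
    define \<eta> where "\<eta> = exp (- (c * real J) * \<kappa>)"
    have \<eta>I: "\<eta> * real I \<le> 1 / (\<gamma> * lP)"
    proof -
      have "\<gamma> * ell \<le> c * real J * \<kappa>"
      proof -
        have "c * \<kappa> * (\<epsilon> * ell / 2) \<le> c * \<kappa> * real J" using J0 c \<kappa> by (intro mult_left_mono) auto
        thus ?thesis by (simp add: \<gamma>_def mult_ac)
      qed
      hence "\<eta> \<le> exp (- (\<gamma> * ell))" by (simp add: \<eta>_def)
      moreover have "real I \<le> ell / lP"
      proof -
        have "real I * lP \<le> ell" using Ile l by (smt (verit) mult_nonneg_nonneg of_nat_0_le_iff)
        thus ?thesis using l by (simp add: field_simps)
      qed
      ultimately have "\<eta> * real I \<le> exp (- (\<gamma> * ell)) * (ell / lP)" by (intro mult_mono) auto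
      also have "\<dots> = ell ^ 1 * exp (- (\<gamma> * ell)) / lP" by simp
      also have "\<dots> \<le> (fact 1 / \<gamma> ^ 1) / lP" using \<gamma> ell0 l by (intro divide_right_mono power_mult_exp_bound) auto
      finally show ?thesis by simp
    qed
    have pow: "((1 + real (p 0 - 1) * \<eta>) / P) ^ I \<le> P * exp (\<beta> * ell) / X * K"
    proof -
      have pm: "real (p 0 - 1) \<le> P" by (simp add: P_def)
      have "1 + real (p 0 - 1) * \<eta> \<le> 1 + P * \<eta>" using pm by (intro add_left_mono mult_right_mono) (auto simp: \<eta>_def)
      also have "\<dots> \<le> exp (P * \<eta>)" by (rule exp_ge_add_one_self)
      finally have "(1 + real (p 0 - 1) * \<eta>) ^ I \<le> exp (P * \<eta>) ^ I" by (intro power_mono) (auto simp: \<eta>_def)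
      also have "\<dots> = exp (P * (\<eta> * real I))" by (simp add: mult_ac flip: exp_of_nat_mult)
      also have "\<dots> \<le> K"
      proof -
        have "P * (\<eta> * real I) \<le> P * (1 / (\<gamma> * lP))" using \<eta>I P by (intro mult_left_mono) auto
        thus ?thesis by (simp add: K_def)
      qed
      finally have "(1 + real (p 0 - 1) * \<eta>) ^ I \<le> K" .
      hence "1 / P ^ I * (1 + real (p 0 - 1) * \<eta>) ^ I \<le> P * exp (\<beta> * ell) / X * K"
        using invP P X0 by (intro mult_mono) (auto simp: \<eta>_def)
      thus ?thesis by (simp add: power_divide)
    qed
    have "integral {0..2*pi} (\<lambda>t. exp (- c * semi_deficit m p X t))
       \<le> real J * (2 * pi * ((1 + real (p 0 - 1) * \<eta>) / P) ^ I)"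
      using integral_exp_semi_deficit_le[OF m _ J0(1), of c I X] c IJ
      by (simp add: P_def Q_def \<eta>_def \<kappa>_def)
    also have "\<dots> \<le> (\<epsilon> * ell) * (2 * pi * (P * exp (\<beta> * ell) / X * K))"
      using J pow P el by (intro mult_mono) (auto simp: \<eta>_def)
    also have "\<dots> = C * ln X * exp (\<beta> * ln X) / X" by (simp add: C_def ell_def)
    finally show ?thesis .
  qed
  thus ?thesis using C by blast
qed

text \<open>Centring a factor gains \<open>X|t|\<close>, summed over the relevant scales.  Far from the origin this is worse than
  the trivial bound, whence the cutoff.\<close>
definition arc_weight :: "real \<Rightarrow> real \<Rightarrow> real" where "arc_weight X t = min (X * \<bar>t\<bar>) (ln X)"

lemma continuous_arc_weight [continuous_intros]: "continuous_on A (arc_weight X)"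
  unfolding arc_weight_def by (intro continuous_intros)

text \<open>Near 0 the exponent is at least a constant times (s X t)^2, so t has size 1/(X s) and
  \<open>arc_weight\<close> has size 1/s, where s is the square root in the bound; this gives the
  order claimed. Beyond pi/X the contribution is smaller by a power of X.\<close>

lemma integral_arc_weight_le:
  fixes c :: real
  assumes m: "2 \<le> m" and c: "0 < c"
  shows "\<exists>C>0. \<exists>X0. \<forall>X\<ge>X0. integral {-pi..pi} (\<lambda>t. arc_weight X t ^ k * exp (- c * semi_deficit m p X t))
    \<le> C / (X * sqrt (ln X ^ (m - 1)) ^ Suc k)"
proof -
  obtain c2 X2 where c2: "0 < c2"
    and minor: "\<And>X t. X2 \<le> X \<Longrightarrow> pi / X \<le> t \<Longrightarrow> t \<le> pi \<Longrightarrow> c2 * ln X \<le> semi_deficit m p X t"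
    using semi_deficit_minor[OF m] by blast
  \<comment> \<open>Half of the exponent saves X^(-2 \<beta>) pointwise by \<open>minor\<close>; the
    integral over the other half loses X^\<beta>. The net gain X^(-\<beta>) absorbs all powers of ln
    X.\<close>
  define \<beta> where "\<beta> = c / 2 * c2 / 2"
  have \<beta>: "0 < \<beta>" using c c2 by (simp add: \<beta>_def)
  obtain C3 X3 where C3: "0 < C3" and int3: "\<And>X. X3 \<le> X \<Longrightarrow> integral {0..2*pi} (\<lambda>t. exp (- (c / 2) * semi_deficit m p X t))
      \<le> C3 * ln X * exp (\<beta> * ln X) / X"
    using integral_exp_semi_deficit_asymp[OF m, of "c / 2" \<beta>] c \<beta> by auto
  define g where "g = c * (mb_density / (18 * window\<^sup>2))"
  have w0: "0 < window" using window_ge_1 by linarith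
  have g: "0 < g" using c mb_density_pos w0 by (simp add: g_def)
  define B1 :: real where "B1 = 2 + fact k + fact (Suc k)"
  have B1: "0 < B1" by (simp add: B1_def add_pos_pos)
  \<comment> \<open>The power of ln X to absorb: m (k + 1) from s^(k+1), as s \<le> (ln X)^m, and k
    + 1 from \<open>arc_weight\<close> and the integral bound.\<close>
  define N where "N = m * Suc k + Suc k"
  define B2 where "B2 = C3 * (fact N / \<beta> ^ N)"
  have B2: "0 < B2" using C3 \<beta> by (simp add: B2_def)
  define C where "C = 2 * (B1 / sqrt g ^ k * (2 / sqrt g) + B2)"
  have C: "0 < C" using B1 B2 g by (simp add: C_def add_pos_pos)
  have main: "integral {-pi..pi} (\<lambda>t. arc_weight X t ^ k * exp (- c * semi_deficit m p X t))
      \<le> C / (X * sqrt (ln X ^ (m - 1)) ^ Suc k)"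
    if X: "max (max X2 X3) (max window (exp 1)) \<le> X" for X
  proof -
    define ell where "ell = ln X"
    have X0: "0 < X" using X w0 by linarith
    have ell1: "1 \<le> ell" using X X0 unfolding ell_def by (metis ln_exp ln_le_cancel_iff exp_gt_zero max.bounded_iff)
    define s where "s = sqrt (ell ^ (m - 1))"
    have s: "1 \<le> s" using ell1 by (simp add: s_def)
    have s2: "s\<^sup>2 = ell ^ (m - 1)" using ell1 by (simp add: s_def)
    have sm: "s \<le> ell ^ m"
    proof -
      have "s * 1 \<le> s * s" using s by (intro mult_left_mono) auto
      hence "s \<le> ell ^ (m - 1)" using s2 by (simp add: power2_eq_square)
      also have "\<dots> \<le> ell ^ m" using ell1 by (intro power_increasing) auto
      finally show ?thesis .
    qed
    define D where "D = semi_deficit m p X"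
    define G where "G = g * s\<^sup>2 * X\<^sup>2"
    have G: "0 < G" using g s X0 by (simp add: G_def)
    have sG: "sqrt G = sqrt g * s * X" using s X0 by (simp add: G_def real_sqrt_mult)
    let ?f = "\<lambda>t. arc_weight X t ^ k * exp (- c * D t)"
    define F where "F = (\<lambda>t. B1 / (sqrt g * s) ^ k * (1 / (1 + G * t\<^sup>2)) + ell ^ k * exp (- (2 * \<beta> * ell)) * exp (- (c / 2) * D t))"
    have contf: "continuous_on A ?f" for A unfolding D_def by (intro continuous_intros)
    have contD: "continuous_on A (\<lambda>t. exp (- (c / 2) * D t))" for A unfolding D_def by (intro continuous_intros)
    have aw0: "0 \<le> arc_weight X t" for t
      using X0 ell1 unfolding arc_weight_def ell_def by (intro min.boundedI mult_nonneg_nonneg) linarith+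
    have pt: "?f t \<le> F t" if t: "t \<in> {0..pi}" for t
    proof (cases "t \<le> pi / X")
      case True
      have "\<bar>t\<bar> \<le> pi / X" using True t by simp
      hence "mb_density / (18 * window\<^sup>2) * ell ^ (m - 1) * (X * t)\<^sup>2 \<le> D t"
        unfolding D_def ell_def using X m by (intro semi_deficit_major) auto
      hence "c * (mb_density / (18 * window\<^sup>2) * ell ^ (m - 1) * (X * t)\<^sup>2) \<le> c * D t"
        using c by (intro mult_left_mono) auto
      hence GD: "G * t\<^sup>2 \<le> c * D t" by (simp add: G_def g_def s2 power_mult_distrib mult_ac)
      define u where "u = sqrt G * t"
      have u: "0 \<le> u" "u\<^sup>2 = G * t\<^sup>2" using t G by (auto simp: u_def power_mult_distrib)
      have gs: "0 < sqrt g * s" using g s by simp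
      have aw: "arc_weight X t \<le> u / (sqrt g * s)"
      proof -
        have "u / (sqrt g * s) = X * \<bar>t\<bar>" using g s t by (simp add: u_def sG)
        thus ?thesis by (simp add: arc_weight_def)
      qed
      have "?f t \<le> (u / (sqrt g * s)) ^ k * exp (- u\<^sup>2)"
        using GD u aw aw0[of t] by (intro mult_mono power_mono) auto
      also have "\<dots> = u ^ k * exp (- u\<^sup>2) / (sqrt g * s) ^ k" by (simp add: power_divide)
      also have "\<dots> \<le> B1 / (1 + u\<^sup>2) / (sqrt g * s) ^ k"
        unfolding B1_def using u gs by (intro divide_right_mono gaussian_power_bound) auto
      also have "\<dots> = B1 / (sqrt g * s) ^ k * (1 / (1 + G * t\<^sup>2))" by (simp add: u)
      also have "\<dots> \<le> F t" unfolding F_def using ell1 by simp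
      finally show ?thesis .
    next
      case False
      hence "c2 * ell \<le> D t" unfolding D_def ell_def using X t by (intro minor) auto
      hence "c / 2 * (c2 * ell) \<le> c / 2 * D t" using c by (intro mult_left_mono) auto
      hence "2 * \<beta> * ell + c / 2 * D t \<le> c * D t" by (simp add: \<beta>_def)
      hence "exp (- c * D t) \<le> exp (- (2 * \<beta> * ell) + - (c / 2) * D t)" by simp
      hence ex: "exp (- c * D t) \<le> exp (- (2 * \<beta> * ell)) * exp (- (c / 2) * D t)" by (simp only: exp_add)
      have "arc_weight X t \<le> ell" by (simp add: arc_weight_def ell_def)
      hence "?f t \<le> ell ^ k * (exp (- (2 * \<beta> * ell)) * exp (- (c / 2) * D t))"
        using ex aw0[of t] by (intro mult_mono power_mono) (use ell1 in auto)
      also have "\<dots> \<le> F t" unfolding F_def using B1 g s G by (simp add: mult_ac)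
      finally show ?thesis .
    qed
    note ic = integral_cauchy_density_le[OF G, of pi]
    have iD: "(\<lambda>t. exp (- (c / 2) * D t)) integrable_on {0..pi}" using contD by (rule integrable_continuous_real)
    have intF: "F integrable_on {0..pi}"
      unfolding F_def using ic(1) iD by (intro integrable_add integrable_on_mult_right) auto
    have "integral {0..pi} ?f \<le> integral {0..pi} F"
      using pt intF integrable_continuous_real[OF contf] by (intro integral_le) auto
    also have "\<dots> = B1 / (sqrt g * s) ^ k * integral {0..pi} (\<lambda>t. 1 / (1 + G * t\<^sup>2))
        + ell ^ k * exp (- (2 * \<beta> * ell)) * integral {0..pi} (\<lambda>t. exp (- (c / 2) * D t))"
      unfolding F_def using ic(1) iD
      by (subst integral_add) (auto intro!: integrable_on_mult_right simp only: integral_mult_right pi_ge_zero)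
    also have "\<dots> \<le> B1 / (sqrt g * s) ^ k * (2 / sqrt G)
        + ell ^ k * exp (- (2 * \<beta> * ell)) * (C3 * ell * exp (\<beta> * ell) / X)"
    proof (intro add_mono mult_left_mono)
      show "integral {0..pi} (\<lambda>t. 1 / (1 + G * t\<^sup>2)) \<le> 2 / sqrt G" using ic(2) by simp
      have "integral {0..pi} (\<lambda>t. exp (- (c / 2) * D t)) \<le> integral {0..2*pi} (\<lambda>t. exp (- (c / 2) * D t))"
        using contD by (intro integral_subset_le integrable_continuous_real) auto
      also have "\<dots> \<le> C3 * ell * exp (\<beta> * ell) / X" unfolding D_def ell_def using X by (intro int3) auto
      finally show "integral {0..pi} (\<lambda>t. exp (- (c / 2) * D t)) \<le> C3 * ell * exp (\<beta> * ell) / X" .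
    qed (use B1 g s ell1 in auto)
    also have "B1 / (sqrt g * s) ^ k * (2 / sqrt G) = B1 / sqrt g ^ k * (2 / sqrt g) / (X * s ^ Suc k)"
      unfolding sG by (simp add: power_mult_distrib mult_ac)
    also have "ell ^ k * exp (- (2 * \<beta> * ell)) * (C3 * ell * exp (\<beta> * ell) / X) \<le> B2 / (X * s ^ Suc k)"
    proof -
      have "s ^ Suc k \<le> (ell ^ m) ^ Suc k" using sm s by (intro power_mono) auto
      also have "\<dots> = ell ^ (m * Suc k)" by (simp only: power_mult)
      finally have "s ^ Suc k * (ell ^ Suc k * exp (- (\<beta> * ell))) \<le> ell ^ (m * Suc k) * (ell ^ Suc k * exp (- (\<beta> * ell)))"
        using ell1 by (intro mult_right_mono) auto
      also have "\<dots> = ell ^ N * exp (- (\<beta> * ell))" unfolding N_def power_add by (simp only: mult.assoc)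
      also have "\<dots> \<le> fact N / \<beta> ^ N" using \<beta> ell1 by (intro power_mult_exp_bound) auto
      finally have bnd: "C3 * (s ^ Suc k * (ell ^ Suc k * exp (- (\<beta> * ell)))) \<le> B2"
        unfolding B2_def using C3 by (intro mult_left_mono) auto
      have "exp (- (2 * \<beta> * ell)) * exp (\<beta> * ell) = exp (- (\<beta> * ell))" by (simp flip: exp_add)
      hence "ell ^ k * exp (- (2 * \<beta> * ell)) * (C3 * ell * exp (\<beta> * ell) / X) = C3 * (ell ^ Suc k * exp (- (\<beta> * ell))) / X"
        by (simp add: mult_ac)
      also have "\<dots> = C3 * (s ^ Suc k * (ell ^ Suc k * exp (- (\<beta> * ell)))) / (X * s ^ Suc k)"
        using s by simp
      also have "\<dots> \<le> B2 / (X * s ^ Suc k)" using bnd X0 s by (intro divide_right_mono) auto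
      finally show ?thesis .
    qed
    finally have half: "integral {0..pi} ?f \<le> (B1 / sqrt g ^ k * (2 / sqrt g) + B2) / (X * s ^ Suc k)"
      by (simp add: add_divide_distrib)
    have "integral {-pi..0} ?f = integral {0..pi} ?f"
      using Henstock_Kurzweil_Integration.integral_reflect_real[of pi 0 ?f] by (simp add: arc_weight_def D_def)
    moreover have "integral {-pi..pi} ?f = integral {-pi..0} ?f + integral {0..pi} ?f"
      using contf by (intro Henstock_Kurzweil_Integration.integral_combine[symmetric] integrable_continuous_real) auto
    ultimately have "integral {-pi..pi} ?f = 2 * integral {0..pi} ?f" by simp
    also have "\<dots> \<le> 2 * ((B1 / sqrt g ^ k * (2 / sqrt g) + B2) / (X * s ^ Suc k))"
      using half by (intro mult_left_mono) auto
    also have "\<dots> = C / (X * s ^ Suc k)" by (simp only: C_def times_divide_eq_right)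
    finally show ?thesis unfolding D_def s_def ell_def .
  qed
  show ?thesis using C main by blast
qed

end

section \<open>Tilted digits\<close>

definition tilt :: "nat \<Rightarrow> real \<Rightarrow> nat \<Rightarrow> real" where
  "tilt d y k = exp (- (y * real k)) / (\<Sum>j<d. exp (- (y * real j)))"

definition tilt_mean :: "nat \<Rightarrow> real \<Rightarrow> real" where
  "tilt_mean d y = (\<Sum>k<d. tilt d y k * real k)"

definition tilt_var :: "nat \<Rightarrow> real \<Rightarrow> real" where
  "tilt_var d y = (\<Sum>k<d. tilt d y k * (real k - tilt_mean d y)\<^sup>2)"

lemma norm_cis_minus_1: "cmod (cis x - 1) \<le> \<bar>x\<bar>"
  using iexp_approx1[of x 0] by (simp add: cis_conv_exp)

lemma norm_cis_minus_quadratic: "cmod (cis x - (1 + \<i> * x - x\<^sup>2 / 2)) \<le> \<bar>x\<bar> ^ 3 / 6"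
  using iexp_approx1[of x 2]
  by (simp add: cis_conv_exp numeral_2_eq_2 fact_reduce power2_eq_square numeral_3_eq_3 field_simps)

lemma exp_minus_linear_bounds:
  fixes s :: real
  assumes "0 \<le> s"
  shows "\<bar>exp (- s) - (1 - s)\<bar> \<le> s" "\<bar>exp (- s) - (1 - s)\<bar> \<le> s\<^sup>2"
proof -
  have 0: "1 - s \<le> exp (- s)" using exp_ge_add_one_self[of "- s"] by simp
  have 1: "exp (- s) \<le> 1" using assms by simp
  show "\<bar>exp (- s) - (1 - s)\<bar> \<le> s" using 0 1 by simp
  have "exp (- s) \<le> 1 / (1 + s)"
    using exp_ge_add_one_self[of s] assms by (simp add: exp_minus field_simps)
  also have "\<dots> \<le> 1 - s + s\<^sup>2"
  proof -
    have "(1 - s + s\<^sup>2) * (1 + s) = 1 + s ^ 3" by (simp add: algebra_simps power2_eq_square power3_eq_cube)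
    hence "1 \<le> (1 - s + s\<^sup>2) * (1 + s)" using assms by simp
    thus ?thesis using assms by (simp add: pos_divide_le_eq)
  qed
  finally show "\<bar>exp (- s) - (1 - s)\<bar> \<le> s\<^sup>2" using 0 by simp
qed

locale tilted_digit =
  fixes d :: nat and y :: real
  assumes d: "2 \<le> d" and y: "0 \<le> y"
begin

lemma normaliser_bounds: "1 \<le> (\<Sum>j<d. exp (- (y * real j)))" "(\<Sum>j<d. exp (- (y * real j))) \<le> real d"
proof -
  have "exp (- (y * real 0)) \<le> (\<Sum>j<d. exp (- (y * real j)))" using d by (intro member_le_sum) auto
  thus "1 \<le> (\<Sum>j<d. exp (- (y * real j)))" by simp
  have "(\<Sum>j<d. exp (- (y * real j))) \<le> real (card {..<d}) * 1" using y by (intro sum_bounded_above) auto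
  thus "(\<Sum>j<d. exp (- (y * real j))) \<le> real d" by simp
qed

lemma tilt_nonneg: "0 \<le> tilt d y k"
  using normaliser_bounds by (simp add: tilt_def)

lemma sum_tilt: "(\<Sum>k<d. tilt d y k) = 1"
  using normaliser_bounds(1) unfolding tilt_def by (simp flip: sum_divide_distrib)

lemma tilt_le_1: "k < d \<Longrightarrow> tilt d y k \<le> 1"
  using member_le_sum[of k "{..<d}" "tilt d y"] sum_tilt tilt_nonneg by auto

lemma tilt_le_exp: "1 \<le> k \<Longrightarrow> tilt d y k \<le> exp (- y)"
proof -
  assume k: "1 \<le> k"
  have "tilt d y k \<le> exp (- (y * real k)) / 1"
    unfolding tilt_def using normaliser_bounds(1) by (intro divide_left_mono) auto
  also have "\<dots> \<le> exp (- y)" using k y mult_left_mono[of 1 "real k" y] by simp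
  finally show ?thesis .
qed

text \<open>In the application \<open>y \<le> 1\<close> means h \<le> X; this is the source of the
  constant \<open>decay\<close> and of the cutoff X in the exponent.\<close>

lemma tilt_0_1_ge: "y \<le> 1 \<Longrightarrow> exp (- 1) / (real d)\<^sup>2 \<le> tilt d y 0 * tilt d y 1"
proof -
  assume y1: "y \<le> 1"
  have "1 / real d \<le> tilt d y 0" "exp (- 1) / real d \<le> tilt d y 1"
    unfolding tilt_def using normaliser_bounds y1 by (auto intro!: frac_le)
  hence "(1 / real d) * (exp (- 1) / real d) \<le> tilt d y 0 * tilt d y 1"
    by (intro mult_mono tilt_nonneg) auto
  thus ?thesis by (simp add: power2_eq_square)
qed

text \<open>The difference is a mean of differences of exponentials, each at most d y, divided by a
  normaliser that is at least 1.\<close>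

lemma tilt_near_uniform: "k < d \<Longrightarrow> \<bar>tilt d y k - 1 / real d\<bar> \<le> real d * y"
proof -
  assume k: "k < d"
  define Z where "Z = (\<Sum>j<d. exp (- (y * real j)))"
  have Z: "1 \<le> Z" using normaliser_bounds by (simp add: Z_def)
  have lip: "\<bar>exp (- (y * real k)) - exp (- (y * real j))\<bar> \<le> real d * y" if "j < d" for j
  proof -
    have one: "exp (- (y * real a)) - exp (- (y * real b)) \<le> real d * y" if "a < d" "b < d" for a b
    proof -
      have "exp (- (y * real a)) \<le> 1" using y by simp
      moreover have "1 - y * real b \<le> exp (- (y * real b))" using exp_ge_add_one_self[of "- (y * real b)"] by simp
      moreover have "y * real b \<le> y * real d" using that y by (intro mult_left_mono) auto
      ultimately have "exp (- (y * real a)) - exp (- (y * real b)) \<le> y * real d" by linarith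
      thus ?thesis by (simp only: mult.commute)
    qed
    show ?thesis using one[of k j] one[of j k] k that by linarith
  qed
  have "tilt d y k - 1 / real d = (real d * exp (- (y * real k)) - Z) / (real d * Z)"
    using Z d by (simp add: tilt_def Z_def field_simps)
  also have "real d * exp (- (y * real k)) - Z = (\<Sum>j<d. exp (- (y * real k)) - exp (- (y * real j)))"
    by (simp add: Z_def sum_subtractf)
  finally have "\<bar>tilt d y k - 1 / real d\<bar> = \<bar>\<Sum>j<d. exp (- (y * real k)) - exp (- (y * real j))\<bar> / (real d * Z)"
    using Z by (simp add: abs_mult)
  also have "\<dots> \<le> (real (card {..<d}) * (real d * y)) / (real d * Z)"
    using lip Z by (intro divide_right_mono order.trans[OF sum_abs] sum_bounded_above) auto
  also have "\<dots> = real d * y / Z" using d by simp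
  also have "\<dots> \<le> real d * y / 1" using Z y by (intro divide_left_mono) auto
  finally show ?thesis by simp
qed

lemma tilt_mean_nonneg: "0 \<le> tilt_mean d y"
  unfolding tilt_mean_def by (intro sum_nonneg mult_nonneg_nonneg tilt_nonneg) auto

lemma tilt_mean_le: "tilt_mean d y \<le> real d"
proof -
  have "tilt_mean d y \<le> (\<Sum>k<d. tilt d y k * real d)"
    unfolding tilt_mean_def by (intro sum_mono mult_left_mono tilt_nonneg) auto
  thus ?thesis by (simp add: sum_tilt flip: sum_distrib_right)
qed

lemma tilt_mean_le_exp: "tilt_mean d y \<le> (real d)\<^sup>2 * exp (- y)"
proof -
  have "tilt_mean d y \<le> (\<Sum>k<d. exp (- y) * real d)"
    unfolding tilt_mean_def
  proof (rule sum_mono)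
    fix k assume "k \<in> {..<d}"
    thus "tilt d y k * real k \<le> exp (- y) * real d"
      using tilt_le_exp[of k] by (cases "k = 0") (auto intro!: mult_mono tilt_nonneg)
  qed
  thus ?thesis by (simp add: power2_eq_square mult_ac)
qed

lemma tilt_var_le: "tilt_var d y \<le> real d ^ 3 * exp (- y)"
proof -
  have "tilt_var d y = (\<Sum>k<d. tilt d y k * (real k)\<^sup>2) - (tilt_mean d y)\<^sup>2"
  proof -
    have "tilt_var d y = (\<Sum>k<d. tilt d y k * (real k)\<^sup>2 - 2 * tilt_mean d y * (tilt d y k * real k) + (tilt_mean d y)\<^sup>2 * tilt d y k)"
      unfolding tilt_var_def by (intro sum.cong refl) (simp add: power2_eq_square algebra_simps)
    also have "\<dots> = (\<Sum>k<d. tilt d y k * (real k)\<^sup>2) - 2 * tilt_mean d y * tilt_mean d y + (tilt_mean d y)\<^sup>2 * 1"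
      unfolding sum.distrib sum_subtractf sum_distrib_left[symmetric] sum_tilt tilt_mean_def[symmetric] ..
    finally show ?thesis by (simp add: power2_eq_square)
  qed
  also have "\<dots> \<le> (\<Sum>k<d. tilt d y k * (real k)\<^sup>2)" by simp
  also have "\<dots> \<le> (\<Sum>k<d. tilt d y k * real k * real d)"
    by (intro sum_mono) (auto simp: power2_eq_square mult.assoc intro!: mult_left_mono tilt_nonneg)
  also have "\<dots> = tilt_mean d y * real d" by (simp add: tilt_mean_def sum_distrib_right)
  also have "\<dots> \<le> (real d)\<^sup>2 * exp (- y) * real d" using tilt_mean_le_exp by (intro mult_right_mono) auto
  finally show ?thesis by (simp add: power2_eq_square power3_eq_cube mult_ac)
qed

text \<open>Only the digits 0 and 1 are used: a b + (a \<mu> - b (1 - \<mu>))^2 = (a + b) v bounds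
  their share v of the variance below, for any centre \<mu>.\<close>

lemma tilt_var_ge: "tilt d y 0 * tilt d y 1 \<le> tilt_var d y"
proof -
  define a b \<mu> where "a = tilt d y 0" and "b = tilt d y 1" and "\<mu> = tilt_mean d y"
  have ab: "0 \<le> a" "0 \<le> b" by (auto simp: a_def b_def tilt_nonneg)
  have ab1: "a + b \<le> 1"
  proof -
    have "(\<Sum>k\<in>{0,1}. tilt d y k) \<le> (\<Sum>k<d. tilt d y k)" using d by (intro sum_mono2) (auto simp: tilt_nonneg)
    thus ?thesis by (simp add: sum_tilt a_def b_def)
  qed
  define v where "v = a * \<mu>\<^sup>2 + b * (1 - \<mu>)\<^sup>2"
  have v: "0 \<le> v" using ab by (simp add: v_def)
  have "a * b \<le> a * b + (a * \<mu> - b * (1 - \<mu>))\<^sup>2" by simp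
  also have "\<dots> = (a + b) * v" by (simp add: v_def power2_eq_square algebra_simps)
  also have "\<dots> \<le> 1 * v" using ab1 v by (intro mult_right_mono) auto
  also have "\<dots> = (\<Sum>k\<in>{0,1}. tilt d y k * (real k - tilt_mean d y)\<^sup>2)"
    by (simp add: v_def a_def b_def \<mu>_def)
  also have "\<dots> \<le> tilt_var d y" unfolding tilt_var_def
    using d by (intro sum_mono2) (auto simp: tilt_nonneg)
  finally show ?thesis by (simp add: a_def b_def)
qed

lemma norm_tilt_sum_le:
  assumes "\<And>k. k < d \<Longrightarrow> cmod (g k) \<le> B"
  shows "cmod (\<Sum>k<d. of_real (tilt d y k) * g k) \<le> B"
proof -
  have "cmod (\<Sum>k<d. of_real (tilt d y k) * g k) \<le> (\<Sum>k<d. tilt d y k * B)"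
    using assms by (intro sum_norm_le) (auto simp: norm_mult tilt_nonneg intro!: mult_left_mono)
  thus ?thesis by (simp add: sum_tilt flip: sum_distrib_right)
qed

text \<open>Mean zero allows 1 to be subtracted from the exponential. The factor exp(-y) inherited
  from the mean digit keeps the later sum over h effectively at scale X.\<close>

lemma norm_centred_tilt_sum_le:
  assumes g: "\<And>k. k < d \<Longrightarrow> cmod (g k) \<le> 1" and mean0: "(\<Sum>k<d. of_real (tilt d y k) * g k) = 0"
  shows "cmod (\<Sum>k<d. of_real (tilt d y k) * g k * cis (x * real k)) \<le> min 1 (\<bar>x\<bar> * ((real d)\<^sup>2 * exp (- y)))"
proof (rule min.boundedI)
  show "cmod (\<Sum>k<d. of_real (tilt d y k) * g k * cis (x * real k)) \<le> 1"
    using norm_tilt_sum_le[of "\<lambda>k. g k * cis (x * real k)" 1] g by (simp add: norm_mult mult.assoc)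
  have "(\<Sum>k<d. of_real (tilt d y k) * g k * cis (x * real k))
      = (\<Sum>k<d. of_real (tilt d y k) * g k * (cis (x * real k) - 1))"
    using mean0 by (simp add: right_diff_distrib sum_subtractf)
  also have "cmod \<dots> \<le> (\<Sum>k<d. \<bar>x\<bar> * (tilt d y k * real k))"
  proof (intro sum_norm_le)
    fix k assume "k \<in> {..<d}"
    hence "cmod (of_real (tilt d y k) * g k * (cis (x * real k) - 1)) \<le> tilt d y k * 1 * \<bar>x * real k\<bar>"
      unfolding norm_mult using g norm_cis_minus_1 by (intro mult_mono) (auto simp: tilt_nonneg)
    thus "cmod (of_real (tilt d y k) * g k * (cis (x * real k) - 1)) \<le> \<bar>x\<bar> * (tilt d y k * real k)"
      by (simp add: abs_mult mult_ac)
  qed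
  also have "\<dots> = \<bar>x\<bar> * tilt_mean d y" by (simp add: tilt_mean_def sum_distrib_left)
  also have "\<dots> \<le> \<bar>x\<bar> * ((real d)\<^sup>2 * exp (- y))" using tilt_mean_le_exp by (intro mult_left_mono) auto
  finally show "cmod (\<Sum>k<d. of_real (tilt d y k) * g k * cis (x * real k)) \<le> \<bar>x\<bar> * ((real d)\<^sup>2 * exp (- y))" .
qed

text \<open>The digits 0 and 1 alone produce the cancellation; the others are bounded trivially.
  Arbitrary phases cover the twist by the digit count as well.\<close>

lemma norm_unimodular_tilt_sum_le:
  "cmod (\<Sum>k<d. of_real (tilt d y k) * cis (f k)) \<le> exp (- (tilt d y 0 * tilt d y 1) * (1 - cos (f 1 - f 0)))"
proof -
  define a b where "a = tilt d y 0" and "b = tilt d y 1"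
  have ab: "0 \<le> a" "0 \<le> b" by (auto simp: a_def b_def tilt_nonneg)
  have sub: "{0,1} \<subseteq> {..<d}" using d by auto
  have rest: "(\<Sum>k\<in>{..<d} - {0,1}. tilt d y k) = 1 - (a + b)"
    using sum_diff[OF _ sub, of "tilt d y"] by (simp add: sum_tilt a_def b_def)
  have "0 \<le> (\<Sum>k\<in>{..<d} - {0,1}. tilt d y k)" by (intro sum_nonneg tilt_nonneg)
  hence ab1: "a + b \<le> 1" using rest by simp
  define e where "e = 1 - cos (f 1 - f 0)"
  have e: "0 \<le> e" "e \<le> 2" using cos_ge_minus_one[of "f 1 - f 0"] by (auto simp: e_def)
  have two: "cmod (of_real a * cis (f 0) + of_real b * cis (f 1)) \<le> (a + b) - a * b * e"
  proof (rule power2_le_imp_le)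
    have "(cmod (of_real a * cis (f 0) + of_real b * cis (f 1)))\<^sup>2
        = (a * cos (f 0) + b * cos (f 1))\<^sup>2 + (a * sin (f 0) + b * sin (f 1))\<^sup>2"
      by (simp add: cmod_power2)
    also have "\<dots> = a\<^sup>2 * ((sin (f 0))\<^sup>2 + (cos (f 0))\<^sup>2) + b\<^sup>2 * ((sin (f 1))\<^sup>2 + (cos (f 1))\<^sup>2)
        + 2 * a * b * (cos (f 1) * cos (f 0) + sin (f 1) * sin (f 0))"
      by algebra
    also have "\<dots> = (a + b)\<^sup>2 - 2 * (a * b * e)"
      by (simp only: sin_cos_squared_add cos_diff[symmetric]) (simp add: e_def power2_eq_square algebra_simps)
    \<comment> \<open>Inserting a + b \<le> 1 prepares the completion of the square.\<close>
    also have "\<dots> \<le> (a + b)\<^sup>2 - 2 * (a + b) * (a * b * e)"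
    proof -
      have "(a + b) * (a * b * e) \<le> 1 * (a * b * e)" using ab ab1 e by (intro mult_right_mono) auto
      thus ?thesis by (simp only: mult.assoc[of 2])
    qed
    also have "\<dots> \<le> ((a + b) - a * b * e)\<^sup>2" by (simp add: power2_diff)
    finally show "(cmod (of_real a * cis (f 0) + of_real b * cis (f 1)))\<^sup>2 \<le> ((a + b) - a * b * e)\<^sup>2" .
    have "a * b * e \<le> a * b * 2" using ab e by (intro mult_left_mono) auto
    also have "\<dots> \<le> a + b"
      using ab ab1 mult_left_mono[of b 1 a] mult_right_mono[of a 1 b] by simp
    finally show "0 \<le> (a + b) - a * b * e" by simp
  qed
  have "(\<Sum>k<d. of_real (tilt d y k) * cis (f k))
      = (of_real a * cis (f 0) + of_real b * cis (f 1)) + (\<Sum>k\<in>{..<d} - {0,1}. of_real (tilt d y k) * cis (f k))"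
    by (subst sum.subset_diff[OF sub]) (auto simp: a_def b_def)
  also have "cmod \<dots> \<le> ((a + b) - a * b * e) + (\<Sum>k\<in>{..<d} - {0,1}. tilt d y k)"
    by (intro norm_triangle_mono two sum_norm_le) (auto simp: norm_mult tilt_nonneg)
  also have "\<dots> = 1 + - (a * b) * e" unfolding rest by simp
  also have "\<dots> \<le> exp (- (a * b) * e)" by (rule exp_ge_add_one_self)
  finally show ?thesis by (simp only: a_def b_def e_def)
qed

text \<open>Both errors, the cubic Taylor remainder and the expansion of the Gaussian, are kept
  proportional to the variance, which carries the factor exp(-y). A bound by |x|^3 alone would be
  too large when summed over h.\<close>

lemma tilt_charfun_approx:
  "cmod ((\<Sum>k<d. of_real (tilt d y k) * cis (x * (real k - tilt_mean d y))) - of_real (exp (- (tilt_var d y * x\<^sup>2 / 2))))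
    \<le> min 2 (2 * real d ^ 5 * (\<bar>x\<bar> ^ 3 * exp (- y)))"
proof (rule min.boundedI)
  define \<mu> V where "\<mu> = tilt_mean d y" and "V = tilt_var d y"
  define a where "a = (\<Sum>k<d. of_real (tilt d y k) * cis (x * (real k - \<mu>)))"
  have V0: "0 \<le> V" unfolding V_def tilt_var_def by (intro sum_nonneg mult_nonneg_nonneg tilt_nonneg) auto
  have dev: "\<bar>real k - \<mu>\<bar> \<le> real d" if "k < d" for k
    using that tilt_mean_nonneg tilt_mean_le by (simp add: \<mu>_def abs_le_iff)
  have V2: "V \<le> (real d)\<^sup>2"
  proof -
    have "V \<le> (\<Sum>k<d. tilt d y k * (real d)\<^sup>2)"
      unfolding V_def tilt_var_def
    proof (intro sum_mono mult_left_mono tilt_nonneg)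
      fix k assume "k \<in> {..<d}"
      thus "(real k - tilt_mean d y)\<^sup>2 \<le> (real d)\<^sup>2"
        using dev[of k] by (simp add: \<mu>_def abs_le_square_iff[symmetric])
    qed
    thus ?thesis by (simp add: sum_tilt flip: sum_distrib_right)
  qed
  have "cmod a \<le> 1" unfolding a_def by (intro norm_tilt_sum_le) auto
  moreover have "cmod (of_real (exp (- (V * x\<^sup>2 / 2)))) \<le> 1" using V0 by simp
  ultimately show "cmod ((\<Sum>k<d. of_real (tilt d y k) * cis (x * (real k - tilt_mean d y))) - of_real (exp (- (tilt_var d y * x\<^sup>2 / 2)))) \<le> 2"
    unfolding a_def \<mu>_def V_def using norm_triangle_ineq4[of a] by (smt (verit) norm_triangle_ineq4)
  have lin: "(\<Sum>k<d. tilt d y k * (real k - \<mu>)) = 0"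
    by (simp add: right_diff_distrib sum_subtractf \<mu>_def tilt_mean_def[symmetric] sum_tilt flip: sum_distrib_right)
  have split: "complex_of_real w * (1 + \<i> * of_real (x * u) - of_real ((x * u)\<^sup>2) / 2)
      = of_real w + \<i> * of_real x * of_real (w * u) - of_real (x\<^sup>2 / 2) * of_real (w * u\<^sup>2)" for w u
    by (simp add: power_mult_distrib algebra_simps)
  have "(\<Sum>k<d. of_real (tilt d y k) * (1 + \<i> * of_real (x * (real k - \<mu>)) - of_real ((x * (real k - \<mu>))\<^sup>2) / 2))
      = of_real (\<Sum>k<d. tilt d y k) + \<i> * of_real x * of_real (\<Sum>k<d. tilt d y k * (real k - \<mu>))
        - of_real (x\<^sup>2 / 2) * of_real (\<Sum>k<d. tilt d y k * (real k - \<mu>)\<^sup>2)"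
    unfolding split by (simp only: sum.distrib sum_subtractf sum_distrib_left[symmetric] of_real_sum)
  also have "\<dots> = of_real (1 - V * x\<^sup>2 / 2)"
    unfolding sum_tilt lin V_def[unfolded tilt_var_def, folded \<mu>_def, symmetric] by simp
  finally have quad: "(\<Sum>k<d. of_real (tilt d y k) * (1 + \<i> * of_real (x * (real k - \<mu>)) - of_real ((x * (real k - \<mu>))\<^sup>2) / 2)) = of_real (1 - V * x\<^sup>2 / 2)" .
  have "cmod (a - of_real (1 - V * x\<^sup>2 / 2))
      = cmod (\<Sum>k<d. of_real (tilt d y k) * (cis (x * (real k - \<mu>)) - (1 + \<i> * of_real (x * (real k - \<mu>)) - of_real ((x * (real k - \<mu>))\<^sup>2) / 2)))"
    unfolding quad[symmetric] a_def by (simp only: right_diff_distrib sum_subtractf)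
  \<comment> \<open>Only one of the three factors |k - \<mu>| is estimated by d; the other two
    rebuild the variance.\<close>
  also have "\<dots> \<le> (\<Sum>k<d. tilt d y k * (real k - \<mu>)\<^sup>2 * (\<bar>x\<bar> ^ 3 * real d))"
  proof (intro sum_norm_le)
    fix k assume k: "k \<in> {..<d}"
    have "cmod (of_real (tilt d y k) * (cis (x * (real k - \<mu>)) - (1 + \<i> * of_real (x * (real k - \<mu>)) - of_real ((x * (real k - \<mu>))\<^sup>2) / 2)))
        \<le> tilt d y k * (\<bar>x * (real k - \<mu>)\<bar> ^ 3 / 6)"
      unfolding norm_mult using norm_cis_minus_quadratic[of "x * (real k - \<mu>)"]
      by (intro mult_mono) (auto simp: tilt_nonneg)
    also have "\<dots> \<le> tilt d y k * (\<bar>x\<bar> ^ 3 * ((real k - \<mu>)\<^sup>2 * real d))"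
    proof (intro mult_left_mono tilt_nonneg)
      have "\<bar>x * (real k - \<mu>)\<bar> ^ 3 / 6 \<le> \<bar>x * (real k - \<mu>)\<bar> ^ 3" by simp
      also have "\<bar>x * (real k - \<mu>)\<bar> ^ 3 = \<bar>x\<bar> ^ 3 * ((real k - \<mu>)\<^sup>2 * \<bar>real k - \<mu>\<bar>)"
      proof -
        have "\<bar>u\<bar> ^ 3 = u\<^sup>2 * \<bar>u\<bar>" for u :: real
          by (simp add: power3_eq_cube power2_eq_square abs_mult_self_eq)
        thus ?thesis by (simp only: abs_mult power_mult_distrib)
      qed
      also have "\<dots> \<le> \<bar>x\<bar> ^ 3 * ((real k - \<mu>)\<^sup>2 * real d)" using dev[of k] k by (intro mult_left_mono) auto
      finally show "\<bar>x * (real k - \<mu>)\<bar> ^ 3 / 6 \<le> \<bar>x\<bar> ^ 3 * ((real k - \<mu>)\<^sup>2 * real d)" .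
    qed
    finally show "cmod (of_real (tilt d y k) * (cis (x * (real k - \<mu>)) - (1 + \<i> * of_real (x * (real k - \<mu>)) - of_real ((x * (real k - \<mu>))\<^sup>2) / 2)))
        \<le> tilt d y k * (real k - \<mu>)\<^sup>2 * (\<bar>x\<bar> ^ 3 * real d)"
      by (simp only: mult_ac)
  qed
  also have "\<dots> = V * (\<bar>x\<bar> ^ 3 * real d)" by (simp add: V_def tilt_var_def \<mu>_def sum_distrib_right)
  finally have A: "cmod (a - of_real (1 - V * x\<^sup>2 / 2)) \<le> V * \<bar>x\<bar> ^ 3 * real d" by simp
  define s where "s = V * x\<^sup>2 / 2"
  have s: "0 \<le> s" using V0 by (simp add: s_def)
  have B: "\<bar>exp (- s) - (1 - s)\<bar> \<le> V * \<bar>x\<bar> ^ 3 * (real d)\<^sup>2"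
  \<comment> \<open>Quadratic error for small x, linear error for large x: in both regimes the power
    of x is at most |x|^3.\<close>
  proof (cases "\<bar>x\<bar> \<le> 1")
    case True
    have "x ^ 4 = \<bar>x\<bar> ^ 3 * \<bar>x\<bar>" by (simp add: power3_eq_cube eval_nat_numeral abs_mult_self_eq)
    also have "\<dots> \<le> \<bar>x\<bar> ^ 3 * 1" using True by (intro mult_left_mono) auto
    finally have x4: "x ^ 4 \<le> \<bar>x\<bar> ^ 3" by simp
    have "\<bar>exp (- s) - (1 - s)\<bar> \<le> s\<^sup>2" using exp_minus_linear_bounds(2)[OF s] .
    also have "s\<^sup>2 = V * x ^ 4 * V / 4" by (simp add: s_def power2_eq_square eval_nat_numeral)
    also have "\<dots> \<le> V * x ^ 4 * V" using V0 by simp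
    also have "\<dots> \<le> V * \<bar>x\<bar> ^ 3 * (real d)\<^sup>2" using V0 V2 x4 by (intro mult_mono) auto
    finally show ?thesis .
  next
    case False
    hence "x\<^sup>2 * 1 \<le> x\<^sup>2 * \<bar>x\<bar>" by (intro mult_left_mono) auto
    hence x3: "x\<^sup>2 \<le> \<bar>x\<bar> ^ 3" by (simp add: power3_eq_cube power2_eq_square abs_mult_self_eq)
    have "\<bar>exp (- s) - (1 - s)\<bar> \<le> s" using exp_minus_linear_bounds(1)[OF s] .
    also have "s \<le> V * x\<^sup>2 * 1" using V0 by (simp add: s_def)
    also have "\<dots> \<le> V * \<bar>x\<bar> ^ 3 * (real d)\<^sup>2" using V0 x3 d by (intro mult_mono) auto
    finally show ?thesis .
  qed
  have "cmod (a - of_real (exp (- s))) \<le> cmod (a - of_real (1 - s)) + cmod (of_real (1 - s) - of_real (exp (- s)))"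
    by (rule norm_triangle_sub[of "a - of_real (exp (- s))" "a - of_real (1 - s)", THEN order.trans]) simp
  also have "cmod (of_real (1 - s) - of_real (exp (- s))) = \<bar>exp (- s) - (1 - s)\<bar>"
    by (simp only: of_real_diff[symmetric] norm_of_real abs_minus_commute)
  also have "cmod (a - of_real (1 - s)) + \<bar>exp (- s) - (1 - s)\<bar> \<le> V * \<bar>x\<bar> ^ 3 * real d + V * \<bar>x\<bar> ^ 3 * (real d)\<^sup>2"
    using A B by (simp add: s_def)
  also have "\<dots> \<le> V * \<bar>x\<bar> ^ 3 * (real d)\<^sup>2 + V * \<bar>x\<bar> ^ 3 * (real d)\<^sup>2"
    using V0 d by (intro add_right_mono mult_left_mono) (auto simp: power2_eq_square)
  also have "\<dots> = 2 * \<bar>x\<bar> ^ 3 * (real d)\<^sup>2 * V" by simp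
  also have "\<dots> \<le> 2 * \<bar>x\<bar> ^ 3 * (real d)\<^sup>2 * (real d ^ 3 * exp (- y))"
    unfolding V_def using tilt_var_le by (intro mult_left_mono) auto
  also have "\<dots> = 2 * real d ^ 5 * (\<bar>x\<bar> ^ 3 * exp (- y))"
    by (simp add: power2_eq_square eval_nat_numeral)
  finally show "cmod ((\<Sum>k<d. of_real (tilt d y k) * cis (x * (real k - tilt_mean d y))) - of_real (exp (- (tilt_var d y * x\<^sup>2 / 2))))
    \<le> 2 * real d ^ 5 * (\<bar>x\<bar> ^ 3 * exp (- y))"
    by (simp add: a_def s_def V_def \<mu>_def)
qed

end

section \<open>Coefficient extraction\<close>

lemma has_integral_cis:
  fixes j :: int
  shows "((\<lambda>t. cis (of_int j * t)) has_integral (if j = 0 then 2 * pi else 0)) {-pi..pi}"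
proof (cases "j = 0")
  case True
  thus ?thesis using has_integral_const_real[of "1::complex" "-pi" pi]
    by (simp add: scaleR_conv_of_real)
next
  case False
  have "((\<lambda>t. - \<i> / of_int j * cis (of_int j * t)) has_vector_derivative cis (of_int j * t)) (at t within {-pi..pi})" for t
  proof -
    have "((\<lambda>t. cis (of_int j * t)) has_vector_derivative (of_int j *\<^sub>R (\<i> * cis (of_int j * t)))) (at t within {-pi..pi})"
      using exp_scaleR_has_vector_derivative_right[of "\<i> * of_int j" t "{-pi..pi}"]
      by (simp add: cis_conv_exp scaleR_conv_of_real mult_ac)
    from has_vector_derivative_mult_right[OF this, of "- \<i> / of_int j"] False
    show ?thesis by (simp add: scaleR_conv_of_real)
  qed
  hence "((\<lambda>t. cis (of_int j * t)) has_integral (- \<i> / of_int j * cis (of_int j * pi) - (- \<i> / of_int j * cis (of_int j * (- pi))))) {-pi..pi}"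
    by (intro fundamental_theorem_of_calculus) auto
  moreover have "cis (of_int j * pi) = cis (of_int j * (- pi))"
  proof -
    have "of_int j * pi = of_int j * (- pi) + of_int j * (2 * pi)" by simp
    hence "cis (of_int j * pi) = cis (of_int j * (- pi)) * cis (of_int j * (2 * pi))" by (metis cis_mult)
    also have "cis (of_int j * (2 * pi)) = 1" using cos_int_2pin[of j] sin_int_2pin[of j] by (simp add: complex_eq_iff mult_ac)
    finally show ?thesis by simp
  qed
  ultimately show ?thesis using False by simp
qed

lemma prod_cis: "(\<Prod>i\<in>A. cis (f i)) = cis (\<Sum>i\<in>A. f i)"
  by (induction A rule: infinite_finite_induct) (auto simp: cis_mult)

text \<open>Extensional functions, so that the set is finite and a product of sums expands over it;
  \<open>extend_digits\<close> later replaces the values outside H by 0.\<close>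

definition digit_choices :: "nat \<Rightarrow> nat set \<Rightarrow> nat \<Rightarrow> (nat \<Rightarrow> nat) set" where
  "digit_choices d H n = {a \<in> PiE H (\<lambda>_. {..<d}). (\<Sum>h\<in>H. a h * h) = n}"

lemma finite_digit_choices: "finite H \<Longrightarrow> finite (digit_choices d H n)"
  unfolding digit_choices_def by (intro finite_subset[OF _ finite_PiE[of H "\<lambda>_. {..<d}"]]) auto

text \<open>Arbitrary factors \<open>G\<close> make one formula serve for the probability of W = n,
  the centred correlations and the characteristic function.\<close>

lemma has_integral_coefficient:
  fixes G :: "nat \<Rightarrow> nat \<Rightarrow> complex"
  assumes fin: "finite H"
  shows "((\<lambda>t. cis (- (real n * t)) * (\<Prod>h\<in>H. \<Sum>k<d. G h k * cis (t * real h * real k)))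
    has_integral (2 * pi * (\<Sum>a\<in>digit_choices d H n. \<Prod>h\<in>H. G h (a h)))) {-pi..pi}"
proof -
  let ?\<Omega> = "PiE H (\<lambda>_. {..<d})"
  define W where "W = (\<lambda>a. \<Sum>h\<in>H. a h * h)"
  have fin\<Omega>: "finite ?\<Omega>" using fin by (intro finite_PiE) auto
  have eq: "cis (- (real n * t)) * (\<Prod>h\<in>H. \<Sum>k<d. G h k * cis (t * real h * real k))
      = (\<Sum>a\<in>?\<Omega>. (\<Prod>h\<in>H. G h (a h)) * cis (of_int (int (W a) - int n) * t))" for t
  proof -
    have "(\<Prod>h\<in>H. \<Sum>k<d. G h k * cis (t * real h * real k))
        = (\<Sum>a\<in>?\<Omega>. \<Prod>h\<in>H. G h (a h) * cis (t * real h * real (a h)))"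
      using fin by (subst prod_sum_PiE) auto
    also have "\<dots> = (\<Sum>a\<in>?\<Omega>. (\<Prod>h\<in>H. G h (a h)) * cis (real (W a) * t))"
      by (intro sum.cong refl) (simp add: prod.distrib prod_cis W_def sum_distrib_left sum_distrib_right mult_ac)
    moreover have "cis (- (real n * t)) * (c * cis (real (W a) * t)) = c * cis (of_int (int (W a) - int n) * t)" for a c
    proof -
      have "cis (of_int (int (W a) - int n) * t) = cis (- (real n * t)) * cis (real (W a) * t)"
        by (simp add: cis_mult algebra_simps)
      thus ?thesis by (simp only: mult_ac)
    qed
    ultimately show ?thesis by (simp only: sum_distrib_left)
  qed
  have "((\<lambda>t. \<Sum>a\<in>?\<Omega>. (\<Prod>h\<in>H. G h (a h)) * cis (of_int (int (W a) - int n) * t)) has_integral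
      (\<Sum>a\<in>?\<Omega>. (\<Prod>h\<in>H. G h (a h)) * (if int (W a) - int n = 0 then 2 * pi else 0))) {-pi..pi}"
    by (intro has_integral_sum[OF fin\<Omega>] has_integral_mult_right has_integral_cis)
  also have "(\<Sum>a\<in>?\<Omega>. (\<Prod>h\<in>H. G h (a h)) * complex_of_real (if int (W a) - int n = 0 then 2 * pi else 0))
      = (\<Sum>a\<in>?\<Omega>. if W a = n then 2 * pi * (\<Prod>h\<in>H. G h (a h)) else 0)"
    by (intro sum.cong) auto
  also have "\<dots> = 2 * pi * (\<Sum>a\<in>digit_choices d H n. \<Prod>h\<in>H. G h (a h))"
    unfolding digit_choices_def sum_distrib_left W_def by (subst sum.inter_filter[OF fin\<Omega>]) simp
  finally show ?thesis unfolding eq .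
qed

lemma norm_coefficient_le:
  fixes G :: "nat \<Rightarrow> nat \<Rightarrow> complex"
  assumes fin: "finite H" and int: "f integrable_on {-pi..pi}"
    and bound: "\<And>t. t \<in> {-pi..pi} \<Longrightarrow> cmod (\<Prod>h\<in>H. \<Sum>k<d. G h k * cis (t * real h * real k)) \<le> f t"
  shows "cmod (\<Sum>a\<in>digit_choices d H n. \<Prod>h\<in>H. G h (a h)) \<le> integral {-pi..pi} f"
proof -
  note hi = has_integral_coefficient[OF fin, where n = n and d = d and G = G]
  have "cmod (2 * pi * (\<Sum>a\<in>digit_choices d H n. \<Prod>h\<in>H. G h (a h))) \<le> integral {-pi..pi} f"
    unfolding integral_unique[OF hi, symmetric]
    using bound by (intro integral_norm_bound_integral has_integral_integrable[OF hi] int) (auto simp: norm_mult)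
  \<comment> \<open>The factor 1/(2 pi) of the inversion formula is estimated by 1.\<close>
  moreover have "1 * cmod (\<Sum>a\<in>digit_choices d H n. \<Prod>h\<in>H. G h (a h)) \<le> 2 * pi * cmod (\<Sum>a\<in>digit_choices d H n. \<Prod>h\<in>H. G h (a h))"
    using pi_gt3 by (intro mult_right_mono) auto
  ultimately show ?thesis by (simp add: norm_mult)
qed

text \<open>Factors are exchanged one at a time. The majorants \<open>e\<close> of the untouched
  factors are kept, because their product supplies the decay in t.\<close>

lemma norm_prod_diff_le:
  fixes a b :: "'i \<Rightarrow> complex"
  assumes "finite A" "\<And>i. i \<in> A \<Longrightarrow> cmod (a i) \<le> e i" "\<And>i. i \<in> A \<Longrightarrow> cmod (b i) \<le> e i"
  shows "cmod ((\<Prod>i\<in>A. a i) - (\<Prod>i\<in>A. b i)) \<le> (\<Sum>i\<in>A. cmod (a i - b i) * (\<Prod>j\<in>A - {i}. e j))"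
  using assms
proof (induction A rule: finite_induct)
  case (insert x A)
  have e0: "0 \<le> e i" if "i \<in> insert x A" for i using insert.prems(1)[OF that] norm_ge_zero by (rule order.trans[rotated])
  have "(\<Prod>i\<in>insert x A. a i) - (\<Prod>i\<in>insert x A. b i) = (a x - b x) * (\<Prod>i\<in>A. a i) + b x * ((\<Prod>i\<in>A. a i) - (\<Prod>i\<in>A. b i))"
    using insert by (simp add: algebra_simps)
  also have "cmod \<dots> \<le> cmod (a x - b x) * (\<Prod>i\<in>A. e i) + e x * (\<Sum>i\<in>A. cmod (a i - b i) * (\<Prod>j\<in>A - {i}. e j))"
  proof (intro norm_triangle_mono)
    show "cmod ((a x - b x) * (\<Prod>i\<in>A. a i)) \<le> cmod (a x - b x) * (\<Prod>i\<in>A. e i)"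
      unfolding norm_mult using insert.prems
      by (intro mult_left_mono order.trans[OF eq_refl[OF prod_norm[symmetric]] prod_mono]) auto
    show "cmod (b x * ((\<Prod>i\<in>A. a i) - (\<Prod>i\<in>A. b i))) \<le> e x * (\<Sum>i\<in>A. cmod (a i - b i) * (\<Prod>j\<in>A - {i}. e j))"
      unfolding norm_mult using insert by (intro mult_mono insert.IH) (auto intro: e0)
  qed
  also have "e x * (\<Sum>i\<in>A. cmod (a i - b i) * (\<Prod>j\<in>A - {i}. e j)) = (\<Sum>i\<in>A. cmod (a i - b i) * (\<Prod>j\<in>insert x A - {i}. e j))"
  proof -
    have "(\<Prod>j\<in>insert x A - {i}. e j) = e x * (\<Prod>j\<in>A - {i}. e j)" if "i \<in> A" for i
    proof -
      have "insert x A - {i} = insert x (A - {i})" using that insert by auto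
      thus ?thesis using insert by simp
    qed
    thus ?thesis by (simp add: sum_distrib_left mult_ac)
  qed
  also have "cmod (a x - b x) * (\<Prod>i\<in>A. e i) = cmod (a x - b x) * (\<Prod>j\<in>insert x A - {x}. e j)"
    using insert by simp
  finally show ?case using insert by simp
qed simp

section \<open>Conditioned moments and characteristic function\<close>

lemma norm_coefficient_diff_le:
  fixes G G' :: "nat \<Rightarrow> nat \<Rightarrow> complex"
  assumes fin: "finite H" and int: "f integrable_on {-pi..pi}"
    and bound: "\<And>t. t \<in> {-pi..pi} \<Longrightarrow> cmod ((\<Prod>h\<in>H. \<Sum>k<d. G h k * cis (t * real h * real k)) - (\<Prod>h\<in>H. \<Sum>k<d. G' h k * cis (t * real h * real k))) \<le> f t"
  shows "cmod ((\<Sum>a\<in>digit_choices d H n. \<Prod>h\<in>H. G h (a h)) - (\<Sum>a\<in>digit_choices d H n. \<Prod>h\<in>H. G' h (a h))) \<le> integral {-pi..pi} f"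
proof -
  let ?Q = "\<lambda>G. \<Sum>a\<in>digit_choices d H n. \<Prod>h\<in>H. G h (a h)"
  note hi = has_integral_diff[OF has_integral_coefficient[OF fin, where n = n and d = d and G = G]
      has_integral_coefficient[OF fin, where n = n and d = d and G = G']]
  have "cmod (2 * pi * ?Q G - 2 * pi * ?Q G') \<le> integral {-pi..pi} f"
    unfolding integral_unique[OF hi, symmetric]
    using bound by (intro integral_norm_bound_integral has_integral_integrable[OF hi] int)
      (auto simp: norm_mult right_diff_distrib[symmetric])
  moreover have "2 * pi * ?Q G - 2 * pi * ?Q G' = of_real (2 * pi) * (?Q G - ?Q G')" by (simp add: right_diff_distrib)
  moreover have "1 * cmod (?Q G - ?Q G') \<le> 2 * pi * cmod (?Q G - ?Q G')"
    using pi_gt3 by (intro mult_right_mono) auto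
  ultimately show ?thesis by (simp only: norm_mult norm_of_real) simp
qed

text \<open>By half-angles and subadditivity of |sin|, shifting the angle by u costs half of 1 - cos
  x and a term u^2/2. The twist by the digit count shifts the phase between the digits 0 and 1; the
  halving is why \<open>decay / 2\<close> appears in the exponent later.\<close>

lemma one_minus_cos_add_ge: "(1 - cos x) / 2 - u\<^sup>2 / 2 \<le> 1 - cos (x + u)" for x u :: real
proof -
  define \<alpha> \<beta> where "\<alpha> = (x + u) / 2" and "\<beta> = u / 2"
  have "sin (x / 2) = sin \<alpha> * cos \<beta> - cos \<alpha> * sin \<beta>"
    using sin_diff[of \<alpha> \<beta>] by (simp add: \<alpha>_def \<beta>_def flip: diff_divide_distrib)
  hence "\<bar>sin (x / 2)\<bar> \<le> \<bar>sin \<alpha>\<bar> * \<bar>cos \<beta>\<bar> + \<bar>cos \<alpha>\<bar> * \<bar>sin \<beta>\<bar>"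
    by (simp add: abs_mult[symmetric] order.trans[OF abs_triangle_ineq4])
  also have "\<dots> \<le> \<bar>sin \<alpha>\<bar> * 1 + 1 * \<bar>sin \<beta>\<bar>" by (intro add_mono mult_mono) auto
  finally have "\<bar>sin (x / 2)\<bar> \<le> \<bar>sin \<alpha>\<bar> + \<bar>sin \<beta>\<bar>" by simp
  hence "\<bar>sin (x / 2)\<bar>\<^sup>2 \<le> (\<bar>sin \<alpha>\<bar> + \<bar>sin \<beta>\<bar>)\<^sup>2" by (intro power_mono) auto
  also have "\<dots> \<le> 2 * \<bar>sin \<alpha>\<bar>\<^sup>2 + 2 * \<bar>sin \<beta>\<bar>\<^sup>2"
    using zero_le_power2[of "\<bar>sin \<alpha>\<bar> - \<bar>sin \<beta>\<bar>"] by (simp add: power2_eq_square algebra_simps)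
  finally have sq: "(sin (x / 2))\<^sup>2 - 2 * (sin \<beta>)\<^sup>2 \<le> 2 * (sin \<alpha>)\<^sup>2" by simp
  have eqs: "1 - cos x = 2 * (sin (x / 2))\<^sup>2" "1 - cos (x + u) = 2 * (sin \<alpha>)\<^sup>2" "1 - cos u = 2 * (sin \<beta>)\<^sup>2"
    unfolding \<alpha>_def \<beta>_def by (rule one_minus_cos)+
  have "(1 - cos x) / 2 - u\<^sup>2 / 2 \<le> (1 - cos x) / 2 - (1 - cos u)" using one_minus_cos_le[of u] by simp
  also have "\<dots> = (sin (x / 2))\<^sup>2 - 2 * (sin \<beta>)\<^sup>2" unfolding eqs by simp
  also have "\<dots> \<le> 1 - cos (x + u)" using sq by (simp only: eqs)
  finally show ?thesis .
qed

section \<open>The setting at a saddle point, envelopes, and the first two conditioned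
  moments\<close>

locale multi_base = coprime_bases +
  fixes d b :: nat
  assumes m_ge_2: "2 \<le> m" and d_ge_2: "2 \<le> d" and b_ge_1: "1 \<le> b" and b_less: "b < d"
begin

text \<open>The lower bound of \<open>tilt_0_1_ge\<close> for the product of the probabilities of
  the digits 0 and 1 at h \<le> X.\<close>

definition decay :: real where "decay = exp (- 1) / (real d)\<^sup>2"

lemma decay_pos: "0 < decay" using d_ge_2 by (simp add: decay_def)

lemma decay_le_1: "decay \<le> 1"
proof -
  have "exp (- 1::real) \<le> 1" by simp
  also have "1 \<le> (real d)\<^sup>2" using d_ge_2 by simp
  finally show ?thesis unfolding decay_def using d_ge_2 by (simp add: divide_le_eq)
qed

end

text \<open>All that is used about one n and its saddle point z. \<open>C\<close> is a parameter so
  that the constants \<open>K1\<close> to \<open>K5\<close> depend on d and C only and are uniform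
  in n; \<open>saddle_exists\<close> provides one C for all large n.\<close>

locale saddle = multi_base +
  fixes C z :: real and n :: nat
  assumes C_ge_1: "1 \<le> C" and z_pos: "0 < z" and X_ge: "exp 1 \<le> 1 / z" and X_le: "1 / z \<le> real n"
    and mean_eq: "(\<Sum>h\<in>mb_le m p (real n). real h * tilt_mean d (z * real h)) = real n"
    and card_le: "real (card (mb_le m p (real n))) \<le> C * ln (1 / z) ^ m"
    and sums_le: "\<And>j. 1 \<le> j \<Longrightarrow> j \<le> 3 \<Longrightarrow>
      (\<Sum>h\<in>mb_le m p (real n). (z * real h) ^ j * exp (- (z * real h))) \<le> C * ln (1 / z) ^ (m - 1)"
    and arcs_le: "\<And>k. k \<le> 3 \<Longrightarrow>
      integral {-pi..pi} (\<lambda>t. arc_weight (1 / z) t ^ k * exp (- (decay / 2) * semi_deficit m p (1 / z) t))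
        \<le> C / (1 / z * sqrt (ln (1 / z) ^ (m - 1)) ^ Suc k)"
begin

abbreviation "H \<equiv> mb_le m p (real n)"
definition X where "X = 1 / z"
definition ell where "ell = ln X"
text \<open>Up to constants, X s is the standard deviation of W, and s^2 is the number of semigroup
  elements within a constant factor of X.\<close>

definition s where "s = sqrt (ell ^ (m - 1))"
definition env where "env t = exp (- (decay / 2) * semi_deficit m p X t)"
definition e1 where "e1 h t = min 1 (\<bar>t * real h\<bar> * ((real d)\<^sup>2 * exp (- (z * real h))))"
text \<open>The product law; \<open>mass\<close> is then the probability of W = n.\<close>

definition weight where "weight a = (\<Prod>h\<in>H. tilt d (z * real h) (a h))"
definition mass where "mass = (\<Sum>a\<in>digit_choices d H n. weight a)"
definition xi :: "nat \<Rightarrow> nat \<Rightarrow> real" where "xi h k = (if k = b then 1 else 0) - tilt d (z * real h) b"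
definition v where "v h = tilt d (z * real h) b * (1 - tilt d (z * real h) b)"

lemma X_pos: "0 < X" using z_pos by (simp add: X_def)

lemma ell_ge_1: "1 \<le> ell"
  using X_ge X_pos unfolding ell_def X_def by (metis exp_gt_zero ln_exp ln_le_cancel_iff)

lemma s_ge_1: "1 \<le> s" using ell_ge_1 by (simp add: s_def)

lemma s_squared: "s\<^sup>2 = ell ^ (m - 1)" using ell_ge_1 by (simp add: s_def)

lemma card_H_le: "real (card H) \<le> C * s\<^sup>2 * ell"
proof -
  have "ell ^ m = ell ^ (m - 1) * ell" using m_ge_2 by (cases m) auto
  thus ?thesis using card_le by (simp add: s_squared ell_def X_def mult_ac)
qed

lemma finite_choices [simp]: "finite (digit_choices d H n)"
  by (intro finite_digit_choices) auto

lemma tilted: "tilted_digit d (z * real h)"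
  using d_ge_2 z_pos by unfold_locales auto

lemma arcs: "k \<le> 3 \<Longrightarrow> integral {-pi..pi} (\<lambda>t. arc_weight X t ^ k * env t) \<le> C / (X * s ^ Suc k)"
  using arcs_le[of k] by (simp add: env_def X_def s_def ell_def)

lemma continuous_env [continuous_intros]: "continuous_on A env"
  unfolding env_def by (intro continuous_intros)

lemma env_pos: "0 < env t" by (simp add: env_def)

lemma continuous_e1 [continuous_intros]: "continuous_on A (e1 h)"
  unfolding e1_def by (intro continuous_intros)

lemma e1_nonneg: "0 \<le> e1 h t" by (simp add: e1_def)

text \<open>One bound for each branch of the minimum in \<open>arc_weight\<close>: summing the terms
  gives the power of X|t|, and counting all of H gives s^2 ell, which suffices since
  \<open>1 \<le> j\<close>.\<close>

lemma min_sum_le_arc_weight: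
  assumes j: "1 \<le> j" "j \<le> 3" and A: "1 \<le> A"
  shows "(\<Sum>h\<in>H. min 1 (A * (\<bar>t * real h\<bar> ^ j * exp (- (z * real h))))) \<le> A * C * s\<^sup>2 * arc_weight X t ^ j"
proof -
  have "(\<Sum>h\<in>H. min 1 (A * (\<bar>t * real h\<bar> ^ j * exp (- (z * real h))))) \<le> (\<Sum>h\<in>H. A * (\<bar>t * real h\<bar> ^ j * exp (- (z * real h))))"
    by (intro sum_mono) auto
  also have "\<dots> = A * (X * \<bar>t\<bar>) ^ j * (\<Sum>h\<in>H. (z * real h) ^ j * exp (- (z * real h)))"
    using z_pos by (simp add: sum_distrib_left X_def power_mult_distrib power_divide abs_mult mult_ac)
  also have "\<dots> \<le> A * (X * \<bar>t\<bar>) ^ j * (C * s\<^sup>2)"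
    using sums_le[OF j] A X_pos by (intro mult_left_mono) (auto simp: s_squared ell_def X_def)
  finally have 1: "(\<Sum>h\<in>H. min 1 (A * (\<bar>t * real h\<bar> ^ j * exp (- (z * real h))))) \<le> A * C * s\<^sup>2 * (X * \<bar>t\<bar>) ^ j"
    by (simp add: mult_ac)
  have "(\<Sum>h\<in>H. min 1 (A * (\<bar>t * real h\<bar> ^ j * exp (- (z * real h))))) \<le> real (card H) * 1"
    by (intro sum_bounded_above) auto
  also have "\<dots> \<le> 1 * (C * s\<^sup>2 * ell ^ 1)" using card_H_le by simp
  also have "\<dots> \<le> A * (C * s\<^sup>2 * ell ^ j)"
    using A C_ge_1 ell_ge_1 s_ge_1 j by (intro mult_mono power_increasing) auto
  finally have 2: "(\<Sum>h\<in>H. min 1 (A * (\<bar>t * real h\<bar> ^ j * exp (- (z * real h))))) \<le> A * C * s\<^sup>2 * ell ^ j"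
    by (simp add: mult_ac)
  show ?thesis using 1 2 by (simp add: arc_weight_def ell_def min_def)
qed

lemma sum_e1_le: "(\<Sum>h\<in>H. e1 h t) \<le> (real d)\<^sup>2 * C * s\<^sup>2 * arc_weight X t"
  using min_sum_le_arc_weight[of 1 "(real d)\<^sup>2" t] d_ge_2 unfolding e1_def by (simp add: mult_ac)

text \<open>Majorant of a single factor. The first term is the loss from a phase shift of size at
  most |\<theta>|; a gain is claimed only for h \<le> X, where the digits 0 and 1 have probabilities
  bounded below.\<close>

definition envelope :: "real \<Rightarrow> nat \<Rightarrow> real \<Rightarrow> real" where
  "envelope \<theta> h t = exp (decay * \<theta>\<^sup>2 / 2 - (if real h \<le> X then decay / 2 * (1 - cos (real h * t)) else 0))"

lemma mb_le_X: "mb_le m p X = {h \<in> H. real h \<le> X}"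
  using X_le by (auto simp: mb_le_def X_def)

text \<open>Omitting up to two factors costs only a constant, since each factor is bounded below.\<close>
lemma prod_envelope_le:
  assumes E: "E \<subseteq> H" "card E \<le> 2"
  shows "(\<Prod>h\<in>H - E. envelope \<theta> h t) \<le> exp 2 * exp (real (card H) * \<theta>\<^sup>2) * env t"
proof -
  define f where "f = (\<lambda>h. if real h \<le> X then decay / 2 * (1 - cos (real h * t)) else 0)"
  have f: "0 \<le> f h" "f h \<le> 1" for h
  proof -
    show "0 \<le> f h" using decay_pos by (simp add: f_def)
    have "decay / 2 * (1 - cos (real h * t)) \<le> 1 / 2 * 2"
      using decay_le_1 decay_pos cos_ge_minus_one[of "real h * t"] by (intro mult_mono) auto
    thus "f h \<le> 1" by (simp add: f_def)
  qed
  have finE: "finite E" using E(1) finite_subset by auto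
  have "(\<Prod>h\<in>H - E. envelope \<theta> h t) = exp (\<Sum>h\<in>H - E. decay * \<theta>\<^sup>2 / 2 - f h)"
    unfolding envelope_def f_def by (subst exp_sum) auto
  also have "(\<Sum>h\<in>H - E. decay * \<theta>\<^sup>2 / 2 - f h) = real (card (H - E)) * (decay * \<theta>\<^sup>2 / 2) - (\<Sum>h\<in>H. f h) + (\<Sum>h\<in>E. f h)"
    using E finE by (simp add: sum_subtractf sum_diff)
  also have "(\<Sum>h\<in>H. f h) = decay / 2 * semi_deficit m p X t"
    unfolding f_def semi_deficit_def mb_le_X by (simp add: sum.inter_filter sum_distrib_left if_distrib cong: if_cong)
  also have "real (card (H - E)) * (decay * \<theta>\<^sup>2 / 2) - decay / 2 * semi_deficit m p X t + (\<Sum>h\<in>E. f h)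
      \<le> real (card H) * \<theta>\<^sup>2 - decay / 2 * semi_deficit m p X t + 2"
  proof -
    have "(\<Sum>h\<in>E. f h) \<le> real (card E) * 1" using f by (intro sum_bounded_above) auto
    hence "(\<Sum>h\<in>E. f h) \<le> 2" using E(2) by simp
    moreover have "real (card (H - E)) * (decay * \<theta>\<^sup>2 / 2) \<le> real (card H) * (1 * \<theta>\<^sup>2)"
    proof (intro mult_mono)
      have "decay * \<theta>\<^sup>2 / 2 \<le> decay * \<theta>\<^sup>2" using decay_pos by simp
      also have "\<dots> \<le> 1 * \<theta>\<^sup>2" using decay_le_1 by (intro mult_right_mono) auto
      finally show "decay * \<theta>\<^sup>2 / 2 \<le> 1 * \<theta>\<^sup>2" .
    qed (use decay_pos in \<open>auto intro: card_mono\<close>)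
    ultimately show ?thesis by simp
  qed
  also have "exp (real (card H) * \<theta>\<^sup>2 - decay / 2 * semi_deficit m p X t + 2) = exp 2 * exp (real (card H) * \<theta>\<^sup>2) * env t"
    unfolding env_def exp_add[symmetric] by simp
  finally show ?thesis by simp
qed

lemma prod_envelope_0_le:
  assumes "E \<subseteq> H" "card E \<le> 2"
  shows "(\<Prod>h\<in>H - E. envelope 0 h t) \<le> exp 2 * env t"
  using prod_envelope_le[OF assms, of 0 t] by simp

lemma envelope_nonneg: "0 \<le> envelope \<theta> h t" by (simp add: envelope_def)

lemma unimodular_le_envelope:
  assumes f: "f 1 - f 0 = t * real h + u" and u: "\<bar>u\<bar> \<le> \<bar>\<theta>\<bar>"
  shows "cmod (\<Sum>k<d. of_real (tilt d (z * real h) k) * cis (f k)) \<le> envelope \<theta> h t"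
proof -
  interpret tilted_digit d "z * real h" by (rule tilted)
  show ?thesis
  proof (cases "real h \<le> X")
    case True
    hence y1: "z * real h \<le> 1" using z_pos by (simp add: X_def field_simps)
    have cosu: "(1 - cos (real h * t)) / 2 - \<theta>\<^sup>2 / 2 \<le> 1 - cos (f 1 - f 0)"
    proof -
      have "u\<^sup>2 \<le> \<theta>\<^sup>2" using u by (simp add: abs_le_square_iff)
      thus ?thesis using one_minus_cos_add_ge[of "t * real h" u] f by (simp add: mult.commute)
    qed
    have "decay * ((1 - cos (real h * t)) / 2 - \<theta>\<^sup>2 / 2) \<le> decay * (1 - cos (f 1 - f 0))"
      using cosu decay_pos by (intro mult_left_mono) auto
    also have "\<dots> \<le> (tilt d (z * real h) 0 * tilt d (z * real h) 1) * (1 - cos (f 1 - f 0))"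
      using tilt_0_1_ge[OF y1] by (intro mult_right_mono) (auto simp: decay_def)
    finally have "- (tilt d (z * real h) 0 * tilt d (z * real h) 1) * (1 - cos (f 1 - f 0))
        \<le> - (decay * ((1 - cos (real h * t)) / 2 - \<theta>\<^sup>2 / 2))" by simp
    also have "\<dots> = decay * \<theta>\<^sup>2 / 2 - decay / 2 * (1 - cos (real h * t))" by (simp add: field_simps)
    finally have "exp (- (tilt d (z * real h) 0 * tilt d (z * real h) 1) * (1 - cos (f 1 - f 0))) \<le> envelope \<theta> h t"
      unfolding envelope_def using True by simp
    thus ?thesis using norm_unimodular_tilt_sum_le[of f] by linarith
  next
    case False
    have "cmod (\<Sum>k<d. of_real (tilt d (z * real h) k) * cis (f k)) \<le> 1" by (intro norm_tilt_sum_le) auto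
    also have "1 \<le> envelope \<theta> h t" using False decay_pos by (simp add: envelope_def)
    finally show ?thesis .
  qed
qed

lemma phi_le_envelope:
  "cmod (\<Sum>k<d. of_real (tilt d (z * real h) k) * cis (t * real h * real k)) \<le> envelope \<theta> h t"
  by (rule unimodular_le_envelope[where u = 0]) auto

lemma e1_bound:
  assumes "\<And>k. k < d \<Longrightarrow> cmod (g k) \<le> 1" "(\<Sum>k<d. of_real (tilt d (z * real h) k) * g k) = 0"
  shows "cmod (\<Sum>k<d. of_real (tilt d (z * real h) k) * g k * cis (t * real h * real k)) \<le> e1 h t"
  unfolding e1_def by (rule tilted_digit.norm_centred_tilt_sum_le[OF tilted assms])

lemma of_real_weight: "of_real (weight a) = (\<Prod>h\<in>H. complex_of_real (tilt d (z * real h) (a h)))"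
  by (simp add: weight_def)

text \<open>At the sites of \<open>E\<close>, centring replaces the envelope by \<open>e1\<close>;
  the other sites are untouched. One site serves for means and diagonal terms, two for
  covariances.\<close>

lemma centred_correlation_le:
  fixes g :: "nat \<Rightarrow> nat \<Rightarrow> complex"
  assumes E: "E \<subseteq> H" "card E \<le> 2"
    and g: "\<And>h k. h \<in> E \<Longrightarrow> k < d \<Longrightarrow> cmod (g h k) \<le> 1"
    and mean0: "\<And>h. h \<in> E \<Longrightarrow> (\<Sum>k<d. of_real (tilt d (z * real h) k) * g h k) = 0"
  shows "cmod (\<Sum>a\<in>digit_choices d H n. of_real (weight a) * (\<Prod>h\<in>E. g h (a h)))
    \<le> exp 2 * integral {-pi..pi} (\<lambda>t. (\<Prod>h\<in>E. e1 h t) * env t)"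
proof -
  define G where "G = (\<lambda>h k. of_real (tilt d (z * real h) k) * (if h \<in> E then g h k else 1))"
  have HE: "H \<inter> E = E" using E by auto
  have prodG: "(\<Prod>h\<in>H. G h (a h)) = of_real (weight a) * (\<Prod>h\<in>E. g h (a h))" for a
    unfolding G_def prod.distrib of_real_weight
    by (simp add: prod.If_cases HE)
  have "cmod (\<Sum>a\<in>digit_choices d H n. \<Prod>h\<in>H. G h (a h))
      \<le> integral {-pi..pi} (\<lambda>t. exp 2 * ((\<Prod>h\<in>E. e1 h t) * env t))"
  proof (rule norm_coefficient_le)
    show "(\<lambda>t. exp 2 * ((\<Prod>h\<in>E. e1 h t) * env t)) integrable_on {-pi..pi}"
      by (intro integrable_continuous_real continuous_intros)
    fix t
    have "(\<Prod>h\<in>H. \<Sum>k<d. G h k * cis (t * real h * real k))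
        = (\<Prod>h\<in>E. \<Sum>k<d. G h k * cis (t * real h * real k)) * (\<Prod>h\<in>H - E. \<Sum>k<d. G h k * cis (t * real h * real k))"
      using E by (subst prod.subset_diff[OF E(1)]) (auto simp: mult.commute)
    also have "cmod \<dots> \<le> (\<Prod>h\<in>E. e1 h t) * (\<Prod>h\<in>H - E. envelope 0 h t)"
      unfolding norm_mult
    proof (intro mult_mono)
      show "cmod (\<Prod>h\<in>E. \<Sum>k<d. G h k * cis (t * real h * real k)) \<le> (\<Prod>h\<in>E. e1 h t)"
        unfolding prod_norm[symmetric] using e1_bound g mean0 by (intro prod_mono) (auto simp: G_def)
      show "cmod (\<Prod>h\<in>H - E. \<Sum>k<d. G h k * cis (t * real h * real k)) \<le> (\<Prod>h\<in>H - E. envelope 0 h t)"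
        unfolding prod_norm[symmetric] using phi_le_envelope by (intro prod_mono) (auto simp: G_def)
    qed (auto intro: prod_nonneg e1_nonneg)
    also have "\<dots> \<le> (\<Prod>h\<in>E. e1 h t) * (exp 2 * env t)"
      using prod_envelope_0_le[OF E] by (intro mult_left_mono prod_nonneg) (auto intro: e1_nonneg)
    finally show "cmod (\<Prod>h\<in>H. \<Sum>k<d. G h k * cis (t * real h * real k)) \<le> exp 2 * ((\<Prod>h\<in>E. e1 h t) * env t)"
      by (simp only: mult_ac)
  qed simp
  thus ?thesis unfolding prodG by simp
qed

definition K1 where "K1 = exp 2 * (real d)\<^sup>2 * C\<^sup>2"

text \<open>Summing over h before integrating produces s^2, which cancels against the order 1/(X
  s^2) of the integral.\<close>

lemma sum_integral_e1_le:
  "(\<Sum>h\<in>H. exp 2 * integral {-pi..pi} (\<lambda>t. e1 h t * env t)) \<le> K1 / X"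
proof -
  have int: "(\<lambda>t. e1 h t * env t) integrable_on {-pi..pi}" for h
    by (intro integrable_continuous_real continuous_intros)
  have "(\<Sum>h\<in>H. integral {-pi..pi} (\<lambda>t. e1 h t * env t)) = integral {-pi..pi} (\<lambda>t. (\<Sum>h\<in>H. e1 h t) * env t)"
    using int by (simp add: sum_distrib_right integral_sum)
  also have "\<dots> \<le> integral {-pi..pi} (\<lambda>t. (real d)\<^sup>2 * C * s\<^sup>2 * (arc_weight X t ^ 1 * env t))"
  proof (intro integral_le integrable_continuous_real continuous_intros)
    fix t
    show "(\<Sum>h\<in>H. e1 h t) * env t \<le> (real d)\<^sup>2 * C * s\<^sup>2 * (arc_weight X t ^ 1 * env t)"
      using sum_e1_le[of t] env_pos[of t] by (simp add: mult.assoc[symmetric] mult_right_mono)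
  qed
  also have "\<dots> = (real d)\<^sup>2 * C * s\<^sup>2 * integral {-pi..pi} (\<lambda>t. arc_weight X t ^ 1 * env t)" by (rule integral_mult_right)
  also have "\<dots> \<le> (real d)\<^sup>2 * C * s\<^sup>2 * (C / (X * s ^ Suc 1))"
    using C_ge_1 by (intro mult_left_mono arcs) auto
  also have "\<dots> = (real d)\<^sup>2 * C\<^sup>2 / X" using s_ge_1 by (simp add: power2_eq_square)
  finally have "exp 2 * (\<Sum>h\<in>H. integral {-pi..pi} (\<lambda>t. e1 h t * env t)) \<le> exp 2 * ((real d)\<^sup>2 * C\<^sup>2 / X)"
    by (intro mult_left_mono) auto
  thus ?thesis by (simp add: sum_distrib_left K1_def mult_ac)
qed

lemma xi_bound: "k < d \<Longrightarrow> \<bar>xi h k\<bar> \<le> 1"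
  using tilted_digit.tilt_nonneg[OF tilted, of h b] tilted_digit.tilt_le_1[OF tilted b_less, of h]
  by (auto simp: xi_def)

lemma tilt_sum_indicator: "(\<Sum>k<d. tilt d (z * real h) k * (if k = b then c else 0)) = tilt d (z * real h) b * c"
  using b_less by (simp add: if_distrib cong: if_cong)

lemma xi_mean: "(\<Sum>k<d. tilt d (z * real h) k * xi h k) = 0"
  using tilted_digit.sum_tilt[OF tilted, of h] tilt_sum_indicator[of h 1]
  by (simp add: xi_def right_diff_distrib sum_subtractf flip: sum_distrib_right)

lemma xi_var: "(\<Sum>k<d. tilt d (z * real h) k * (xi h k)\<^sup>2) = v h"
proof -
  define q where "q = tilt d (z * real h) b"
  have "(xi h k)\<^sup>2 = (if k = b then 1 - 2 * q else 0) + q\<^sup>2" for k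
    by (simp add: xi_def q_def power2_eq_square algebra_simps)
  hence "(\<Sum>k<d. tilt d (z * real h) k * (xi h k)\<^sup>2) = q * (1 - 2 * q) + q\<^sup>2"
    using tilted_digit.sum_tilt[OF tilted, of h] tilt_sum_indicator[of h "1 - 2 * q"]
    by (simp add: distrib_left sum.distrib q_def flip: sum_distrib_right)
  thus ?thesis by (simp add: v_def q_def power2_eq_square algebra_simps)
qed

lemma v_bounds: "0 \<le> v h" "v h \<le> 1"
proof -
  have q: "0 \<le> tilt d (z * real h) b" "tilt d (z * real h) b \<le> 1"
    using tilted_digit.tilt_nonneg[OF tilted] tilted_digit.tilt_le_1[OF tilted b_less] by auto
  show "0 \<le> v h" using q by (simp add: v_def)
  have "v h \<le> 1 * 1" unfolding v_def using q by (intro mult_mono) auto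
  thus "v h \<le> 1" by simp
qed

definition centred where "centred a = (\<Sum>h\<in>H. xi h (a h))"

lemma complex_of_real_tilt_sum:
  "(\<Sum>k<d. complex_of_real (tilt d (z * real h) k) * of_real (g k)) = of_real (\<Sum>k<d. tilt d (z * real h) k * g k)"
  by simp

text \<open>Division by \<open>mass\<close>, at least of order 1/(X s), will turn this into a shift
  of the mean by O(s).\<close>

lemma first_moment: "\<bar>\<Sum>a\<in>digit_choices d H n. weight a * centred a\<bar> \<le> K1 / X"
proof -
  have each: "\<bar>\<Sum>a\<in>digit_choices d H n. weight a * xi h (a h)\<bar> \<le> exp 2 * integral {-pi..pi} (\<lambda>t. e1 h t * env t)"
    if h: "h \<in> H" for h
  proof -
    have "cmod (\<Sum>a\<in>digit_choices d H n. of_real (weight a) * (\<Prod>h\<in>{h}. of_real (xi h (a h))))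
      \<le> exp 2 * integral {-pi..pi} (\<lambda>t. (\<Prod>h\<in>{h}. e1 h t) * env t)"
      using h xi_bound xi_mean by (intro centred_correlation_le) (auto simp only: complex_of_real_tilt_sum norm_of_real of_real_0 singleton_iff card.insert, auto)
    moreover have "(\<Sum>a\<in>digit_choices d H n. of_real (weight a) * (\<Prod>h\<in>{h}. complex_of_real (xi h (a h))))
        = of_real (\<Sum>a\<in>digit_choices d H n. weight a * xi h (a h))" by simp
    ultimately show ?thesis by (simp only: norm_of_real) simp
  qed
  have eq: "(\<Sum>a\<in>digit_choices d H n. weight a * centred a) = (\<Sum>h\<in>H. \<Sum>a\<in>digit_choices d H n. weight a * xi h (a h))"
    unfolding centred_def sum_distrib_left by (rule sum.swap)
  have "\<bar>\<Sum>h\<in>H. \<Sum>a\<in>digit_choices d H n. weight a * xi h (a h)\<bar> \<le> (\<Sum>h\<in>H. exp 2 * integral {-pi..pi} (\<lambda>t. e1 h t * env t))"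
    by (rule order.trans[OF sum_abs], rule sum_mono) (rule each)
  also have "\<dots> \<le> K1 / X" by (rule sum_integral_e1_le)
  finally show ?thesis unfolding eq .
qed

definition K2 where "K2 = exp 2 * ((real d)\<^sup>2 * C)\<^sup>2 * C + K1"

text \<open>Off the diagonal the double sum is at most the square of the sum of the
  \<open>e1\<close>, of order s^4 against an integral of order 1/(X s^3); the diagonal contributes
  O(1/X). After division by \<open>mass\<close> the error is O(s^2).\<close>

lemma second_moment:
  "\<bar>(\<Sum>a\<in>digit_choices d H n. weight a * (centred a)\<^sup>2) - mass * (\<Sum>h\<in>H. v h)\<bar> \<le> K2 * s / X"
proof -
  let ?S = "\<lambda>f. \<Sum>a\<in>digit_choices d H n. weight a * f a"
  let ?I = "\<lambda>f. integral {-pi..pi} (\<lambda>t. f t * env t)"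
  have diag: "\<bar>?S (\<lambda>a. (xi h (a h))\<^sup>2 - v h)\<bar> \<le> exp 2 * ?I (e1 h)" if h: "h \<in> H" for h
  proof -
    have "\<bar>(xi h k)\<^sup>2 - v h\<bar> \<le> 1" if "k < d" for k
      using v_bounds[of h] power_mono[OF xi_bound[OF that, of h], of 2] by (simp add: abs_le_iff) (smt (verit) zero_le_power2)
    moreover have "(\<Sum>k<d. tilt d (z * real h) k * ((xi h k)\<^sup>2 - v h)) = 0"
      using xi_var[of h] tilted_digit.sum_tilt[OF tilted, of h]
      by (simp add: right_diff_distrib sum_subtractf flip: sum_distrib_right)
    ultimately have "cmod (\<Sum>a\<in>digit_choices d H n. of_real (weight a) * (\<Prod>h\<in>{h}. of_real ((xi h (a h))\<^sup>2 - v h)))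
      \<le> exp 2 * integral {-pi..pi} (\<lambda>t. (\<Prod>h\<in>{h}. e1 h t) * env t)"
      using h by (intro centred_correlation_le) (auto simp only: complex_of_real_tilt_sum norm_of_real of_real_0 singleton_iff card.insert, auto)
    moreover have "(\<Sum>a\<in>digit_choices d H n. of_real (weight a) * (\<Prod>h\<in>{h}. complex_of_real ((xi h (a h))\<^sup>2 - v h)))
        = of_real (?S (\<lambda>a. (xi h (a h))\<^sup>2 - v h))" by simp
    ultimately show ?thesis by (simp only: norm_of_real) simp
  qed
  have off: "\<bar>?S (\<lambda>a. xi h (a h) * xi h' (a h'))\<bar> \<le> exp 2 * ?I (\<lambda>t. e1 h t * e1 h' t)"
    if h: "h \<in> H" "h' \<in> H" "h \<noteq> h'" for h h'
  proof -
    have "cmod (\<Sum>a\<in>digit_choices d H n. of_real (weight a) * (\<Prod>h\<in>{h, h'}. of_real (xi h (a h))))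
      \<le> exp 2 * integral {-pi..pi} (\<lambda>t. (\<Prod>h\<in>{h, h'}. e1 h t) * env t)"
    proof (rule centred_correlation_le)
      show "{h, h'} \<subseteq> H" "card {h, h'} \<le> 2" using h by auto
      show "cmod (of_real (xi i k)) \<le> 1" if "k < d" for i k using xi_bound[OF that] by simp
      show "(\<Sum>k<d. of_real (tilt d (z * real i) k) * complex_of_real (xi i k)) = 0" for i
        by (simp only: complex_of_real_tilt_sum xi_mean of_real_0)
    qed
    moreover have "(\<Sum>a\<in>digit_choices d H n. of_real (weight a) * (\<Prod>h\<in>{h, h'}. complex_of_real (xi h (a h))))
        = of_real (?S (\<lambda>a. xi h (a h) * xi h' (a h')))" using h by simp
    ultimately show ?thesis using h by (simp only: norm_of_real) simp
  qed
  \<comment> \<open>The diagonal squares are centred at \<open>v h\<close>, so that they too have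
    mean zero under the product law.\<close>
  have sq: "(centred a)\<^sup>2 = (\<Sum>h\<in>H. \<Sum>h'\<in>H - {h}. xi h (a h) * xi h' (a h')) + (\<Sum>h\<in>H. (xi h (a h))\<^sup>2 - v h) + (\<Sum>h\<in>H. v h)" for a
  proof -
    have "(centred a)\<^sup>2 = (\<Sum>h\<in>H. \<Sum>h'\<in>H. xi h (a h) * xi h' (a h'))"
      unfolding centred_def power2_eq_square sum_product ..
    also have "\<dots> = (\<Sum>h\<in>H. (\<Sum>h'\<in>H - {h}. xi h (a h) * xi h' (a h')) + (xi h (a h))\<^sup>2)"
    proof (intro sum.cong refl)
      fix h assume "h \<in> H"
      thus "(\<Sum>h'\<in>H. xi h (a h) * xi h' (a h')) = (\<Sum>h'\<in>H - {h}. xi h (a h) * xi h' (a h')) + (xi h (a h))\<^sup>2"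
        by (subst sum.remove[of _ h]) (auto simp: power2_eq_square)
    qed
    finally show ?thesis by (simp add: sum.distrib sum_subtractf)
  qed
  have "?S (\<lambda>a. (centred a)\<^sup>2) = (\<Sum>h\<in>H. \<Sum>h'\<in>H - {h}. ?S (\<lambda>a. xi h (a h) * xi h' (a h')))
      + (\<Sum>h\<in>H. ?S (\<lambda>a. (xi h (a h))\<^sup>2 - v h)) + mass * (\<Sum>h\<in>H. v h)"
  proof -
    have "?S (\<lambda>a. (centred a)\<^sup>2) = ?S (\<lambda>a. \<Sum>h\<in>H. \<Sum>h'\<in>H - {h}. xi h (a h) * xi h' (a h'))
        + ?S (\<lambda>a. \<Sum>h\<in>H. (xi h (a h))\<^sup>2 - v h) + ?S (\<lambda>a. \<Sum>h\<in>H. v h)"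
      unfolding sq by (simp only: distrib_left sum.distrib)
    also have "?S (\<lambda>a. \<Sum>h\<in>H. v h) = mass * (\<Sum>h\<in>H. v h)" by (simp add: mass_def sum_distrib_right)
    also have "?S (\<lambda>a. \<Sum>h\<in>H. (xi h (a h))\<^sup>2 - v h) = (\<Sum>h\<in>H. ?S (\<lambda>a. (xi h (a h))\<^sup>2 - v h))"
      unfolding sum_distrib_left by (rule sum.swap)
    also have "?S (\<lambda>a. \<Sum>h\<in>H. \<Sum>h'\<in>H - {h}. xi h (a h) * xi h' (a h')) = (\<Sum>h\<in>H. \<Sum>h'\<in>H - {h}. ?S (\<lambda>a. xi h (a h) * xi h' (a h')))"
      unfolding sum_distrib_left by (subst sum.swap, intro sum.cong refl, rule sum.swap)
    finally show ?thesis .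
  qed
  hence "\<bar>?S (\<lambda>a. (centred a)\<^sup>2) - mass * (\<Sum>h\<in>H. v h)\<bar>
      \<le> \<bar>\<Sum>h\<in>H. \<Sum>h'\<in>H - {h}. ?S (\<lambda>a. xi h (a h) * xi h' (a h'))\<bar> + \<bar>\<Sum>h\<in>H. ?S (\<lambda>a. (xi h (a h))\<^sup>2 - v h)\<bar>"
    by simp
  also have "\<bar>\<Sum>h\<in>H. ?S (\<lambda>a. (xi h (a h))\<^sup>2 - v h)\<bar> \<le> (\<Sum>h\<in>H. exp 2 * ?I (e1 h))"
    by (rule order.trans[OF sum_abs], rule sum_mono) (rule diag)
  also have "\<dots> \<le> K1 / X" by (rule sum_integral_e1_le)
  also have "\<bar>\<Sum>h\<in>H. \<Sum>h'\<in>H - {h}. ?S (\<lambda>a. xi h (a h) * xi h' (a h'))\<bar>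
      \<le> exp 2 * ((real d)\<^sup>2 * C)\<^sup>2 * C * s / X"
  proof -
    have int: "(\<lambda>t. e1 h t * e1 h' t * env t) integrable_on {-pi..pi}" for h h'
      by (intro integrable_continuous_real continuous_intros)
    have I0: "0 \<le> exp 2 * ?I (\<lambda>t. e1 h t * e1 h' t)" for h h'
      using env_pos by (intro mult_nonneg_nonneg integral_nonneg int) (auto simp: e1_nonneg less_imp_le)
    have "\<bar>\<Sum>h\<in>H. \<Sum>h'\<in>H - {h}. ?S (\<lambda>a. xi h (a h) * xi h' (a h'))\<bar>
        \<le> (\<Sum>h\<in>H. \<Sum>h'\<in>H - {h}. exp 2 * ?I (\<lambda>t. e1 h t * e1 h' t))"
      by (rule order.trans[OF sum_abs], rule sum_mono, rule order.trans[OF sum_abs], rule sum_mono, rule off) auto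
    \<comment> \<open>Adding nonnegative diagonal terms completes the square.\<close>
    also have "\<dots> \<le> (\<Sum>h\<in>H. \<Sum>h'\<in>H. exp 2 * ?I (\<lambda>t. e1 h t * e1 h' t))"
      using I0 by (intro sum_mono sum_mono2) auto
    also have "\<dots> = exp 2 * ?I (\<lambda>t. (\<Sum>h\<in>H. e1 h t)\<^sup>2)"
    proof -
      have "?I (\<lambda>t. (\<Sum>h\<in>H. e1 h t)\<^sup>2) = integral {-pi..pi} (\<lambda>t. \<Sum>h\<in>H. \<Sum>h'\<in>H. e1 h t * e1 h' t * env t)"
        by (simp only: power2_eq_square sum_product) (simp only: sum_distrib_right)
      also have "\<dots> = (\<Sum>h\<in>H. integral {-pi..pi} (\<lambda>t. \<Sum>h'\<in>H. e1 h t * e1 h' t * env t))"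
        by (rule integral_sum) (auto intro!: integrable_sum int)
      also have "\<dots> = (\<Sum>h\<in>H. \<Sum>h'\<in>H. ?I (\<lambda>t. e1 h t * e1 h' t))"
        by (intro sum.cong refl integral_sum int) auto
      finally show ?thesis by (simp only: sum_distrib_left)
    qed
    also have "\<dots> \<le> exp 2 * integral {-pi..pi} (\<lambda>t. ((real d)\<^sup>2 * C * s\<^sup>2)\<^sup>2 * (arc_weight X t ^ 2 * env t))"
    proof (intro mult_left_mono integral_le integrable_continuous_real continuous_intros)
      fix t
      have "(\<Sum>h\<in>H. e1 h t)\<^sup>2 \<le> ((real d)\<^sup>2 * C * s\<^sup>2 * arc_weight X t)\<^sup>2"
        using sum_e1_le[of t] by (intro power_mono sum_nonneg e1_nonneg) auto
      thus "(\<Sum>h\<in>H. e1 h t)\<^sup>2 * env t \<le> ((real d)\<^sup>2 * C * s\<^sup>2)\<^sup>2 * (arc_weight X t ^ 2 * env t)"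
        using env_pos[of t] by (simp add: mult.assoc[symmetric] mult_right_mono power_mult_distrib)
    qed auto
    also have "\<dots> = exp 2 * (((real d)\<^sup>2 * C * s\<^sup>2)\<^sup>2 * integral {-pi..pi} (\<lambda>t. arc_weight X t ^ 2 * env t))"
      by (simp only: integral_mult_right)
    also have "\<dots> \<le> exp 2 * (((real d)\<^sup>2 * C * s\<^sup>2)\<^sup>2 * (C / (X * s ^ Suc 2)))"
      by (intro mult_left_mono arcs) auto
    also have "\<dots> = exp 2 * ((real d)\<^sup>2 * C)\<^sup>2 * C * s / X"
    proof -
      have "(s\<^sup>2)\<^sup>2 = s * s ^ Suc 2" by (simp add: power2_eq_square power3_eq_cube)
      hence "((real d)\<^sup>2 * C * s\<^sup>2)\<^sup>2 * (C / (X * s ^ Suc 2)) = ((real d)\<^sup>2 * C)\<^sup>2 * (s * s ^ Suc 2) * (C / (X * s ^ Suc 2))"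
        by (simp only: power_mult_distrib)
      also have "\<dots> = ((real d)\<^sup>2 * C)\<^sup>2 * C * s / X" using s_ge_1 by (simp add: mult_ac)
      finally show ?thesis by (simp only: mult.assoc times_divide_eq_right)
    qed
    finally show ?thesis .
  qed
  also have "exp 2 * ((real d)\<^sup>2 * C)\<^sup>2 * C * s / X + K1 / X \<le> K2 * s / X"
  proof -
    have "K1 * 1 \<le> K1 * s" using s_ge_1 by (intro mult_left_mono) (auto simp: K1_def)
    hence "(exp 2 * ((real d)\<^sup>2 * C)\<^sup>2 * C * s + K1) / X \<le> K2 * s / X"
      unfolding K2_def distrib_right using X_pos by (intro divide_right_mono) auto
    thus ?thesis by (simp only: add_divide_distrib)
  qed
  finally show ?thesis by simp
qed

end

section \<open>Lower bound for the mass, and the conditioned characteristic function\<close>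

context saddle begin

definition K3 where "K3 = 2 * real d ^ 5 * exp 2 * C\<^sup>2"
text \<open>Variance of W under the product law.\<close>

definition V where "V = (\<Sum>h\<in>H. (real h)\<^sup>2 * tilt_var d (z * real h))"

lemma V_bounds: "0 \<le> V" "V \<le> real d ^ 3 * C * (X * s)\<^sup>2"
proof -
  have v0: "0 \<le> tilt_var d (z * real h)" for h
    using tilted_digit.tilt_nonneg[OF tilted] unfolding tilt_var_def by (intro sum_nonneg mult_nonneg_nonneg) auto
  thus "0 \<le> V" unfolding V_def by (intro sum_nonneg mult_nonneg_nonneg) auto
  have "V \<le> (\<Sum>h\<in>H. (real h)\<^sup>2 * (real d ^ 3 * exp (- (z * real h))))"
    unfolding V_def by (intro sum_mono mult_left_mono tilted_digit.tilt_var_le[OF tilted]) auto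
  also have "\<dots> = real d ^ 3 * X\<^sup>2 * (\<Sum>h\<in>H. (z * real h) ^ 2 * exp (- (z * real h)))"
    using z_pos by (simp add: sum_distrib_left X_def power_mult_distrib power_divide mult_ac)
  also have "\<dots> \<le> real d ^ 3 * X\<^sup>2 * (C * s\<^sup>2)"
    using sums_le[of 2] by (intro mult_left_mono) (auto simp: s_squared ell_def X_def)
  finally show "V \<le> real d ^ 3 * C * (X * s)\<^sup>2" by (simp add: power_mult_distrib mult_ac)
qed

text \<open>On an interval of length 1/(X s) the exponent is bounded by \<open>V_bounds\<close>; the
  rest of the positive integrand is discarded.\<close>

lemma integral_gaussian_ge:
  "exp (- (real d ^ 3 * C / 2)) / (X * s) \<le> integral {-pi..pi} (\<lambda>t. exp (- (V * t\<^sup>2 / 2)))"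
proof -
  define \<delta> where "\<delta> = 1 / (X * s)"
  have Xs: "1 \<le> X * s"
  proof -
    have "1 \<le> exp (1::real)" by simp
    also have "\<dots> \<le> X" using X_ge by (simp add: X_def)
    finally have "1 * 1 \<le> X * s" using s_ge_1 by (intro mult_mono) auto
    thus ?thesis by simp
  qed
  have \<delta>: "0 < \<delta>" "\<delta> \<le> 1" using Xs by (auto simp: \<delta>_def)
  have cont: "continuous_on A (\<lambda>t. exp (- (V * t\<^sup>2 / 2)))" for A by (intro continuous_intros) auto
  have "exp (- (real d ^ 3 * C / 2)) / (X * s) = integral {0..\<delta>} (\<lambda>t. exp (- (real d ^ 3 * C / 2)))"
    using \<delta> by (simp add: \<delta>_def)
  also have "\<dots> \<le> integral {0..\<delta>} (\<lambda>t. exp (- (V * t\<^sup>2 / 2)))"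
  proof (intro integral_le integrable_continuous_real cont)
    fix t assume t: "t \<in> {0..\<delta>}"
    have "V * t\<^sup>2 \<le> real d ^ 3 * C * (X * s)\<^sup>2 * \<delta>\<^sup>2"
      using V_bounds t by (intro mult_mono power_mono) auto
    also have "\<dots> = real d ^ 3 * C" using X_pos s_ge_1 by (simp add: \<delta>_def power_divide)
    finally show "exp (- (real d ^ 3 * C / 2)) \<le> exp (- (V * t\<^sup>2 / 2))" by simp
  qed auto
  also have "\<dots> \<le> integral {-pi..pi} (\<lambda>t. exp (- (V * t\<^sup>2 / 2)))"
    using \<delta> pi_gt3 by (intro integral_subset_le integrable_continuous_real cont) auto
  finally show ?thesis .
qed

text \<open>Local limit theorem at the mean. The cubic error gives s^2 times an integral of order
  1/(X s^4), smaller than the main term by the factor s.\<close>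

lemma mass_approx:
  "\<bar>2 * pi * mass - integral {-pi..pi} (\<lambda>t. exp (- (V * t\<^sup>2 / 2)))\<bar> \<le> K3 / (X * s\<^sup>2)"
proof -
  define \<mu> where "\<mu> = (\<lambda>h. tilt_mean d (z * real h))"
  define a where "a = (\<lambda>h t. \<Sum>k<d. of_real (tilt d (z * real h) k) * cis (t * real h * (real k - \<mu> h)))"
  define c where "c = (\<lambda>h t. complex_of_real (exp (- (tilt_var d (z * real h) * (t * real h)\<^sup>2 / 2))))"
  have prod_a: "cis (- (real n * t)) * (\<Prod>h\<in>H. \<Sum>k<d. of_real (tilt d (z * real h) k) * cis (t * real h * real k)) = (\<Prod>h\<in>H. a h t)" for t
  proof -
    \<comment> \<open>The saddle equation \<open>mean_eq\<close> enters here: the factor cis(-n t)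
      is distributed so as to centre every digit, and no linear term survives.\<close>
    have "(\<Sum>h\<in>H. - (t * real h * \<mu> h)) = - (t * (\<Sum>h\<in>H. real h * tilt_mean d (z * real h)))"
      by (simp add: \<mu>_def sum_distrib_left sum_negf mult_ac)
    hence "cis (- (real n * t)) = cis (\<Sum>h\<in>H. - (t * real h * \<mu> h))"
      by (simp only: mean_eq mult.commute)
    also have "\<dots> = (\<Prod>h\<in>H. cis (- (t * real h * \<mu> h)))" by (simp add: prod_cis)
    finally have "cis (- (real n * t)) * (\<Prod>h\<in>H. \<Sum>k<d. of_real (tilt d (z * real h) k) * cis (t * real h * real k))
        = (\<Prod>h\<in>H. cis (- (t * real h * \<mu> h)) * (\<Sum>k<d. of_real (tilt d (z * real h) k) * cis (t * real h * real k)))"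
      by (simp only: prod.distrib)
    also have "\<dots> = (\<Prod>h\<in>H. a h t)"
      unfolding a_def sum_distrib_left
      by (intro prod.cong sum.cong refl) (simp add: mult.left_commute cis_mult right_diff_distrib)
    finally show ?thesis .
  qed
  have prod_c: "(\<Prod>h\<in>H. c h t) = of_real (exp (- (V * t\<^sup>2 / 2)))" for t
  proof -
    have "(\<Prod>h\<in>H. c h t) = of_real (\<Prod>h\<in>H. exp (- (tilt_var d (z * real h) * (t * real h)\<^sup>2 / 2)))"
      by (simp add: c_def)
    also have "(\<Prod>h\<in>H. exp (- (tilt_var d (z * real h) * (t * real h)\<^sup>2 / 2))) = exp (\<Sum>h\<in>H. - (tilt_var d (z * real h) * (t * real h)\<^sup>2 / 2))"
      by (subst exp_sum) auto
    also have "(\<Sum>h\<in>H. - (tilt_var d (z * real h) * (t * real h)\<^sup>2 / 2)) = - (V * t\<^sup>2 / 2)"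
      unfolding V_def sum_distrib_right sum_divide_distrib sum_negf[symmetric]
      by (intro sum.cong) (auto simp: power_mult_distrib mult_ac)
    finally show ?thesis .
  qed
  have hi: "((\<lambda>t. \<Prod>h\<in>H. a h t) has_integral (of_real (2 * pi * mass))) {-pi..pi}"
  proof -
    have "((\<lambda>t. cis (- (real n * t)) * (\<Prod>h\<in>H. \<Sum>k<d. of_real (tilt d (z * real h) k) * cis (t * real h * real k)))
      has_integral (2 * pi * (\<Sum>x\<in>digit_choices d H n. \<Prod>h\<in>H. complex_of_real (tilt d (z * real h) (x h))))) {-pi..pi}"
      by (rule has_integral_coefficient) auto
    thus ?thesis unfolding prod_a by (simp add: mass_def of_real_weight)
  qed
  define I where "I = integral {-pi..pi} (\<lambda>t. exp (- (V * t\<^sup>2 / 2)))"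
  have "((\<lambda>t. exp (- (V * t\<^sup>2 / 2))) has_integral I) {-pi..pi}"
    unfolding I_def by (intro integrable_integral integrable_continuous_real continuous_intros) auto
  hence hiI: "((\<lambda>t. \<Prod>h\<in>H. c h t) has_integral (of_real I)) {-pi..pi}"
    unfolding prod_c by (rule has_integral_of_real)
  have pt: "cmod ((\<Prod>h\<in>H. a h t) - (\<Prod>h\<in>H. c h t)) \<le> 2 * real d ^ 5 * C * s\<^sup>2 * exp 2 * (arc_weight X t ^ 3 * env t)" for t
  proof -
    have a_env: "cmod (a h t) \<le> envelope 0 h t" for h
      unfolding a_def by (rule unimodular_le_envelope[where u = 0]) (auto simp: algebra_simps)
    \<comment> \<open>The Gaussian factors obey the same envelope because the digit variance is at
      least \<open>decay\<close> for h \<le> X; the two products can then be compared factor by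
      factor.\<close>
    have c_env: "cmod (c h t) \<le> envelope 0 h t" for h
    proof (cases "real h \<le> X")
      case True
      interpret tilted_digit d "z * real h" by (rule tilted)
      have y1: "z * real h \<le> 1" using z_pos True by (simp add: X_def field_simps)
      have "decay / 2 * (1 - cos (real h * t)) \<le> decay * (1 - cos (real h * t))"
        using decay_pos by (intro mult_right_mono) auto
      also have "\<dots> \<le> tilt_var d (z * real h) * ((real h * t)\<^sup>2 / 2)"
      proof (intro mult_mono one_minus_cos_le)
        show "decay \<le> tilt_var d (z * real h)"
          using tilt_0_1_ge[OF y1] tilt_var_ge by (simp add: decay_def)
        thus "0 \<le> tilt_var d (z * real h)" using decay_pos by simp
      qed auto
      finally show ?thesis using True by (simp add: c_def envelope_def mult.commute)
    next
      case False
      have "0 \<le> tilt_var d (z * real h)"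
        using tilted_digit.tilt_nonneg[OF tilted] unfolding tilt_var_def by (intro sum_nonneg mult_nonneg_nonneg) auto
      thus ?thesis using False by (simp add: c_def envelope_def)
    qed
    have "cmod ((\<Prod>h\<in>H. a h t) - (\<Prod>h\<in>H. c h t)) \<le> (\<Sum>h\<in>H. cmod (a h t - c h t) * (\<Prod>j\<in>H - {h}. envelope 0 j t))"
      using a_env c_env by (intro norm_prod_diff_le) auto
    also have "\<dots> \<le> (\<Sum>h\<in>H. (2 * min 1 (real d ^ 5 * (\<bar>t * real h\<bar> ^ 3 * exp (- (z * real h))))) * (exp 2 * env t))"
    proof (intro sum_mono mult_mono)
      fix h assume h: "h \<in> H"
      have "cmod (a h t - c h t) \<le> min 2 (2 * real d ^ 5 * (\<bar>t * real h\<bar> ^ 3 * exp (- (z * real h))))"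
        unfolding a_def c_def \<mu>_def by (rule tilted_digit.tilt_charfun_approx[OF tilted])
      also have "\<dots> = 2 * min 1 (real d ^ 5 * (\<bar>t * real h\<bar> ^ 3 * exp (- (z * real h))))"
        by (simp add: min_mult_distrib_left mult.assoc)
      finally show "cmod (a h t - c h t) \<le> 2 * min 1 (real d ^ 5 * (\<bar>t * real h\<bar> ^ 3 * exp (- (z * real h))))" .
      show "(\<Prod>j\<in>H - {h}. envelope 0 j t) \<le> exp 2 * env t"
        using h by (intro prod_envelope_0_le) auto
    qed (auto intro!: prod_nonneg envelope_nonneg)
    also have "\<dots> = 2 * exp 2 * env t * (\<Sum>h\<in>H. min 1 (real d ^ 5 * (\<bar>t * real h\<bar> ^ 3 * exp (- (z * real h)))))"
      by (simp add: sum_distrib_left mult_ac)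
    also have "\<dots> \<le> 2 * exp 2 * env t * (real d ^ 5 * C * s\<^sup>2 * arc_weight X t ^ 3)"
      using env_pos[of t] d_ge_2 by (intro mult_left_mono min_sum_le_arc_weight) auto
    finally show ?thesis by (simp only: mult_ac)
  qed
  have "cmod (of_real (2 * pi * mass) - of_real I) \<le> integral {-pi..pi} (\<lambda>t. 2 * real d ^ 5 * C * s\<^sup>2 * exp 2 * (arc_weight X t ^ 3 * env t))"
    unfolding integral_unique[OF has_integral_diff[OF hi hiI], symmetric]
    by (intro integral_norm_bound_integral has_integral_integrable[OF has_integral_diff[OF hi hiI]] pt
      integrable_continuous_real continuous_intros)
  also have "\<dots> = 2 * real d ^ 5 * C * s\<^sup>2 * exp 2 * integral {-pi..pi} (\<lambda>t. arc_weight X t ^ 3 * env t)"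
    by (rule integral_mult_right)
  also have "\<dots> \<le> 2 * real d ^ 5 * C * s\<^sup>2 * exp 2 * (C / (X * s ^ Suc 3))"
    using C_ge_1 by (intro mult_left_mono arcs) auto
  also have "\<dots> = K3 / (X * s\<^sup>2)"
  proof -
    have "s ^ Suc 3 = s\<^sup>2 * s\<^sup>2" by (simp flip: power_add)
    thus ?thesis using s_ge_1 by (simp add: K3_def power2_eq_square)
  qed
  finally show ?thesis by (simp only: I_def norm_of_real flip: of_real_diff)
qed

text \<open>The Gaussian lower bound, with 1/2 lost to the error term and 1/(2 pi) from inversion;
  the hypothesis of \<open>mass_ge\<close> makes the error at most half of the main term.\<close>

definition mass_const where "mass_const = exp (- (real d ^ 3 * C / 2)) / (4 * pi)"

lemma mass_const_pos: "0 < mass_const" by (simp add: mass_const_def)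

lemma mass_ge:
  assumes s: "2 * K3 * exp (real d ^ 3 * C / 2) \<le> s"
  shows "mass_const / (X * s) \<le> mass"
proof -
  define E where "E = exp (- (real d ^ 3 * C / 2))"
  have E: "0 < E" by (simp add: E_def)
  have "2 * K3 * (exp (real d ^ 3 * C / 2) * E) \<le> s * E"
    unfolding mult.assoc[symmetric] using mult_right_mono[OF s, of E] E by simp
  hence "2 * K3 \<le> s * E" by (simp add: E_def flip: exp_add)
  hence "K3 / (X * s\<^sup>2) \<le> (s * E / 2) / (X * s\<^sup>2)" using X_pos s_ge_1 by (intro divide_right_mono) auto
  also have "\<dots> = E / (X * s) / 2" using s_ge_1 by (simp add: power2_eq_square)
  finally have "E / (X * s) / 2 \<le> 2 * pi * mass"
    using mass_approx integral_gaussian_ge unfolding E_def[symmetric] by linarith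
  hence "E / (X * s) / 2 / (2 * pi) \<le> 2 * pi * mass / (2 * pi)" by (intro divide_right_mono) auto
  thus ?thesis unfolding mass_const_def E_def[symmetric] by (simp add: mult_ac)
qed

definition K4 where "K4 = exp 2 * (C + 4 * (real d)\<^sup>2 * C\<^sup>2)"

text \<open>The difference of the twists has a mean of order |\<theta>|^3, since \<open>xi\<close>
  has mean 0 and variance \<open>v\<close> and so the second-order expansions agree. What remains
  after removing that mean is centred and of size at most 4|\<theta>|, so it gains
  \<open>e1\<close>.\<close>

lemma charfun_factor_diff:
  assumes \<theta>: "\<bar>\<theta>\<bar> \<le> 1"
  shows "cmod ((\<Sum>k<d. of_real (tilt d (z * real h) k) * cis (\<theta> * xi h k) * cis (t * real h * real k))
     - of_real (exp (- (\<theta>\<^sup>2 * v h / 2))) * (\<Sum>k<d. of_real (tilt d (z * real h) k) * cis (t * real h * real k)))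
    \<le> \<bar>\<theta>\<bar> ^ 3 + 4 * \<bar>\<theta>\<bar> * e1 h t"
proof (cases "\<theta> = 0")
  case True
  thus ?thesis by simp
next
  case False
  interpret tilted_digit d "z * real h" by (rule tilted)
  define w where "w = (\<lambda>k. complex_of_real (tilt d (z * real h) k))"
  define \<beta> where "\<beta> = exp (- (\<theta>\<^sup>2 * v h / 2))"
  define f where "f = (\<lambda>k. cis (\<theta> * xi h k) - of_real \<beta>)"
  define \<mu> where "\<mu> = (\<Sum>k<d. w k * f k)"
  have sum_w: "(\<Sum>k<d. w k) = 1" unfolding w_def using sum_tilt by (simp flip: of_real_sum)
  have th3: "\<theta>\<^sup>2 \<le> \<bar>\<theta>\<bar>" using \<theta> mult_left_mono[OF \<theta>, of "\<bar>\<theta>\<bar>"] by (simp add: power2_eq_square abs_mult_self_eq)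
  define y where "y = \<theta>\<^sup>2 * v h / 2"
  have y: "0 \<le> y" "y \<le> \<theta>\<^sup>2 / 2"
    using v_bounds[of h] mult_left_mono[OF v_bounds(2)[of h], of "\<theta>\<^sup>2"] by (auto simp: y_def)
  have f_le: "cmod (f k) \<le> 2 * \<bar>\<theta>\<bar>" if k: "k < d" for k
  proof -
    have "f k = (cis (\<theta> * xi h k) - 1) + of_real (1 - \<beta>)" by (simp add: f_def)
    hence "cmod (f k) \<le> cmod (cis (\<theta> * xi h k) - 1) + \<bar>1 - \<beta>\<bar>"
      by (metis norm_triangle_ineq norm_of_real)
    moreover have "cmod (cis (\<theta> * xi h k) - 1) \<le> \<bar>\<theta>\<bar> * 1"
      by (rule order.trans[OF norm_cis_minus_1]) (use mult_left_mono[OF xi_bound[OF k, of h], of "\<bar>\<theta>\<bar>"] in \<open>simp add: abs_mult\<close>)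
    moreover have "\<bar>1 - \<beta>\<bar> \<le> y"
      using exp_ge_add_one_self[of "- y"] y unfolding \<beta>_def y_def[symmetric] by simp
    ultimately show ?thesis using y th3 by linarith
  qed
  have \<mu>_le2: "cmod \<mu> \<le> 2 * \<bar>\<theta>\<bar>" unfolding \<mu>_def w_def by (rule norm_tilt_sum_le) (rule f_le)
  have \<mu>_le: "cmod \<mu> \<le> \<bar>\<theta>\<bar> ^ 3"
  proof -
    define q where "q = (\<lambda>k. 1 + \<i> * of_real (\<theta> * xi h k) - of_real ((\<theta> * xi h k)\<^sup>2) / 2)"
    have "(\<Sum>k<d. w k * q k) = of_real ((\<Sum>k<d. tilt d (z * real h) k)) + \<i> * of_real \<theta> * of_real (\<Sum>k<d. tilt d (z * real h) k * xi h k)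
        - of_real (\<theta>\<^sup>2 / 2) * of_real (\<Sum>k<d. tilt d (z * real h) k * (xi h k)\<^sup>2)"
    proof -
      have "w k * q k = of_real (tilt d (z * real h) k) + \<i> * of_real \<theta> * of_real (tilt d (z * real h) k * xi h k)
          - of_real (\<theta>\<^sup>2 / 2) * of_real (tilt d (z * real h) k * (xi h k)\<^sup>2)" for k
        by (simp add: w_def q_def power_mult_distrib algebra_simps)
      thus ?thesis by (simp only: sum.distrib sum_subtractf sum_distrib_left[symmetric] of_real_sum)
    qed
    also have "\<dots> = of_real (1 - y)" unfolding sum_tilt xi_mean xi_var by (simp add: y_def)
    finally have sq: "(\<Sum>k<d. w k * q k) = of_real (1 - y)" .
    have "\<mu> = (\<Sum>k<d. w k * (cis (\<theta> * xi h k) - q k)) + (\<Sum>k<d. w k * q k) - of_real \<beta> * (\<Sum>k<d. w k)"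
      unfolding \<mu>_def f_def by (simp add: right_diff_distrib sum_subtractf sum_distrib_left mult_ac)
    hence "\<mu> = (\<Sum>k<d. w k * (cis (\<theta> * xi h k) - q k)) + of_real (1 - y - \<beta>)" unfolding sq sum_w by simp
    hence "cmod \<mu> \<le> cmod (\<Sum>k<d. w k * (cis (\<theta> * xi h k) - q k)) + \<bar>1 - y - \<beta>\<bar>"
      by (metis norm_triangle_ineq norm_of_real)
    moreover have "cmod (\<Sum>k<d. w k * (cis (\<theta> * xi h k) - q k)) \<le> \<bar>\<theta>\<bar> ^ 3 / 6"
      unfolding w_def
    proof (rule norm_tilt_sum_le)
      fix k assume k: "k < d"
      have "cmod (cis (\<theta> * xi h k) - q k) \<le> \<bar>\<theta> * xi h k\<bar> ^ 3 / 6"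
        unfolding q_def using norm_cis_minus_quadratic[of "\<theta> * xi h k"] by simp
      also have "\<bar>\<theta> * xi h k\<bar> ^ 3 \<le> (\<bar>\<theta>\<bar> * 1) ^ 3"
        using xi_bound[OF k, of h] unfolding abs_mult by (intro power_mono mult_left_mono) auto
      finally show "cmod (cis (\<theta> * xi h k) - q k) \<le> \<bar>\<theta>\<bar> ^ 3 / 6" by simp
    qed
    moreover have "\<bar>1 - y - \<beta>\<bar> \<le> \<bar>\<theta>\<bar> ^ 3 / 4"
    proof -
      have "\<bar>1 - y - \<beta>\<bar> \<le> y\<^sup>2" using exp_minus_linear_bounds(2)[OF y(1)] unfolding \<beta>_def y_def[symmetric] by (simp add: abs_minus_commute)
      also have "\<dots> \<le> (\<theta>\<^sup>2 / 2)\<^sup>2" using y by (intro power_mono) auto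
      also have "\<dots> = \<theta>\<^sup>2 * \<theta>\<^sup>2 / 4" by (simp add: power2_eq_square)
      also have "\<dots> \<le> \<theta>\<^sup>2 * \<bar>\<theta>\<bar> / 4" using th3 by (intro divide_right_mono mult_left_mono) auto
      also have "\<theta>\<^sup>2 * \<bar>\<theta>\<bar> = \<bar>\<theta>\<bar> ^ 3" by (simp add: power2_eq_square power3_eq_cube abs_mult_self_eq)
      finally show ?thesis .
    qed
    moreover have "0 \<le> \<bar>\<theta>\<bar> ^ 3" by simp
    ultimately show ?thesis by linarith
  qed
  \<comment> \<open>Scaled to modulus at most 1, as \<open>e1_bound\<close> requires; this division
    is the reason for treating \<theta> = 0 apart.\<close>
  define g where "g = (\<lambda>k. (f k - \<mu>) / of_real (4 * \<bar>\<theta>\<bar>))"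
  have g_le: "cmod (\<Sum>k<d. w k * g k * cis (t * real h * real k)) \<le> e1 h t"
    unfolding w_def
  proof (rule e1_bound)
    fix k assume "k < d"
    hence "cmod (f k - \<mu>) \<le> 4 * \<bar>\<theta>\<bar>" using f_le[of k] \<mu>_le2 norm_triangle_ineq4[of "f k" \<mu>] by linarith
    thus "cmod (g k) \<le> 1" using False by (simp add: g_def norm_divide)
  next
    have "(\<Sum>k<d. w k * (f k - \<mu>)) = 0"
      by (simp add: right_diff_distrib sum_subtractf \<mu>_def[symmetric] sum_w flip: sum_distrib_right)
    thus "(\<Sum>k<d. of_real (tilt d (z * real h) k) * g k) = 0"
      unfolding g_def w_def by (simp flip: sum_divide_distrib)
  qed
  have split_eq: "(\<Sum>k<d. w k * cis (\<theta> * xi h k) * cis (t * real h * real k)) - of_real \<beta> * (\<Sum>k<d. w k * cis (t * real h * real k))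
      = of_real (4 * \<bar>\<theta>\<bar>) * (\<Sum>k<d. w k * g k * cis (t * real h * real k)) + \<mu> * (\<Sum>k<d. w k * cis (t * real h * real k))"
  proof -
    have "of_real (4 * \<bar>\<theta>\<bar>) * (w k * g k * cis (t * real h * real k)) + \<mu> * (w k * cis (t * real h * real k))
        = w k * cis (\<theta> * xi h k) * cis (t * real h * real k) - of_real \<beta> * (w k * cis (t * real h * real k))" for k
    proof -
      have "of_real (4 * \<bar>\<theta>\<bar>) * g k = f k - \<mu>" using False by (simp add: g_def)
      hence "of_real (4 * \<bar>\<theta>\<bar>) * (w k * g k * cis (t * real h * real k)) = w k * (f k - \<mu>) * cis (t * real h * real k)"
        by (metis (no_types, lifting) mult.assoc mult.left_commute)
      thus ?thesis by (simp add: f_def algebra_simps)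
    qed
    thus ?thesis by (simp only: sum_distrib_left sum_subtractf[symmetric] sum.distrib[symmetric])
  qed
  have "cmod (of_real (4 * \<bar>\<theta>\<bar>) * (\<Sum>k<d. w k * g k * cis (t * real h * real k)) + \<mu> * (\<Sum>k<d. w k * cis (t * real h * real k)))
      \<le> 4 * \<bar>\<theta>\<bar> * e1 h t + \<bar>\<theta>\<bar> ^ 3 * 1"
  proof (intro norm_triangle_mono)
    show "cmod (of_real (4 * \<bar>\<theta>\<bar>) * (\<Sum>k<d. w k * g k * cis (t * real h * real k))) \<le> 4 * \<bar>\<theta>\<bar> * e1 h t"
      unfolding norm_mult using g_le by (intro mult_mono) auto
    have "cmod (\<Sum>k<d. w k * cis (t * real h * real k)) \<le> 1" unfolding w_def by (rule norm_tilt_sum_le) simp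
    thus "cmod (\<mu> * (\<Sum>k<d. w k * cis (t * real h * real k))) \<le> \<bar>\<theta>\<bar> ^ 3 * 1"
      unfolding norm_mult using \<mu>_le by (intro mult_mono) auto
  qed
  hence "cmod ((\<Sum>k<d. w k * cis (\<theta> * xi h k) * cis (t * real h * real k)) - of_real \<beta> * (\<Sum>k<d. w k * cis (t * real h * real k)))
      \<le> \<bar>\<theta>\<bar> ^ 3 + 4 * \<bar>\<theta>\<bar> * e1 h t"
    unfolding split_eq by simp
  thus ?thesis unfolding w_def \<beta>_def .
qed

text \<open>The |\<theta>|^3 terms meet an integral of order 1/(X s); the centred terms, with total
  s^2, meet one of order 1/(X s^2). The exponential is the accumulated phase loss of the envelopes,
  harmless when \<theta>^2 is of order 1 / card H.\<close>

lemma charfun_approx: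
  assumes \<theta>: "\<bar>\<theta>\<bar> \<le> 1"
  shows "cmod ((\<Sum>a\<in>digit_choices d H n. of_real (weight a) * cis (\<theta> * centred a)) - of_real (exp (- (\<theta>\<^sup>2 * (\<Sum>h\<in>H. v h) / 2)) * mass))
    \<le> K4 * exp (real (card H) * \<theta>\<^sup>2) * (real (card H) * \<bar>\<theta>\<bar> ^ 3 / (X * s) + \<bar>\<theta>\<bar> / X)"
proof -
  define G where "G = (\<lambda>h k. complex_of_real (tilt d (z * real h) k) * cis (\<theta> * xi h k))"
  define G' where "G' = (\<lambda>h k. complex_of_real (tilt d (z * real h) k) * of_real (exp (- (\<theta>\<^sup>2 * v h / 2))))"
  define A where "A = (\<lambda>h t. \<Sum>k<d. G h k * cis (t * real h * real k))"
  define B where "B = (\<lambda>h t. \<Sum>k<d. G' h k * cis (t * real h * real k))"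
  have B_eq: "B h t = of_real (exp (- (\<theta>\<^sup>2 * v h / 2))) * (\<Sum>k<d. of_real (tilt d (z * real h) k) * cis (t * real h * real k))" for h t
    unfolding B_def G'_def sum_distrib_left by (intro sum.cong) (auto simp: mult_ac)
  have prodG: "(\<Prod>h\<in>H. G h (a h)) = of_real (weight a) * cis (\<theta> * centred a)" for a
    unfolding G_def prod.distrib of_real_weight centred_def sum_distrib_left by (simp add: prod_cis)
  have "(\<Prod>h\<in>H. exp (- (\<theta>\<^sup>2 * v h / 2))) = exp (- (\<theta>\<^sup>2 * (\<Sum>h\<in>H. v h) / 2))"
    by (subst exp_sum[symmetric]) (auto simp: sum_negf sum_distrib_left sum_divide_distrib)
  hence prodG': "(\<Prod>h\<in>H. G' h (a h)) = of_real (exp (- (\<theta>\<^sup>2 * (\<Sum>h\<in>H. v h) / 2)) * weight a)" for a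
    unfolding G'_def prod.distrib of_real_weight[symmetric] by (simp flip: of_real_prod)
  define M where "M = exp 2 * exp (real (card H) * \<theta>\<^sup>2)"
  define F where "F = (\<lambda>t. M * (real (card H) * \<bar>\<theta>\<bar> ^ 3) * (arc_weight X t ^ 0 * env t) + M * (4 * \<bar>\<theta>\<bar> * ((real d)\<^sup>2 * C * s\<^sup>2)) * (arc_weight X t ^ 1 * env t))"
  have pt: "cmod ((\<Prod>h\<in>H. A h t) - (\<Prod>h\<in>H. B h t)) \<le> F t" for t
  proof -
    have A_env: "cmod (A h t) \<le> envelope \<theta> h t" for h
    proof -
      have "A h t = (\<Sum>k<d. of_real (tilt d (z * real h) k) * cis (\<theta> * xi h k + t * real h * real k))"
        unfolding A_def G_def by (simp add: mult.assoc cis_mult)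
      moreover have "\<bar>\<theta> * (xi h 1 - xi h 0)\<bar> \<le> \<bar>\<theta>\<bar>"
      proof -
        have "\<bar>xi h 1 - xi h 0\<bar> \<le> 1" by (simp add: xi_def)
        thus ?thesis unfolding abs_mult using mult_left_mono[of "\<bar>xi h 1 - xi h 0\<bar>" 1 "\<bar>\<theta>\<bar>"] by simp
      qed
      ultimately show ?thesis
        using unimodular_le_envelope[of "\<lambda>k. \<theta> * xi h k + t * real h * real k" t h "\<theta> * (xi h 1 - xi h 0)" \<theta>]
        by (simp add: algebra_simps)
    qed
    have B_env: "cmod (B h t) \<le> envelope \<theta> h t" for h
    proof -
      have "cmod (B h t) \<le> 1 * envelope \<theta> h t"
        unfolding B_eq norm_mult using phi_le_envelope v_bounds[of h] by (intro mult_mono) auto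
      thus ?thesis by simp
    qed
    have "cmod ((\<Prod>h\<in>H. A h t) - (\<Prod>h\<in>H. B h t)) \<le> (\<Sum>h\<in>H. cmod (A h t - B h t) * (\<Prod>j\<in>H - {h}. envelope \<theta> j t))"
      using A_env B_env by (intro norm_prod_diff_le) auto
    also have "\<dots> \<le> (\<Sum>h\<in>H. (\<bar>\<theta>\<bar> ^ 3 + 4 * \<bar>\<theta>\<bar> * e1 h t) * (M * env t))"
    proof (intro sum_mono mult_mono)
      fix h assume h: "h \<in> H"
      show "cmod (A h t - B h t) \<le> \<bar>\<theta>\<bar> ^ 3 + 4 * \<bar>\<theta>\<bar> * e1 h t"
        unfolding B_eq unfolding A_def G_def by (rule charfun_factor_diff[OF \<theta>])
      show "(\<Prod>j\<in>H - {h}. envelope \<theta> j t) \<le> M * env t"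
        unfolding M_def using h by (intro prod_envelope_le) auto
    qed (auto intro!: prod_nonneg envelope_nonneg add_nonneg_nonneg mult_nonneg_nonneg e1_nonneg)
    also have "\<dots> = M * env t * (real (card H) * \<bar>\<theta>\<bar> ^ 3 + 4 * \<bar>\<theta>\<bar> * (\<Sum>h\<in>H. e1 h t))"
      by (simp add: sum.distrib flip: sum_distrib_right sum_distrib_left)
    also have "\<dots> \<le> M * env t * (real (card H) * \<bar>\<theta>\<bar> ^ 3 + 4 * \<bar>\<theta>\<bar> * ((real d)\<^sup>2 * C * s\<^sup>2 * arc_weight X t))"
      using sum_e1_le[of t] env_pos[of t] by (intro mult_left_mono add_left_mono) (auto simp: M_def)
    also have "\<dots> = F t" by (simp add: F_def algebra_simps)
    finally show ?thesis .
  qed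
  have int: "(\<lambda>t. arc_weight X t ^ k * env t) integrable_on {-pi..pi}" for k
    by (intro integrable_continuous_real continuous_intros)
  have "cmod ((\<Sum>a\<in>digit_choices d H n. \<Prod>h\<in>H. G h (a h)) - (\<Sum>a\<in>digit_choices d H n. \<Prod>h\<in>H. G' h (a h))) \<le> integral {-pi..pi} F"
    by (rule norm_coefficient_diff_le)
      (use pt in \<open>auto simp: F_def A_def B_def intro!: integrable_continuous_real continuous_intros\<close>)
  also have "integral {-pi..pi} F = M * (real (card H) * \<bar>\<theta>\<bar> ^ 3) * integral {-pi..pi} (\<lambda>t. arc_weight X t ^ 0 * env t)
      + M * (4 * \<bar>\<theta>\<bar> * ((real d)\<^sup>2 * C * s\<^sup>2)) * integral {-pi..pi} (\<lambda>t. arc_weight X t ^ 1 * env t)"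
    unfolding F_def using int by (subst integral_add) (auto intro!: integrable_on_mult_right simp only: integral_mult_right)
  also have "\<dots> \<le> M * (real (card H) * \<bar>\<theta>\<bar> ^ 3) * (C / (X * s ^ Suc 0)) + M * (4 * \<bar>\<theta>\<bar> * ((real d)\<^sup>2 * C * s\<^sup>2)) * (C / (X * s ^ Suc 1))"
    using C_ge_1 by (intro add_mono mult_left_mono arcs) (auto simp: M_def)
  also have "\<dots> = M * C * (real (card H) * \<bar>\<theta>\<bar> ^ 3 / (X * s)) + M * (4 * (real d)\<^sup>2 * C\<^sup>2) * (\<bar>\<theta>\<bar> / X)"
    using s_ge_1 by (simp add: power2_eq_square mult_ac)
  also have "\<dots> \<le> M * (C + 4 * (real d)\<^sup>2 * C\<^sup>2) * (real (card H) * \<bar>\<theta>\<bar> ^ 3 / (X * s)) + M * (C + 4 * (real d)\<^sup>2 * C\<^sup>2) * (\<bar>\<theta>\<bar> / X)"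
    using X_pos s_ge_1 C_ge_1 by (intro add_mono mult_right_mono mult_left_mono) (auto simp: M_def)
  also have "\<dots> = K4 * exp (real (card H) * \<theta>\<^sup>2) * (real (card H) * \<bar>\<theta>\<bar> ^ 3 / (X * s) + \<bar>\<theta>\<bar> / X)"
    by (simp only: K4_def M_def distrib_left mult_ac)
  finally show ?thesis unfolding prodG prodG' mass_def by (simp add: sum_distrib_left)
qed

end

section \<open>Existence of the saddle point\<close>

text \<open>24 is 4!, a bound for y^k exp(-y) with k up to j + 1 \<le> 4.\<close>

lemma power_exp_le_min:
  fixes y :: real
  assumes "0 < y" "1 \<le> j" "j \<le> 3"
  shows "y ^ j * exp (- y) \<le> 24 * min y (1 / y)"
proof -
  have fact_le: "fact k \<le> (24::real)" if "k \<le> 4" for k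
  proof -
    have "fact k \<le> (fact 4 :: real)" using that by (intro fact_mono) auto
    thus ?thesis by (simp add: fact_numeral)
  qed
  have e: "y ^ k * exp (- y) \<le> fact k" for k using power_mult_exp_bound[of 1 y k] assms by simp
  have "y ^ j * exp (- y) = y * (y ^ (j - 1) * exp (- y))" using assms by (cases j) auto
  also have "\<dots> \<le> y * 24"
    using assms by (intro mult_left_mono order.trans[OF e fact_le]) auto
  finally have 1: "y ^ j * exp (- y) \<le> 24 * y" by simp
  have "y ^ Suc j * exp (- y) \<le> 24"
    using assms by (intro order.trans[OF e fact_le]) auto
  hence "y ^ j * exp (- y) \<le> 24 * (1 / y)" using assms by (simp add: field_simps)
  with 1 show ?thesis by (simp add: min_def)
qed

lemma exists_dyadic_exponent:
  assumes "1 \<le> ln x" "0 < x"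
  shows "\<exists>K. x < 2 ^ K \<and> real K \<le> 3 * ln x"
proof -
  define u where "u = ln x / ln 2"
  have ln2: "2 / 3 \<le> ln (2::real)" by (rule ln2_ge_two_thirds)
  have "u \<le> ln x / (2 / 3)" unfolding u_def using ln2 assms(1) by (intro divide_left_mono mult_pos_pos) linarith+
  hence u: "u \<le> 3 / 2 * ln x" by simp
  have u0: "0 \<le> u" unfolding u_def using ln2 assms(1) by (intro divide_nonneg_nonneg) linarith+
  define K where "K = nat \<lfloor>u\<rfloor> + 1"
  have K: "u < real K" "real K \<le> u + 1" unfolding K_def using u0 by linarith+
  have "x = exp (u * ln 2)" using assms ln2 by (simp add: u_def)
  also have "\<dots> < exp (real K * ln 2)" using K ln2 by simp
  also have "\<dots> = 2 ^ K" by (simp add: exp_of_nat_mult)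
  finally have "x < 2 ^ K" .
  moreover have "real K \<le> 3 * ln x" using K u assms(1) by linarith
  ultimately show ?thesis by blast
qed

context multi_base begin

text \<open>Majorising by min(u, 1/u) gives a bound that is uniform in z and has the exponent m -
  1.\<close>

lemma sum_power_exp_le:
  assumes z: "0 < z" and n: "1 \<le> ln (real n)" "0 < n" and j: "1 \<le> j" "j \<le> 3"
  shows "(\<Sum>h\<in>mb_le m p (real n). (z * real h) ^ j * exp (- (z * real h))) \<le> 96 * 3 ^ (m - 1) * ln (real n) ^ (m - 1)"
proof -
  obtain K where K: "real n < 2 ^ K" "real K \<le> 3 * ln (real n)" using exists_dyadic_exponent[OF n(1)] n(2) by auto
  have "(\<Sum>h\<in>mb_le m p (real n). (z * real h) ^ j * exp (- (z * real h)))
      \<le> (\<Sum>h\<in>mb_le m p (real n). 24 * min (z * real h) (1 / (z * real h)))"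
  proof (intro sum_mono power_exp_le_min j)
    fix h assume "h \<in> mb_le m p (real n)"
    hence "1 \<le> h" by (rule mb_le_pos[OF order_refl])
    thus "0 < z * real h" using z by simp
  qed
  also have "\<dots> = 24 * (\<Sum>h\<in>mb_le m p (real n). min (z * real h) (1 / (z * real h)))" by (simp add: sum_distrib_left)
  also have "\<dots> \<le> 24 * (4 * real K ^ (m - 1))"
    using m_ge_2 z K by (intro mult_left_mono sum_min_mb_le) auto
  also have "\<dots> \<le> 24 * (4 * (3 * ln (real n)) ^ (m - 1))" using K by (intro mult_left_mono power_mono) auto
  finally show ?thesis by (simp add: power_mult_distrib)
qed

lemma card_mb_le_asymp:
  assumes n: "0 < n" "1 \<le> ln (real n)" "(\<Sum>i<m. ln (real (p i))) \<le> ln (real n)"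
  shows "\<bar>real (card (mb_le m p (real n))) - mb_density * ln (real n) ^ m\<bar>
     \<le> mb_density * (real m * (\<Sum>i<m. ln (real (p i))) * 2 ^ (m - 1)) * ln (real n) ^ (m - 1)"
    and "real (card (mb_le m p (real n))) \<le> mb_density * 2 ^ m * ln (real n) ^ m"
proof -
  define L where "L = ln (real n)"
  define \<sigma> where "\<sigma> = (\<Sum>i<m. ln (real (p i)))"
  have \<sigma>: "0 \<le> \<sigma>" unfolding \<sigma>_def using ln_base_pos by (intro sum_nonneg) (simp add: less_imp_le)
  obtain k where k: "m = Suc k" using m_ge_2 by (cases m) auto
  have L: "1 \<le> L" "\<sigma> \<le> L" using n by (auto simp: L_def \<sigma>_def)
  have n1: "1 \<le> real n" using n by simp
  have low: "mb_density * L ^ m \<le> real (card (mb_le m p (real n)))"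
    using card_mb_le_bounds(1)[OF order_refl n1] by (simp add: mb_density_def L_def)
  have upp: "real (card (mb_le m p (real n))) \<le> mb_density * (L + \<sigma>) ^ m"
    using card_mb_le_bounds(2)[OF order_refl n1] by (simp add: mb_density_def L_def \<sigma>_def)
  have "(L + \<sigma>) ^ m - L ^ m \<le> real m * \<sigma> * (L + \<sigma>) ^ (m - 1)"
    using power_diff_bounds(2)[of L "L + \<sigma>" k] L \<sigma> by (simp add: k)
  also have "\<dots> \<le> real m * \<sigma> * (2 * L) ^ (m - 1)" using L \<sigma> by (intro mult_left_mono power_mono) auto
  finally have "mb_density * ((L + \<sigma>) ^ m - L ^ m) \<le> mb_density * (real m * \<sigma> * 2 ^ (m - 1) * L ^ (m - 1))"
    using mb_density_pos by (intro mult_left_mono) (auto simp: power_mult_distrib)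
  thus "\<bar>real (card (mb_le m p (real n))) - mb_density * ln (real n) ^ m\<bar>
     \<le> mb_density * (real m * (\<Sum>i<m. ln (real (p i))) * 2 ^ (m - 1)) * ln (real n) ^ (m - 1)"
    using low upp unfolding L_def[symmetric] \<sigma>_def[symmetric] by (simp add: right_diff_distrib mult.assoc)
  have "mb_density * (L + \<sigma>) ^ m \<le> mb_density * (2 * L) ^ m"
    using mb_density_pos L \<sigma> by (intro mult_left_mono power_mono) auto
  thus "real (card (mb_le m p (real n))) \<le> mb_density * 2 ^ m * ln (real n) ^ m"
    using upp by (simp add: L_def power_mult_distrib mult.assoc)
qed

text \<open>Intermediate value theorem. At z = 1/n the elements of the window below n already
  contribute at least n; at large z the mean digits are exponentially small. The lower end gives 1/z
  \<le> n, so that all elements up to 1/z occur in the sum.\<close>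

lemma mean_equation_solvable:
  assumes n: "window \<le> real n" and big: "window * real d * exp 1 / mb_density \<le> ln (real n) ^ (m - 1)"
  shows "\<exists>z. 1 / real n \<le> z \<and> (\<Sum>h\<in>mb_le m p (real n). real h * tilt_mean d (z * real h)) = real n"
proof -
  define f where "f = (\<lambda>z. \<Sum>h\<in>mb_le m p (real n). real h * tilt_mean d (z * real h))"
  have n1: "1 \<le> real n" using n window_ge_1 by linarith
  have w0: "0 < window" using window_ge_1 by linarith
  have low: "real n \<le> f (1 / real n)"
  proof -
    define W where "W = {h \<in> mb_le m p (real n). real n / window < real h}"
    \<comment> \<open>Digit 1 alone suffices: its probability is at least e^(-1)/d since h \<le>
      n.\<close>
    have each: "real n / window * (exp (- 1) / real d) \<le> real h * tilt_mean d (1 / real n * real h)" if "h \<in> W" for h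
    proof -
      have hn: "1 / real n * real h \<le> 1" using that n1 by (auto simp: W_def mb_le_def field_simps)
      interpret tilted_digit d "1 / real n * real h" using d_ge_2 by unfold_locales auto
      have "exp (- 1) / real d \<le> tilt d (1 / real n * real h) 1"
      proof -
        have "exp (- 1) \<le> exp (- (1 / real n * real h * real 1))"
          by (subst exp_le_cancel_iff, simp only: of_nat_1 mult_1_right) (use hn in linarith)
        from frac_le[OF exp_ge_zero this _ normaliser_bounds(2)] normaliser_bounds(1)
        show ?thesis unfolding tilt_def by linarith
      qed
      also have "\<dots> = tilt d (1 / real n * real h) 1 * real 1" by simp
      also have "\<dots> \<le> tilt_mean d (1 / real n * real h)"
        unfolding tilt_mean_def using d_ge_2 by (intro member_le_sum mult_nonneg_nonneg tilt_nonneg) auto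
      finally have "exp (- 1) / real d \<le> tilt_mean d (1 / real n * real h)" .
      thus ?thesis using that w0 by (intro mult_mono) (auto simp: W_def)
    qed
    have "real n = real n / window * (exp (- 1) / real d) * (mb_density * (window * real d * exp 1 / mb_density))"
      using w0 d_ge_2 mb_density_pos by (simp add: exp_minus)
    also have "\<dots> \<le> real n / window * (exp (- 1) / real d) * (mb_density * ln (real n) ^ (m - 1))"
      using big w0 mb_density_pos by (intro mult_left_mono) auto
    also have "\<dots> \<le> real n / window * (exp (- 1) / real d) * real (card W)"
      unfolding W_def using card_mb_le_window[OF _ n] m_ge_2 w0 by (intro mult_left_mono) auto
    also have "\<dots> = real (card W) * (real n / window * (exp (- 1) / real d))" by simp
    also have "\<dots> \<le> (\<Sum>h\<in>W. real h * tilt_mean d (1 / real n * real h))" using each by (intro sum_bounded_below)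
    also have "\<dots> \<le> f (1 / real n)"
      unfolding f_def
    proof (intro sum_mono2)
      show "0 \<le> real h * tilt_mean d (1 / real n * real h)" for h
        using d_ge_2 by (intro mult_nonneg_nonneg tilted_digit.tilt_mean_nonneg) (auto simp: tilted_digit_def)
    qed (auto simp: W_def)
    finally show ?thesis .
  qed
  define N where "N = real (card (mb_le m p (real n))) * (real d)\<^sup>2 + 1"
  have N: "1 \<le> N" by (simp add: N_def)
  \<comment> \<open>exp(-z1) is at most 1/N, which beats d^2 times the number of terms.\<close>
  define z1 where "z1 = 1 + ln N"
  have z1: "1 \<le> z1" using N by (simp add: z1_def)
  have upp: "f z1 \<le> real n"
  proof -
    have "f z1 \<le> real (card (mb_le m p (real n))) * (real n * ((real d)\<^sup>2 * (1 / N)))"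
      unfolding f_def
    proof (intro sum_bounded_above mult_mono)
      fix h assume h: "h \<in> mb_le m p (real n)"
      show "real h \<le> real n" using h by (simp add: mb_le_def)
      have h1: "1 \<le> real h" using mb_le_pos[OF order_refl h] by simp
      interpret tilted_digit d "z1 * real h" using d_ge_2 z1 by unfold_locales auto
      have "z1 * 1 \<le> z1 * real h" using z1 h1 by (intro mult_left_mono) auto
      hence "exp (- (z1 * real h)) \<le> exp (- ln N)" using z1_def by simp
      also have "\<dots> = 1 / N" using N by (simp add: exp_minus inverse_eq_divide)
      finally show "tilt_mean d (z1 * real h) \<le> (real d)\<^sup>2 * (1 / N)"
        by (intro order.trans[OF tilt_mean_le_exp] mult_left_mono) auto
      show "0 \<le> tilt_mean d (z1 * real h)" by (rule tilt_mean_nonneg)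
    qed auto
    also have "\<dots> = real n * ((N - 1) / N)" by (simp add: N_def)
    also have "\<dots> \<le> real n * 1" using N by (intro mult_left_mono) auto
    finally show ?thesis by simp
  qed
  have "continuous_on {1 / real n..z1} f"
    unfolding f_def tilt_mean_def tilt_def
  proof (intro continuous_intros ballI)
    fix h :: nat and u :: real assume "u \<in> {1 / real n..z1}"
    hence u: "0 \<le> u" using n1 by (metis atLeastAtMost_iff divide_nonneg_nonneg of_nat_0_le_iff order_trans zero_le_one)
    interpret tilted_digit d "u * real h" using d_ge_2 u by unfold_locales auto
    show "(\<Sum>j<d. exp (- (u * real h * real j))) \<noteq> 0" using normaliser_bounds(1) by linarith
  qed
  moreover have "1 / real n \<le> z1"
  proof -
    have "1 / real n \<le> 1" using n1 by simp
    thus ?thesis using z1 by linarith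
  qed
  ultimately obtain z where "1 / real n \<le> z" "f z = real n" using IVT2'[of f z1 "real n" "1 / real n"] upp low by blast
  thus ?thesis unfolding f_def by blast
qed

text \<open>The constants must be chosen before n, and the available bounds are in ln n rather than
  ln X. The mean equation gives n at most a constant times X (ln n)^(m-1), hence X \<ge> sqrt n for
  large n, and ln n \<le> 2 ln X converts the bounds at the cost of powers of 2.\<close>

lemma saddle_exists:
  "\<exists>C L0. \<forall>n. L0 \<le> ln (real n) \<longrightarrow>
    (\<exists>z. saddle m p d b C z n \<and> ln (real n) \<le> 2 * ln (1 / z) \<and> real n \<le> C * (1 / z) * ln (real n) ^ (m - 1))"
proof -
  have "\<forall>k. \<exists>C X0. 0 < C \<and> (\<forall>X\<ge>X0. integral {-pi..pi} (\<lambda>t. arc_weight X t ^ k * exp (- (decay / 2) * semi_deficit m p X t))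
    \<le> C / (X * sqrt (ln X ^ (m - 1)) ^ Suc k))"
    using integral_arc_weight_le[OF m_ge_2, of "decay / 2"] decay_pos by fastforce
  from choice[OF this] obtain Ck where "\<forall>k. \<exists>X0. 0 < Ck k \<and> (\<forall>X\<ge>X0. integral {-pi..pi} (\<lambda>t. arc_weight X t ^ k * exp (- (decay / 2) * semi_deficit m p X t))
    \<le> Ck k / (X * sqrt (ln X ^ (m - 1)) ^ Suc k))" by blast
  from choice[OF this] obtain Xk where CX: "\<forall>k. 0 < Ck k \<and> (\<forall>X\<ge>Xk k. integral {-pi..pi} (\<lambda>t. arc_weight X t ^ k * exp (- (decay / 2) * semi_deficit m p X t))
    \<le> Ck k / (X * sqrt (ln X ^ (m - 1)) ^ Suc k))" by blast
  have Ck: "0 < Ck k" for k using CX by blast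
  have Xk: "integral {-pi..pi} (\<lambda>t. arc_weight X t ^ k * exp (- (decay / 2) * semi_deficit m p X t))
    \<le> Ck k / (X * sqrt (ln X ^ (m - 1)) ^ Suc k)" if "Xk k \<le> X" for k X using CX that by blast
  define A :: real where "A = 96 * 3 ^ (m - 1)"
  have A: "1 \<le> A"
  proof -
    have "(1::real) \<le> 3 ^ (m - 1)" by simp
    thus ?thesis unfolding A_def by linarith
  qed
  \<comment> \<open>A sum of nonnegative terms, so it dominates each constant demanded by the locale
    \<open>saddle\<close> and by the bound on n.\<close>
  define C where "C = 1 + A * 2 ^ (m - 1) + mb_density * 2 ^ m * 2 ^ m + (real d)\<^sup>2 * A + (\<Sum>k\<le>3. Ck k)"
  define X0 where "X0 = exp 1 + (\<Sum>k\<le>3. \<bar>Xk k\<bar>)"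
  have X0: "exp 1 \<le> X0" "\<And>k. k \<le> 3 \<Longrightarrow> Xk k \<le> X0"
  proof -
    show "exp 1 \<le> X0" unfolding X0_def by (simp add: sum_nonneg)
    fix k :: nat assume "k \<le> 3"
    hence "\<bar>Xk k\<bar> \<le> (\<Sum>k\<le>3. \<bar>Xk k\<bar>)" by (intro member_le_sum) auto
    thus "Xk k \<le> X0" unfolding X0_def using exp_gt_zero[of "1::real"] by linarith
  qed
  have sumCk: "Ck k \<le> (\<Sum>k\<le>3. Ck k)" if "k \<le> 3" for k
    using that Ck by (intro member_le_sum) (auto simp: less_imp_le)
  have C_ge: "1 \<le> C" "A * 2 ^ (m - 1) \<le> C" "mb_density * 2 ^ m * 2 ^ m \<le> C" "(real d)\<^sup>2 * A \<le> C" "\<And>k. k \<le> 3 \<Longrightarrow> Ck k \<le> C"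
  proof -
    have nn: "0 \<le> A * 2 ^ (m - 1)" "0 \<le> mb_density * 2 ^ m * 2 ^ m" "0 \<le> (real d)\<^sup>2 * A" "0 \<le> (\<Sum>k\<le>3. Ck k)"
      using A mb_density_pos Ck by (auto intro!: sum_nonneg simp: less_imp_le)
    show "1 \<le> C" "A * 2 ^ (m - 1) \<le> C" "mb_density * 2 ^ m * 2 ^ m \<le> C" "(real d)\<^sup>2 * A \<le> C"
      unfolding C_def using nn by linarith+
    show "Ck k \<le> C" if "k \<le> 3" for k unfolding C_def using nn sumCk[OF that] by linarith
  qed
  define F where "F = (real d)\<^sup>2 * A * (fact (m - 1) / (1 / 4) ^ (m - 1))"
  have F: "1 \<le> F"
  proof -
    have "(1::real) \<le> fact (m - 1)" by (rule fact_ge_1)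
    moreover have "(1::real) \<le> 1 / (1 / 4) ^ (m - 1)" by (simp add: power_one_over)
    ultimately have "1 * 1 \<le> fact (m - 1) * (1 / (1 / 4 :: real) ^ (m - 1))" by (intro mult_mono) auto
    moreover have "1 * 1 \<le> (real d)\<^sup>2 * A" using d_ge_2 A by (intro mult_mono) auto
    ultimately have "1 * 1 \<le> (real d)\<^sup>2 * A * (fact (m - 1) * (1 / (1 / 4 :: real) ^ (m - 1)))" by (intro mult_mono) auto
    thus ?thesis by (simp add: F_def)
  qed
  define \<sigma> where "\<sigma> = (\<Sum>i<m. ln (real (p i)))"
  have w0: "0 < window" using window_ge_1 by linarith
  define B where "B = window * real d * exp 1 / mb_density"
  define L0 where "L0 = Max {1, ln window, \<sigma>, B, 4 * ln F, 2 * ln X0}"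
  have "\<exists>z. saddle m p d b C z n \<and> ln (real n) \<le> 2 * ln (1 / z) \<and> real n \<le> C * (1 / z) * ln (real n) ^ (m - 1)"
    if nL: "L0 \<le> ln (real n)" for n
  proof -
    define L where "L = ln (real n)"
    have L: "1 \<le> L" "ln window \<le> L" "\<sigma> \<le> L" "B \<le> L" "4 * ln F \<le> L" "2 * ln X0 \<le> L"
      using nL unfolding L0_def L_def[symmetric] by (auto simp: Max_le_iff)
    have n0: "0 < n" using L(1) unfolding L_def by (cases n) auto
    have nL': "real n = exp L" using n0 by (simp add: L_def)
    have nw: "window \<le> real n" using L(2) w0 n0 by (simp add: L_def)
    have "L ^ 1 \<le> L ^ (m - 1)" using L(1) m_ge_2 by (intro power_increasing) auto
    hence "B \<le> L ^ (m - 1)" using L(4) by simp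
    then obtain z where z: "1 / real n \<le> z" "(\<Sum>h\<in>mb_le m p (real n). real h * tilt_mean d (z * real h)) = real n"
      using mean_equation_solvable[OF nw] unfolding B_def L_def by blast
    have z0: "0 < z" using z(1) n0 by (meson divide_pos_pos less_le_trans of_nat_0_less_iff zero_less_one)
    define X where "X = 1 / z"
    have X: "0 < X" using z0 by (simp add: X_def)
    have Xn: "X \<le> real n" using z(1) z0 n0 by (simp add: X_def field_simps)
    have sums: "(\<Sum>h\<in>mb_le m p (real n). (z * real h) ^ j * exp (- (z * real h))) \<le> A * L ^ (m - 1)"
      if "1 \<le> j" "j \<le> 3" for j
      using sum_power_exp_le[OF z0 _ n0 that] L(1) by (simp add: A_def L_def)
    have nX: "real n \<le> (real d)\<^sup>2 * A * X * L ^ (m - 1)"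
    proof -
      have "(\<Sum>h\<in>mb_le m p (real n). real h * tilt_mean d (z * real h))
          \<le> (\<Sum>h\<in>mb_le m p (real n). real h * ((real d)\<^sup>2 * exp (- (z * real h))))"
      proof (intro sum_mono mult_left_mono tilted_digit.tilt_mean_le_exp)
        show "tilted_digit d (z * real h)" for h using d_ge_2 z0 by (simp add: tilted_digit_def)
      qed auto
      also have "\<dots> = (real d)\<^sup>2 * X * (\<Sum>h\<in>mb_le m p (real n). (z * real h) ^ 1 * exp (- (z * real h)))"
        using z0 by (simp add: sum_distrib_left X_def mult_ac)
      also have "\<dots> \<le> (real d)\<^sup>2 * X * (A * L ^ (m - 1))" using sums[of 1] X by (intro mult_left_mono) auto
      finally show ?thesis using z(2) by (simp add: mult_ac)
    qed
    have Xsqrt: "exp (L / 2) \<le> X"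
    proof -
      have "(real d)\<^sup>2 * A * L ^ (m - 1) \<le> exp (L / 2)"
      proof -
        have "L ^ (m - 1) * exp (- (1 / 4 * L)) \<le> fact (m - 1) / (1 / 4) ^ (m - 1)"
          using L(1) by (intro power_mult_exp_bound) auto
        hence "(real d)\<^sup>2 * A * (L ^ (m - 1) * exp (- (1 / 4 * L))) \<le> F"
          unfolding F_def using A by (intro mult_left_mono) auto
        also have "F = exp (ln F)" using F by simp
        also have "\<dots> \<le> exp (L / 4)" using L(5) by simp
        finally have "(real d)\<^sup>2 * A * (L ^ (m - 1) * exp (- (1 / 4 * L))) * exp (L / 4) \<le> exp (L / 4) * exp (L / 4)"
          by (intro mult_right_mono) auto
        moreover have "exp (- (1 / 4 * L)) * exp (L / 4) = 1" by (simp flip: exp_add)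
        moreover have "exp (L / 4) * exp (L / 4) = exp (L / 2)" by (simp flip: exp_add)
        ultimately show ?thesis by (simp add: mult.assoc)
      qed
      hence "(real d)\<^sup>2 * A * L ^ (m - 1) * X \<le> exp (L / 2) * X" using X by (intro mult_right_mono) auto
      moreover have "exp (L / 2) * exp (L / 2) = real n" unfolding nL' by (simp flip: exp_add)
      ultimately have "exp (L / 2) * exp (L / 2) \<le> exp (L / 2) * X" using nX by (simp add: mult_ac)
      thus ?thesis by (rule mult_left_le_imp_le) simp
    qed
    have lX: "L / 2 \<le> ln X" using ln_ge_iff[OF X, of "L / 2"] Xsqrt by blast
    have XX0: "X0 \<le> X"
    proof -
      have "0 < X0" using X0(1) exp_gt_zero[of "1::real"] by linarith
      hence "X0 = exp (ln X0)" by simp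
      also have "\<dots> \<le> exp (L / 2)" using L(6) by simp
      finally show ?thesis using Xsqrt by simp
    qed
    have L2: "L ^ j \<le> 2 ^ j * ln X ^ j" for j
      unfolding power_mult_distrib[symmetric] using L(1) lX by (intro power_mono) auto
    have lX0: "0 \<le> ln X" using lX L(1) by simp
    have "saddle m p d b C z n"
    proof (unfold_locales, goal_cases)
      case 1 show ?case by (rule C_ge)
    next
      case 2 show ?case by (rule z0)
    next
      case 3 show ?case using XX0 X0(1) unfolding X_def by linarith
    next
      case 4 show ?case using Xn unfolding X_def .
    next
      case 5 show ?case by (rule z(2))
    next
      case 6
      have "real (card (mb_le m p (real n))) \<le> mb_density * 2 ^ m * L ^ m"
        using card_mb_le_asymp(2)[OF n0] L(1,3) by (simp add: L_def \<sigma>_def)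
      also have "\<dots> \<le> mb_density * 2 ^ m * (2 ^ m * ln X ^ m)"
        using mb_density_pos L2 by (intro mult_left_mono) auto
      also have "\<dots> \<le> C * ln X ^ m"
        unfolding mult.assoc[symmetric] using C_ge(3) lX0 by (intro mult_right_mono) auto
      finally show ?case by (simp add: X_def)
    next
      case (7 j)
      have "A * L ^ (m - 1) \<le> A * (2 ^ (m - 1) * ln X ^ (m - 1))" using A L2 by (intro mult_left_mono) auto
      also have "\<dots> \<le> C * ln X ^ (m - 1)"
        unfolding mult.assoc[symmetric] using C_ge(2) lX0 by (intro mult_right_mono) auto
      finally show ?case using sums[OF 7] unfolding X_def by linarith
    next
      case (8 k)
      have "Xk k \<le> X" using X0(2)[OF 8] XX0 by linarith
      from Xk[OF this] have "integral {-pi..pi} (\<lambda>t. arc_weight X t ^ k * exp (- (decay / 2) * semi_deficit m p X t))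
        \<le> Ck k / (X * sqrt (ln X ^ (m - 1)) ^ Suc k)" .
      also have "\<dots> \<le> C / (X * sqrt (ln X ^ (m - 1)) ^ Suc k)"
        using C_ge(5)[OF 8] X lX0 by (intro divide_right_mono) auto
      finally show ?case unfolding X_def .
    qed
    moreover have "real n \<le> C * X * L ^ (m - 1)"
    proof -
      have "(real d)\<^sup>2 * A * (X * L ^ (m - 1)) \<le> C * (X * L ^ (m - 1))"
        using C_ge(4) X L(1) by (intro mult_right_mono) auto
      thus ?thesis using nX by (simp add: mult.assoc)
    qed
    ultimately show ?thesis using lX unfolding X_def L_def by (intro exI[of _ z]) auto
  qed
  thus ?thesis by blast
qed

end

section \<open>Uniformly random representations\<close>

context multi_base begin

definition extend_digits :: "nat \<Rightarrow> (nat \<Rightarrow> nat) \<Rightarrow> nat \<Rightarrow> nat" where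
  "extend_digits n a = (\<lambda>h. if h \<in> mb_le m p (real n) then a h else 0)"

text \<open>A nonzero digit at h contributes at least h to n, so every representation is supported
  on the elements up to n and the cutoff loses nothing.\<close>

lemma bij_betw_extend_digits:
  "bij_betw (extend_digits n) (digit_choices d (mb_le m p (real n)) n) (mb_reps d m p n)"
proof (rule bij_betw_imageI)
  let ?H = "mb_le m p (real n)"
  show "inj_on (extend_digits n) (digit_choices d ?H n)"
  proof (rule inj_onI)
    fix a a' assume a: "a \<in> digit_choices d ?H n" "a' \<in> digit_choices d ?H n" and eq: "extend_digits n a = extend_digits n a'"
    show "a = a'"
    proof (rule PiE_ext)
      show "a \<in> PiE ?H (\<lambda>_. {..<d})" "a' \<in> PiE ?H (\<lambda>_. {..<d})" using a by (auto simp: digit_choices_def)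
      fix h assume "h \<in> ?H"
      thus "a h = a' h" using fun_cong[OF eq, of h] by (simp add: extend_digits_def)
    qed
  qed
  show "extend_digits n ` digit_choices d ?H n = mb_reps d m p n"
  proof (intro equalityI subsetI)
    fix r assume "r \<in> extend_digits n ` digit_choices d ?H n"
    then obtain a where a: "a \<in> PiE ?H (\<lambda>_. {..<d})" "(\<Sum>h\<in>?H. a h * h) = n" "r = extend_digits n a"
      by (auto simp: digit_choices_def)
    have supp: "{h. r h \<noteq> 0} \<subseteq> ?H" by (auto simp: a extend_digits_def)
    have "(\<Sum>h\<in>{h. r h \<noteq> 0}. r h * h) = (\<Sum>h\<in>?H. r h * h)"
      using supp by (intro sum.mono_neutral_left) auto
    also have "\<dots> = n" using a by (simp add: extend_digits_def)
    finally show "r \<in> mb_reps d m p n"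
      using supp a d_ge_2 finite_subset[OF supp] by (auto simp: mb_reps_def extend_digits_def mb_le_def PiE_iff)
  next
    fix r assume r: "r \<in> mb_reps d m p n"
    have fin: "finite {h. r h \<noteq> 0}" and sum: "(\<Sum>h\<in>{h. r h \<noteq> 0}. r h * h) = n" and lt: "\<And>h. r h < d"
      using r by (auto simp: mb_reps_def)
    have supp: "h \<in> ?H" if "r h \<noteq> 0" for h
    proof -
      have "1 * h \<le> r h * h" using that by (intro mult_right_mono) auto
      also have "\<dots> \<le> n" unfolding sum[symmetric] using that fin by (intro member_le_sum) auto
      finally show ?thesis using r that by (auto simp: mb_reps_def mb_le_def)
    qed
    have "r = extend_digits n (restrict r ?H)"
    proof
      fix h show "r h = extend_digits n (restrict r ?H) h"
        using supp[of h] by (cases "r h = 0") (auto simp: extend_digits_def)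
    qed
    moreover have "(\<Sum>h\<in>?H. r h * h) = (\<Sum>h\<in>{h. r h \<noteq> 0}. r h * h)"
      using supp by (intro sum.mono_neutral_right) auto
    hence "(\<Sum>h\<in>?H. r h * h) = n" using sum by simp
    hence "restrict r ?H \<in> digit_choices d ?H n" using lt by (auto simp: digit_choices_def)
    ultimately show "r \<in> extend_digits n ` digit_choices d ?H n" by blast
  qed
qed

lemma mb_N_extend_digits:
  "real (mb_N m p b (extend_digits n a)) = (\<Sum>h\<in>mb_le m p (real n). if a h = b then 1 else 0)"
proof -
  \<comment> \<open>\<open>1 \<le> b\<close> excludes the digits 0 that the extension adds outside
    the cutoff.\<close>
  have "{h \<in> mb_S m p. extend_digits n a h = b} = {h \<in> mb_le m p (real n). a h = b}"
    using b_ge_1 by (auto simp: extend_digits_def mb_le_def)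
  thus ?thesis unfolding mb_N_def by (simp add: sum.If_cases Int_def)
qed

end

context saddle begin

definition mu where "mu = (\<Sum>h\<in>H. tilt d (z * real h) b)"
definition sigma2 where "sigma2 = (\<Sum>h\<in>H. v h)"

lemma mb_N_centred: "real (mb_N m p b (extend_digits n a)) - mu = centred a"
  by (simp add: mb_N_extend_digits mu_def centred_def xi_def sum_subtractf)

lemma weight_constant:
  assumes "a \<in> digit_choices d H n"
  shows "weight a = exp (- (z * real n)) / (\<Prod>h\<in>H. \<Sum>j<d. exp (- (z * real h * real j)))"
proof -
  have "(\<Sum>h\<in>H. real (a h) * real h) = real n" using assms by (simp add: digit_choices_def flip: of_nat_mult of_nat_sum)
  moreover have "(\<Prod>h\<in>H. exp (- (z * real h * real (a h)))) = exp (- (z * (\<Sum>h\<in>H. real (a h) * real h)))"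
    by (subst exp_sum[symmetric]) (auto simp: sum_negf sum_distrib_left mult_ac)
  ultimately show ?thesis unfolding weight_def tilt_def prod_dividef by simp
qed

text \<open>Vector-valued so as to serve both the real moments and the complex characteristic
  function. Positive mass also shows that n has a representation, which the uniform law
  presupposes.\<close>

lemma expectation_unif:
  fixes f :: "(nat \<Rightarrow> nat) \<Rightarrow> 'a :: {banach, second_countable_topology}"
  assumes "0 < mass"
  shows "measure_pmf.expectation (mb_unif d m p n) f = (\<Sum>a\<in>digit_choices d H n. weight a *\<^sub>R f (extend_digits n a)) /\<^sub>R mass"
proof -
  let ?D = "digit_choices d H n"
  define w0 where "w0 = exp (- (z * real n)) / (\<Prod>h\<in>H. \<Sum>j<d. exp (- (z * real h * real j)))"
  note bij = bij_betw_extend_digits[of n]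
  have fin: "finite (mb_reps d m p n)" using bij_betw_finite[OF bij] by simp
  have mass: "mass = real (card ?D) * w0"
    unfolding mass_def using weight_constant by (simp add: w0_def)
  have ne: "?D \<noteq> {}" using assms by (auto simp: mass_def)
  hence ne': "mb_reps d m p n \<noteq> {}" using bij by (auto simp: bij_betw_def)
  have w0: "w0 \<noteq> 0" using mass assms by auto
  have "measure_pmf.expectation (mb_unif d m p n) f = (\<Sum>r\<in>mb_reps d m p n. pmf (mb_unif d m p n) r *\<^sub>R f r)"
    using fin ne' by (intro integral_measure_pmf) (auto simp: mb_unif_def)
  also have "\<dots> = (\<Sum>r\<in>mb_reps d m p n. (1 / real (card ?D)) *\<^sub>R f r)"
    using fin ne' bij_betw_same_card[OF bij] by (intro sum.cong) (auto simp: mb_unif_def)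
  also have "\<dots> = (\<Sum>a\<in>?D. (1 / real (card ?D)) *\<^sub>R f (extend_digits n a))"
    by (rule sum.reindex_bij_betw[OF bij, symmetric])
  also have "\<dots> = (\<Sum>a\<in>?D. (inverse mass * w0) *\<^sub>R f (extend_digits n a))"
    using w0 by (simp add: mass inverse_eq_divide)
  also have "\<dots> = (\<Sum>a\<in>?D. weight a *\<^sub>R f (extend_digits n a)) /\<^sub>R mass"
    unfolding scaleR_sum_right scaleR_scaleR
    by (intro sum.cong refl) (simp add: weight_constant w0_def)
  finally show ?thesis .
qed

lemma expectation_unif_real:
  fixes f :: "(nat \<Rightarrow> nat) \<Rightarrow> real"
  assumes "0 < mass"
  shows "measure_pmf.expectation (mb_unif d m p n) f = (\<Sum>a\<in>digit_choices d H n. weight a * f (extend_digits n a)) / mass"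
  using expectation_unif[OF assms, of f] by (simp add: divide_inverse mult.commute)

lemma ratio_mass_le:
  assumes mass: "mass_const / (X * s) \<le> mass" and x: "\<bar>x\<bar> \<le> B / (X * s)" and B: "0 \<le> B"
  shows "\<bar>x / mass\<bar> \<le> B / mass_const"
proof -
  have m0: "0 < mass_const / (X * s)" using mass_const_pos X_pos s_ge_1 by simp
  have "\<bar>x / mass\<bar> = \<bar>x\<bar> / mass" using m0 mass by (simp add: abs_divide)
  also have "\<dots> \<le> (B / (X * s)) / (mass_const / (X * s))"
    using x mass m0 by (intro frac_le) auto
  also have "\<dots> = B / mass_const" using X_pos s_ge_1 by simp
  finally show ?thesis .
qed

definition K5 where "K5 = K1 / mass_const + (K2 / mass_const + (K1 / mass_const)\<^sup>2) + K4 / mass_const"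

lemma K_nonneg: "0 \<le> K1" "0 \<le> K2" "0 \<le> K4"
  using C_ge_1 by (auto simp: K1_def K2_def K4_def intro!: add_nonneg_nonneg mult_nonneg_nonneg)

lemma K5_ge: "K1 / mass_const \<le> K5" "K2 / mass_const + (K1 / mass_const)\<^sup>2 \<le> K5" "K4 / mass_const \<le> K5"
proof -
  have "0 \<le> K1 / mass_const" "0 \<le> K2 / mass_const" "0 \<le> K4 / mass_const" "0 \<le> (K1 / mass_const)\<^sup>2"
    using K_nonneg mass_const_pos by auto
  thus "K1 / mass_const \<le> K5" "K2 / mass_const + (K1 / mass_const)\<^sup>2 \<le> K5" "K4 / mass_const \<le> K5"
    unfolding K5_def by linarith+
qed

text \<open>The threshold of \<open>mass_ge\<close>; it depends on d and C only and holds once ln n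
  is large.\<close>

context
  assumes s_large: "2 * K3 * exp (real d ^ 3 * C / 2) \<le> s"
begin

lemma mass_pos: "0 < mass"
proof -
  have "0 < mass_const / (X * s)" using mass_const_pos X_pos s_ge_1 by simp
  thus ?thesis using mass_ge[OF s_large] by linarith
qed

definition "mean_centred = (\<Sum>a\<in>digit_choices d H n. weight a * centred a) / mass"

lemma mb_mean_eq: "mb_mean d m p b n = mu + mean_centred"
proof -
  have "mb_mean d m p b n = (\<Sum>a\<in>digit_choices d H n. weight a * (mu + centred a)) / mass"
    unfolding mb_mean_def expectation_unif_real[OF mass_pos] mb_N_centred[symmetric] by simp
  also have "\<dots> = (mass * mu + (\<Sum>a\<in>digit_choices d H n. weight a * centred a)) / mass"
    by (simp add: distrib_left sum.distrib mass_def sum_distrib_right)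
  also have "\<dots> = mu + mean_centred" using mass_pos by (simp add: mean_centred_def add_divide_distrib)
  finally show ?thesis .
qed

lemma mean_centred_le: "\<bar>mean_centred\<bar> \<le> K1 / mass_const * s"
proof -
  have "\<bar>\<Sum>a\<in>digit_choices d H n. weight a * centred a\<bar> \<le> (K1 * s) / (X * s)"
    using first_moment s_ge_1 by simp
  from ratio_mass_le[OF mass_ge[OF s_large] this] K_nonneg s_ge_1
  show ?thesis unfolding mean_centred_def by simp
qed

lemma mb_mean_approx: "\<bar>mb_mean d m p b n - mu\<bar> \<le> K5 * s"
proof -
  have "K1 / mass_const * s \<le> K5 * s" using K5_ge s_ge_1 by (intro mult_right_mono) auto
  thus ?thesis using mean_centred_le by (simp add: mb_mean_eq)
qed

text \<open>Passing from the centre \<open>mu\<close> to the true mean subtracts the square of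
  \<open>mean_centred\<close>, which is O(s^2) like the error of
  \<open>second_moment\<close>.\<close>

lemma mb_var_approx: "\<bar>mb_var d m p b n - sigma2\<bar> \<le> K5 * s\<^sup>2"
proof -
  let ?S = "\<lambda>f. \<Sum>a\<in>digit_choices d H n. weight a * f a"
  have "mb_var d m p b n = measure_pmf.expectation (mb_unif d m p n) (\<lambda>a. (real (mb_N m p b a) - mb_mean d m p b n)\<^sup>2)"
    unfolding mb_var_def mb_mean_def ..
  also have "\<dots> = ?S (\<lambda>a. (centred a - mean_centred)\<^sup>2) / mass"
    unfolding expectation_unif_real[OF mass_pos] mb_mean_eq mb_N_centred[symmetric] by (simp add: algebra_simps)
  also have "?S (\<lambda>a. (centred a - mean_centred)\<^sup>2) = ?S (\<lambda>a. (centred a)\<^sup>2) - 2 * mean_centred * ?S centred + mass * mean_centred\<^sup>2"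
  proof -
    have "?S (\<lambda>a. (centred a - mean_centred)\<^sup>2)
        = (\<Sum>a\<in>digit_choices d H n. weight a * (centred a)\<^sup>2 - 2 * mean_centred * (weight a * centred a) + weight a * mean_centred\<^sup>2)"
      by (intro sum.cong refl) (simp add: power2_eq_square algebra_simps)
    thus ?thesis by (simp add: sum.distrib sum_subtractf mass_def sum_distrib_right flip: sum_distrib_left)
  qed
  also have "?S centred = mass * mean_centred" using mass_pos by (simp add: mean_centred_def)
  finally have "mb_var d m p b n - sigma2 = (?S (\<lambda>a. (centred a)\<^sup>2) - mass * sigma2) / mass - mean_centred\<^sup>2"
    using mass_pos by (simp add: field_simps power2_eq_square)
  moreover have "\<bar>(?S (\<lambda>a. (centred a)\<^sup>2) - mass * sigma2) / mass\<bar> \<le> K2 * s\<^sup>2 / mass_const"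
  proof (rule ratio_mass_le[OF mass_ge[OF s_large]])
    show "\<bar>?S (\<lambda>a. (centred a)\<^sup>2) - mass * sigma2\<bar> \<le> K2 * s\<^sup>2 / (X * s)"
      using second_moment s_ge_1 by (simp add: sigma2_def power2_eq_square)
  qed (use K_nonneg in auto)
  moreover have "mean_centred\<^sup>2 \<le> (K1 / mass_const)\<^sup>2 * s\<^sup>2"
    using mean_centred_le by (metis abs_ge_zero power2_abs power_mono power_mult_distrib)
  moreover have "0 \<le> mean_centred\<^sup>2" by simp
  ultimately have "\<bar>mb_var d m p b n - sigma2\<bar> \<le> K2 * s\<^sup>2 / mass_const + (K1 / mass_const)\<^sup>2 * s\<^sup>2" by linarith
  also have "\<dots> = (K2 / mass_const + (K1 / mass_const)\<^sup>2) * s\<^sup>2" by (simp add: distrib_right)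
  also have "\<dots> \<le> K5 * s\<^sup>2" using K5_ge by (intro mult_right_mono) auto
  finally show ?thesis .
qed

lemma charfun_unif_approx:
  assumes \<theta>: "\<bar>\<theta>\<bar> \<le> 1"
  shows "cmod (measure_pmf.expectation (mb_unif d m p n) (\<lambda>a. cis (\<theta> * (real (mb_N m p b a) - mu))) - of_real (exp (- (\<theta>\<^sup>2 * sigma2 / 2))))
    \<le> K5 * (exp (real (card H) * \<theta>\<^sup>2) * (real (card H) * \<bar>\<theta>\<bar> ^ 3 + \<bar>\<theta>\<bar> * s))"
proof -
  define Q where "Q = (\<Sum>a\<in>digit_choices d H n. of_real (weight a) * cis (\<theta> * centred a))"
  define e where "e = exp (- (\<theta>\<^sup>2 * sigma2 / 2))"
  define R where "R = exp (real (card H) * \<theta>\<^sup>2) * (real (card H) * \<bar>\<theta>\<bar> ^ 3 + \<bar>\<theta>\<bar> * s)"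
  have R0: "0 \<le> R" unfolding R_def using s_ge_1 by (intro mult_nonneg_nonneg add_nonneg_nonneg) auto
  have "measure_pmf.expectation (mb_unif d m p n) (\<lambda>a. cis (\<theta> * (real (mb_N m p b a) - mu))) = Q / of_real mass"
    unfolding expectation_unif[OF mass_pos] mb_N_centred Q_def scaleR_conv_of_real
    by (simp add: divide_inverse mult.commute)
  also have "Q / of_real mass - of_real e = (Q - of_real (e * mass)) / of_real mass"
    using mass_pos by (simp add: field_simps)
  also have "cmod \<dots> = \<bar>cmod (Q - of_real (e * mass)) / mass\<bar>" using mass_pos by (simp add: norm_divide)
  also have "\<dots> \<le> K4 * R / mass_const"
  proof (rule ratio_mass_le[OF mass_ge[OF s_large]])
    have "cmod (Q - of_real (e * mass)) \<le> K4 * exp (real (card H) * \<theta>\<^sup>2) * (real (card H) * \<bar>\<theta>\<bar> ^ 3 / (X * s) + \<bar>\<theta>\<bar> / X)"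
      unfolding Q_def e_def sigma2_def by (rule charfun_approx[OF \<theta>])
    also have "real (card H) * \<bar>\<theta>\<bar> ^ 3 / (X * s) + \<bar>\<theta>\<bar> / X = (real (card H) * \<bar>\<theta>\<bar> ^ 3 + \<bar>\<theta>\<bar> * s) / (X * s)"
      using s_ge_1 by (simp add: add_divide_distrib)
    finally show "\<bar>cmod (Q - of_real (e * mass))\<bar> \<le> K4 * R / (X * s)" by (simp add: R_def mult.assoc)
  qed (use K_nonneg R0 in auto)
  also have "\<dots> = K4 / mass_const * R" by simp
  also have "\<dots> \<le> K5 * R" using K5_ge R0 by (intro mult_right_mono) auto
  finally show ?thesis unfolding R_def e_def .
qed

end

text \<open>Split at y = X / L^m. Below, each tilt is within d z y = d / L^m of uniform, and at most
  C L^m elements give O(1). Above, the trivial bound 1 suffices, because n / y is at most C L^(2m):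
  only O(ln L) dyadic scales with O(L^(m-1)) elements each.\<close>

lemma tilt_deviation_le:
  assumes L: "exp 1 \<le> ln (real n)" and L2: "real n \<le> C * X * ln (real n) ^ (m - 1)"
  shows "(\<Sum>h\<in>H. \<bar>tilt d (z * real h) b - 1 / real d\<bar>)
    \<le> (C * real d + 3 ^ m * (ln C + 2 * real m)) * (ln (real n) ^ (m - 1) * ln (ln (real n)))"
proof -
  define L where "L = ln (real n)"
  have L1: "1 \<le> L" using L order.trans[of 1 "exp 1" L] by (simp add: L_def)
  have lnL: "1 \<le> ln L" using L L1 unfolding L_def[symmetric] by (simp add: ln_ge_iff)
  have n0: "0 < n" using L1 unfolding L_def by (cases n) auto
  define y where "y = X / L ^ m"
  have y0: "0 < y" using X_pos L1 by (simp add: y_def)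
  define Q where "Q = C * L ^ (2 * m)"
  have lnC: "0 \<le> ln C" using C_ge_1 by simp
  have lnQ: "ln Q = ln C + 2 * real m * ln L" using C_ge_1 L1 by (simp add: Q_def ln_mult ln_realpow)
  have "1 * 1 \<le> 2 * real m * ln L" using lnL m_ge_2 by (intro mult_mono) auto
  hence lnQ1: "1 \<le> ln Q" using lnC by (simp add: lnQ)
  have Q0: "0 < Q" using C_ge_1 L1 by (simp add: Q_def)
  obtain R where R: "Q < 2 ^ R" "real R \<le> 3 * ln Q" using exists_dyadic_exponent[OF lnQ1 Q0] by blast
  obtain K where K: "real n < 2 ^ K" "real K \<le> 3 * L" using exists_dyadic_exponent[of "real n"] L1 n0 by (auto simp: L_def)
  have "real n \<le> y * 2 ^ R"
  proof -
    have "real n \<le> C * X * L ^ (m - 1)" using L2 by (simp add: L_def)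
    also have "\<dots> \<le> C * X * L ^ m" using C_ge_1 X_pos L1 by (intro mult_left_mono power_increasing) auto
    also have "\<dots> = y * Q"
    proof -
      have "L ^ (2 * m) = L ^ m * L ^ m" by (simp add: mult_2 power_add)
      thus ?thesis using L1 by (simp add: y_def Q_def)
    qed
    also have "\<dots> \<le> y * 2 ^ R" using R y0 by (intro mult_left_mono) auto
    finally show ?thesis .
  qed
  from card_mb_le_greater[OF _ y0 this K(1)] m_ge_2
  have "real (card {h \<in> H. y < real h}) \<le> real R * real K ^ (m - 1)" by simp
  also have "\<dots> \<le> (3 * ln Q) * (3 * L) ^ (m - 1)" using R K lnQ1 by (intro mult_mono power_mono) auto
  also have "\<dots> \<le> (3 * ((ln C + 2 * real m) * ln L)) * (3 * L) ^ (m - 1)"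
  proof (intro mult_right_mono mult_left_mono)
    have "ln C * 1 \<le> ln C * ln L" using lnC lnL by (intro mult_left_mono) auto
    thus "ln Q \<le> (ln C + 2 * real m) * ln L" by (simp add: lnQ distrib_right)
  qed (use L1 in auto)
  also have "\<dots> = 3 ^ m * (ln C + 2 * real m) * (L ^ (m - 1) * ln L)"
    using m_ge_2 by (cases m) (auto simp: power_mult_distrib)
  finally have large: "real (card {h \<in> H. y < real h}) \<le> 3 ^ m * (ln C + 2 * real m) * (L ^ (m - 1) * ln L)" .
  have small: "(\<Sum>h\<in>{h\<in>H. real h \<le> y}. \<bar>tilt d (z * real h) b - 1 / real d\<bar>) \<le> C * real d"
  proof -
    have "(\<Sum>h\<in>{h\<in>H. real h \<le> y}. \<bar>tilt d (z * real h) b - 1 / real d\<bar>) \<le> real (card {h\<in>H. real h \<le> y}) * (real d * (z * y))"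
    proof (rule sum_bounded_above)
      fix h assume "h \<in> {h\<in>H. real h \<le> y}"
      hence "real d * (z * real h) \<le> real d * (z * y)" using z_pos by (intro mult_left_mono) auto
      thus "\<bar>tilt d (z * real h) b - 1 / real d\<bar> \<le> real d * (z * y)"
        using tilted_digit.tilt_near_uniform[OF tilted b_less, of h] by linarith
    qed
    also have "\<dots> \<le> (C * L ^ m) * (real d * (z * y))"
    proof (rule mult_right_mono)
      have "real (card {h\<in>H. real h \<le> y}) \<le> real (card H)" by (intro of_nat_mono card_mono) auto
      also have "\<dots> \<le> C * ell ^ m" using card_le by (simp add: ell_def X_def)
      also have "\<dots> \<le> C * L ^ m"
      proof -
        have "ell \<le> L" unfolding ell_def L_def using X_pos X_le n0 by (subst ln_le_cancel_iff) (auto simp: X_def)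
        thus ?thesis using C_ge_1 ell_ge_1 by (intro mult_left_mono power_mono) auto
      qed
      finally show "real (card {h\<in>H. real h \<le> y}) \<le> C * L ^ m" .
    qed (use z_pos y0 in auto)
    also have "\<dots> = C * real d" using L1 z_pos by (simp add: y_def X_def)
    finally show ?thesis .
  qed
  have "(\<Sum>h\<in>H. \<bar>tilt d (z * real h) b - 1 / real d\<bar>)
      = (\<Sum>h\<in>{h\<in>H. real h \<le> y}. \<bar>tilt d (z * real h) b - 1 / real d\<bar>) + (\<Sum>h\<in>{h\<in>H. y < real h}. \<bar>tilt d (z * real h) b - 1 / real d\<bar>)"
    by (subst sum.union_disjoint[symmetric]) (auto intro!: sum.cong)
  also have "(\<Sum>h\<in>{h\<in>H. y < real h}. \<bar>tilt d (z * real h) b - 1 / real d\<bar>) \<le> real (card {h\<in>H. y < real h}) * 1"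
  proof (rule sum_bounded_above)
    fix h
    have "0 \<le> tilt d (z * real h) b" "tilt d (z * real h) b \<le> 1" "0 \<le> 1 / real d" "1 / real d \<le> 1"
      using tilted_digit.tilt_nonneg[OF tilted] tilted_digit.tilt_le_1[OF tilted b_less] d_ge_2 by auto
    thus "\<bar>tilt d (z * real h) b - 1 / real d\<bar> \<le> 1" by linarith
  qed
  also have "(\<Sum>h\<in>{h\<in>H. real h \<le> y}. \<bar>tilt d (z * real h) b - 1 / real d\<bar>) + real (card {h\<in>H. y < real h}) * 1
      \<le> C * real d * (L ^ (m - 1) * ln L) + 3 ^ m * (ln C + 2 * real m) * (L ^ (m - 1) * ln L)"
  proof (rule add_mono)
    have "1 * 1 \<le> L ^ (m - 1) * ln L" using L1 lnL by (intro mult_mono) auto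
    hence "C * real d * 1 \<le> C * real d * (L ^ (m - 1) * ln L)" using C_ge_1 by (intro mult_left_mono) auto
    thus "(\<Sum>h\<in>{h\<in>H. real h \<le> y}. \<bar>tilt d (z * real h) b - 1 / real d\<bar>) \<le> C * real d * (L ^ (m - 1) * ln L)"
      using small by linarith
  qed (use large in simp)
  finally show ?thesis unfolding L_def[symmetric] by (simp add: distrib_right)
qed

text \<open>For the variance, x (1 - x) - q (1 - q) = (x - q) (1 - x - q), and the second factor is
  at most 1 in absolute value.\<close>

lemma mu_sigma2_approx:
  assumes dev: "(\<Sum>h\<in>H. \<bar>tilt d (z * real h) b - 1 / real d\<bar>) \<le> T"
  shows "\<bar>mu - real (card H) / real d\<bar> \<le> T"
    and "\<bar>sigma2 - real (card H) * ((real d - 1) / (real d)\<^sup>2)\<bar> \<le> T"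
proof -
  have "mu - real (card H) / real d = (\<Sum>h\<in>H. tilt d (z * real h) b - 1 / real d)"
    by (simp add: mu_def sum_subtractf)
  also have "\<bar>\<dots>\<bar> \<le> (\<Sum>h\<in>H. \<bar>tilt d (z * real h) b - 1 / real d\<bar>)" by (rule sum_abs)
  finally show "\<bar>mu - real (card H) / real d\<bar> \<le> T" using dev by linarith
  have each: "\<bar>v h - (real d - 1) / (real d)\<^sup>2\<bar> \<le> \<bar>tilt d (z * real h) b - 1 / real d\<bar>" for h
  proof -
    define x q where "x = tilt d (z * real h) b" and "q = 1 / real d"
    have xq: "0 \<le> x" "x \<le> 1" "0 \<le> q" "q \<le> 1"
      using tilted_digit.tilt_nonneg[OF tilted] tilted_digit.tilt_le_1[OF tilted b_less] d_ge_2 by (auto simp: x_def q_def)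
    have "(real d - 1) / (real d)\<^sup>2 = q * (1 - q)" using d_ge_2 by (simp add: q_def power2_eq_square field_simps)
    hence "v h - (real d - 1) / (real d)\<^sup>2 = (x - q) * (1 - x - q)" by (simp add: v_def x_def algebra_simps)
    hence "\<bar>v h - (real d - 1) / (real d)\<^sup>2\<bar> = \<bar>x - q\<bar> * \<bar>1 - x - q\<bar>" by (simp add: abs_mult)
    also have "\<dots> \<le> \<bar>x - q\<bar> * 1" using xq by (intro mult_left_mono) auto
    finally show ?thesis by (simp add: x_def q_def)
  qed
  have "sigma2 - real (card H) * ((real d - 1) / (real d)\<^sup>2) = (\<Sum>h\<in>H. v h - (real d - 1) / (real d)\<^sup>2)"
    by (simp add: sigma2_def sum_subtractf)
  also have "\<bar>\<dots>\<bar> \<le> (\<Sum>h\<in>H. \<bar>tilt d (z * real h) b - 1 / real d\<bar>)"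
    by (rule order.trans[OF sum_abs sum_mono[OF each]])
  finally show "\<bar>sigma2 - real (card H) * ((real d - 1) / (real d)\<^sup>2)\<bar> \<le> T" using dev by linarith
qed

end

section \<open>Asymptotics\<close>

context multi_base begin

definition charfun_error :: "nat \<Rightarrow> real \<Rightarrow> real \<Rightarrow> real \<Rightarrow> real" where
  "charfun_error n \<mu> \<sigma>2 \<theta> = cmod (measure_pmf.expectation (mb_unif d m p n) (\<lambda>a. cis (\<theta> * (real (mb_N m p b a) - \<mu>))) - of_real (exp (- (\<theta>\<^sup>2 * \<sigma>2 / 2))))"

definition log_error :: "nat \<Rightarrow> real" where
  "log_error n = ln (real n) ^ (m - 1) * ln (ln (real n))"

text \<open>Packages the conclusions of the locale \<open>saddle\<close>, with its centre, variance
  and scale as plain reals, so that they can be quantified existentially for each n.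
  \<open>c\<close> is the number of digit positions, later an upper bound for it.\<close>

definition near_gaussian :: "real \<Rightarrow> real \<Rightarrow> nat \<Rightarrow> real \<Rightarrow> real \<Rightarrow> real \<Rightarrow> bool" where
  "near_gaussian K c n \<mu> \<sigma>2 s \<longleftrightarrow> 1 \<le> s \<and> s\<^sup>2 \<le> ln (real n) ^ (m - 1) \<and>
    \<bar>mb_mean d m p b n - \<mu>\<bar> \<le> K * s \<and> \<bar>mb_var d m p b n - \<sigma>2\<bar> \<le> K * s\<^sup>2 \<and>
    (\<forall>\<theta>. \<bar>\<theta>\<bar> \<le> 1 \<longrightarrow> charfun_error n \<mu> \<sigma>2 \<theta> \<le> K * (exp (c * \<theta>\<^sup>2) * (c * \<bar>\<theta>\<bar> ^ 3 + \<bar>\<theta>\<bar> * s)))"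

lemma eventually_ln_ge: "\<forall>\<^sub>F n in sequentially. c \<le> ln (real n)"
proof -
  have "filterlim (\<lambda>n. ln (real n)) at_top sequentially"
    by (intro filterlim_compose[OF ln_at_top] filterlim_real_sequentially)
  thus ?thesis by (simp add: filterlim_at_top)
qed

lemma saddle_estimates:
  "\<exists>K\<ge>1. \<forall>\<^sub>F n in sequentially. \<exists>\<mu> \<sigma>2 s. near_gaussian K (real (card (mb_le m p (real n)))) n \<mu> \<sigma>2 s \<and>
    \<bar>\<mu> - real (card (mb_le m p (real n))) / real d\<bar> \<le> K * log_error n \<and>
    \<bar>\<sigma>2 - real (card (mb_le m p (real n))) * ((real d - 1) / (real d)\<^sup>2)\<bar> \<le> K * log_error n"
proof -
  obtain C L0 where CL: "\<And>n. L0 \<le> ln (real n) \<Longrightarrow>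
      \<exists>z. saddle m p d b C z n \<and> ln (real n) \<le> 2 * ln (1 / z) \<and> real n \<le> C * (1 / z) * ln (real n) ^ (m - 1)"
    using saddle_exists by blast
  \<comment> \<open>The constants of the locale \<open>saddle\<close> are functions of d and C
    alone, hence available before n is fixed.\<close>
  define S0 where "S0 = 2 * saddle.K3 d C * exp (real d ^ 3 * C / 2)"
  define KT where "KT = C * real d + 3 ^ m * (ln C + 2 * real m)"
  define K where "K = max 1 (max (saddle.K5 d C) KT)"
  have K: "1 \<le> K" "saddle.K5 d C \<le> K" "KT \<le> K" by (auto simp: K_def)
  \<comment> \<open>2 S0^2 \<le> ln n gives S0^2 \<le> ell \<le> s^2, the threshold of
    \<open>mass_ge\<close>.\<close>
  have "\<forall>\<^sub>F n in sequentially. max (max L0 (exp 1)) (2 * S0\<^sup>2) \<le> ln (real n)" by (rule eventually_ln_ge)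
  hence "\<forall>\<^sub>F n in sequentially. \<exists>\<mu> \<sigma>2 s. near_gaussian K (real (card (mb_le m p (real n)))) n \<mu> \<sigma>2 s \<and>
    \<bar>\<mu> - real (card (mb_le m p (real n))) / real d\<bar> \<le> K * log_error n \<and>
    \<bar>\<sigma>2 - real (card (mb_le m p (real n))) * ((real d - 1) / (real d)\<^sup>2)\<bar> \<le> K * log_error n"
  proof (rule eventually_mono)
    fix n assume "max (max L0 (exp 1)) (2 * S0\<^sup>2) \<le> ln (real n)"
    hence nL: "L0 \<le> ln (real n)" "exp 1 \<le> ln (real n)" "2 * S0\<^sup>2 \<le> ln (real n)" by auto
    obtain z where z: "saddle m p d b C z n" "ln (real n) \<le> 2 * ln (1 / z)" "real n \<le> C * (1 / z) * ln (real n) ^ (m - 1)"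
      using CL[OF nL(1)] by blast
    interpret saddle m p d b C z n by (rule z(1))
    have n1: "0 < real n" using X_le X_pos unfolding X_def by linarith
    have L1: "1 \<le> ln (real n)" using nL(2) order.trans[of 1 "exp (1::real)"] by simp
    have lnL: "1 \<le> ln (ln (real n))" using nL(2) L1 by (simp add: ln_ge_iff)
    have pw: "0 \<le> ln (real n) ^ (m - 1) * ln (ln (real n))" using L1 lnL by (intro mult_nonneg_nonneg zero_le_power) linarith+
    have ellL: "ell \<le> ln (real n)" using X_pos X_le n1 unfolding ell_def X_def by (subst ln_le_cancel_iff) auto
    have "S0 \<le> s"
    proof (rule power2_le_imp_le)
      have "S0\<^sup>2 \<le> ell" using nL(3) z(2) by (simp add: ell_def X_def)
      also have "ell = ell ^ 1" by simp
      also have "\<dots> \<le> ell ^ (m - 1)" using ell_ge_1 m_ge_2 by (intro power_increasing) auto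
      finally show "S0\<^sup>2 \<le> s\<^sup>2" by (simp add: s_squared)
    qed (use s_ge_1 in simp)
    hence large: "2 * K3 * exp (real d ^ 3 * C / 2) \<le> s" by (simp add: S0_def)
    have "real n \<le> C * X * ln (real n) ^ (m - 1)" using z(3) by (simp add: X_def)
    note dev = mu_sigma2_approx[OF tilt_deviation_le[OF nL(2) this, folded KT_def log_error_def]]
    have KTle: "KT * log_error n \<le> K * log_error n"
      using K(3) pw unfolding log_error_def by (intro mult_right_mono) auto
    show "\<exists>\<mu> \<sigma>2 s. near_gaussian K (real (card H)) n \<mu> \<sigma>2 s \<and>
      \<bar>\<mu> - real (card H) / real d\<bar> \<le> K * log_error n \<and>
      \<bar>\<sigma>2 - real (card H) * ((real d - 1) / (real d)\<^sup>2)\<bar> \<le> K * log_error n"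
    proof (rule exI[of _ mu], rule exI[of _ sigma2], rule exI[of _ s], unfold near_gaussian_def, intro conjI allI impI)
      show "1 \<le> s" by (rule s_ge_1)
      show "s\<^sup>2 \<le> ln (real n) ^ (m - 1)" unfolding s_squared using ellL ell_ge_1 by (intro power_mono) auto
      show "\<bar>mb_mean d m p b n - mu\<bar> \<le> K * s"
        using s_ge_1 K(2) by (intro order.trans[OF mb_mean_approx[OF large] mult_right_mono]) auto
      show "\<bar>mb_var d m p b n - sigma2\<bar> \<le> K * s\<^sup>2"
        using K(2) by (intro order.trans[OF mb_var_approx[OF large] mult_right_mono]) auto
      show "\<bar>mu - real (card H) / real d\<bar> \<le> K * log_error n"
        by (rule order.trans[OF dev(1) KTle])
      show "\<bar>sigma2 - real (card H) * ((real d - 1) / (real d)\<^sup>2)\<bar> \<le> K * log_error n"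
        by (rule order.trans[OF dev(2) KTle])
      fix \<theta> :: real assume \<theta>: "\<bar>\<theta>\<bar> \<le> 1"
      show "charfun_error n mu sigma2 \<theta> \<le> K * (exp (real (card H) * \<theta>\<^sup>2) * (real (card H) * \<bar>\<theta>\<bar> ^ 3 + \<bar>\<theta>\<bar> * s))"
        unfolding charfun_error_def
        using K(2) s_ge_1 by (intro order.trans[OF charfun_unif_approx[OF large \<theta>] mult_right_mono] mult_nonneg_nonneg add_nonneg_nonneg) auto
    qed
  qed
  thus ?thesis using K(1) by blast
qed

definition "mean_const = mb_density / real d"
definition "var_const = mb_density * ((real d - 1) / (real d)\<^sup>2)"

lemma var_const_pos: "0 < var_const"
  using mb_density_pos d_ge_2 by (simp add: var_const_def)

lemma moment_estimates:
  "\<exists>K\<ge>1. \<forall>\<^sub>F n in sequentially.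
    \<bar>mb_mean d m p b n - mean_const * ln (real n) ^ m\<bar> \<le> K * log_error n \<and>
    \<bar>mb_var d m p b n - var_const * ln (real n) ^ m\<bar> \<le> K * log_error n \<and>
    (\<exists>\<mu> \<sigma>2 s. near_gaussian K (K * ln (real n) ^ m) n \<mu> \<sigma>2 s)"
proof -
  obtain K0 where K0: "1 \<le> K0" and ev: "\<forall>\<^sub>F n in sequentially. \<exists>\<mu> \<sigma>2 s. near_gaussian K0 (real (card (mb_le m p (real n)))) n \<mu> \<sigma>2 s \<and>
    \<bar>\<mu> - real (card (mb_le m p (real n))) / real d\<bar> \<le> K0 * log_error n \<and>
    \<bar>\<sigma>2 - real (card (mb_le m p (real n))) * ((real d - 1) / (real d)\<^sup>2)\<bar> \<le> K0 * log_error n"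
    using saddle_estimates by blast
  define \<sigma> where "\<sigma> = (\<Sum>i<m. ln (real (p i)))"
  have \<sigma>0: "0 \<le> \<sigma>" unfolding \<sigma>_def using ln_base_pos by (intro sum_nonneg) (simp add: less_imp_le)
  define B where "B = mb_density * (real m * \<sigma> * 2 ^ (m - 1))"
  have B0: "0 \<le> B" using mb_density_pos \<sigma>0 by (simp add: B_def)
  \<comment> \<open>One K0 for conditioning, one for tilted against uniform digits, and B for the
    count of positions; the last term bounds that count by K L^m.\<close>
  define K where "K = 2 * K0 + B + mb_density * 2 ^ m"
  have d0: "0 \<le> mb_density * 2 ^ m" using mb_density_pos by simp
  have K: "1 \<le> K" "K0 \<le> K" "2 * K0 + B \<le> K" "mb_density * 2 ^ m \<le> K" unfolding K_def using K0 B0 d0 by linarith+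
  have "\<forall>\<^sub>F n in sequentially. max (exp 1) \<sigma> \<le> ln (real n)" by (rule eventually_ln_ge)
  with ev have "\<forall>\<^sub>F n in sequentially.
    \<bar>mb_mean d m p b n - mean_const * ln (real n) ^ m\<bar> \<le> K * log_error n \<and>
    \<bar>mb_var d m p b n - var_const * ln (real n) ^ m\<bar> \<le> K * log_error n \<and>
    (\<exists>\<mu> \<sigma>2 s. near_gaussian K (K * ln (real n) ^ m) n \<mu> \<sigma>2 s)"
  proof eventually_elim
    case (elim n)
    define L where "L = ln (real n)"
    define E where "E = L ^ (m - 1) * ln L"
    define c where "c = real (card (mb_le m p (real n)))"
    obtain \<mu> \<sigma>2 s where s: "1 \<le> s" "s\<^sup>2 \<le> L ^ (m - 1)"
      and mean: "\<bar>mb_mean d m p b n - \<mu>\<bar> \<le> K0 * s" and var: "\<bar>mb_var d m p b n - \<sigma>2\<bar> \<le> K0 * s\<^sup>2"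
      and mu: "\<bar>\<mu> - c / real d\<bar> \<le> K0 * E" and s2: "\<bar>\<sigma>2 - c * ((real d - 1) / (real d)\<^sup>2)\<bar> \<le> K0 * E"
      and ch: "\<And>\<theta>. \<bar>\<theta>\<bar> \<le> 1 \<Longrightarrow> charfun_error n \<mu> \<sigma>2 \<theta> \<le> K0 * (exp (c * \<theta>\<^sup>2) * (c * \<bar>\<theta>\<bar> ^ 3 + \<bar>\<theta>\<bar> * s))"
      using elim(1) unfolding c_def E_def L_def near_gaussian_def log_error_def by blast
    have L: "exp 1 \<le> L" "\<sigma> \<le> L" using elim(2) by (auto simp: L_def)
    have L1: "1 \<le> L" using L(1) order.trans[of 1 "exp (1::real)"] by simp
    have lnL: "1 \<le> ln L" using L(1) L1 by (simp add: ln_ge_iff)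
    have n0: "0 < n" using L1 unfolding L_def by (cases n) auto
    have "1 * L ^ (m - 1) \<le> ln L * L ^ (m - 1)" using lnL L1 by (intro mult_right_mono) auto
    hence LE: "L ^ (m - 1) \<le> E" by (simp add: E_def mult.commute)
    have E0: "0 \<le> E" using LE L1 by (meson order.trans zero_le_one zero_le_power)
    have "s * 1 \<le> s * s" using s by (intro mult_left_mono) auto
    hence "s \<le> s\<^sup>2" by (simp add: power2_eq_square)
    hence sE: "s \<le> E" "s\<^sup>2 \<le> E" using s LE by linarith+
    have card: "\<bar>c - mb_density * L ^ m\<bar> \<le> B * E" "c \<le> mb_density * 2 ^ m * L ^ m"
    proof -
      note ca = card_mb_le_asymp[OF n0, folded L_def \<sigma>_def c_def]
      have "B * L ^ (m - 1) \<le> B * E" using LE B0 by (intro mult_left_mono)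
      thus "\<bar>c - mb_density * L ^ m\<bar> \<le> B * E" using ca(1)[OF L1 L(2)] by (simp add: B_def)
      show "c \<le> mb_density * 2 ^ m * L ^ m" using ca(2)[OF L1 L(2)] .
    qed
    have scale: "\<bar>c * r - mb_density * r * L ^ m\<bar> \<le> B * E" if "0 \<le> r" "r \<le> 1" for r
    proof -
      have "c * r - mb_density * r * L ^ m = (c - mb_density * L ^ m) * r" by (simp add: algebra_simps)
      hence "\<bar>c * r - mb_density * r * L ^ m\<bar> = \<bar>c - mb_density * L ^ m\<bar> * r" using that by (simp add: abs_mult)
      also have "\<dots> \<le> (B * E) * 1" using card that B0 E0 by (intro mult_mono) auto
      finally show ?thesis by simp
    qed
    have KE: "K0 * s \<le> K0 * E" "K0 * s\<^sup>2 \<le> K0 * E" using sE K0 by (auto intro!: mult_left_mono)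
    have KE': "(2 * K0 + B) * E \<le> K * E" using K E0 by (intro mult_right_mono) auto
    have r1: "0 \<le> 1 / real d" "1 / real d \<le> 1" using d_ge_2 by auto
    have r2: "0 \<le> (real d - 1) / (real d)\<^sup>2" "(real d - 1) / (real d)\<^sup>2 \<le> 1"
    proof -
      show "0 \<le> (real d - 1) / (real d)\<^sup>2" using d_ge_2 by simp
      have "real d * 1 \<le> real d * real d" using d_ge_2 by (intro mult_left_mono) auto
      hence "real d - 1 \<le> (real d)\<^sup>2" by (simp add: power2_eq_square)
      thus "(real d - 1) / (real d)\<^sup>2 \<le> 1" using d_ge_2 by (simp add: divide_le_eq)
    qed
    have "\<bar>mb_mean d m p b n - mean_const * L ^ m\<bar> \<le> K * E"
    proof -
      have "\<bar>c / real d - mean_const * L ^ m\<bar> \<le> B * E" using scale[OF r1] by (simp add: mean_const_def)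
      hence "\<bar>mb_mean d m p b n - mean_const * L ^ m\<bar> \<le> K0 * s + K0 * E + B * E" using mean mu by linarith
      also have "\<dots> \<le> (2 * K0 + B) * E" unfolding distrib_right using KE by linarith
      finally show ?thesis using KE' by linarith
    qed
    moreover have "\<bar>mb_var d m p b n - var_const * L ^ m\<bar> \<le> K * E"
    proof -
      have "\<bar>c * ((real d - 1) / (real d)\<^sup>2) - var_const * L ^ m\<bar> \<le> B * E" using scale[OF r2] by (simp add: var_const_def)
      hence "\<bar>mb_var d m p b n - var_const * L ^ m\<bar> \<le> K0 * s\<^sup>2 + K0 * E + B * E" using var s2 by linarith
      also have "\<dots> \<le> (2 * K0 + B) * E" unfolding distrib_right using KE by linarith
      finally show ?thesis using KE' by linarith
    qed
    moreover have "\<bar>mb_mean d m p b n - \<mu>\<bar> \<le> K * s" "\<bar>mb_var d m p b n - \<sigma>2\<bar> \<le> K * s\<^sup>2"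
    proof -
      have "K0 * s \<le> K * s" "K0 * s\<^sup>2 \<le> K * s\<^sup>2" using K(2) s(1) by (auto intro!: mult_right_mono)
      thus "\<bar>mb_mean d m p b n - \<mu>\<bar> \<le> K * s" "\<bar>mb_var d m p b n - \<sigma>2\<bar> \<le> K * s\<^sup>2" using mean var by linarith+
    qed
    moreover have "charfun_error n \<mu> \<sigma>2 \<theta> \<le> K * (exp (K * L ^ m * \<theta>\<^sup>2) * (K * L ^ m * \<bar>\<theta>\<bar> ^ 3 + \<bar>\<theta>\<bar> * s))"
      if \<theta>: "\<bar>\<theta>\<bar> \<le> 1" for \<theta>
    proof -
      have "mb_density * 2 ^ m * L ^ m \<le> K * L ^ m" using K(4) L1 by (intro mult_right_mono) auto
      hence cK: "c \<le> K * L ^ m" using card(2) by linarith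
      have c0: "0 \<le> c" by (simp add: c_def)
      have "K0 * (exp (c * \<theta>\<^sup>2) * (c * \<bar>\<theta>\<bar> ^ 3 + \<bar>\<theta>\<bar> * s)) \<le> K * (exp (K * L ^ m * \<theta>\<^sup>2) * (K * L ^ m * \<bar>\<theta>\<bar> ^ 3 + \<bar>\<theta>\<bar> * s))"
      proof (intro mult_mono add_right_mono)
        show "exp (c * \<theta>\<^sup>2) \<le> exp (K * L ^ m * \<theta>\<^sup>2)" using cK by (auto intro!: mult_right_mono)
      qed (use K cK c0 s in \<open>auto intro!: add_nonneg_nonneg mult_nonneg_nonneg\<close>)
      thus ?thesis using ch[OF \<theta>] by linarith
    qed
    ultimately show ?case using s unfolding near_gaussian_def log_error_def L_def[symmetric] E_def[symmetric] by blast
  qed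
  thus ?thesis using K(1) by blast
qed

section \<open>From characteristic functions to the Gaussian limit\<close>

lemma exp_minus_lipschitz: "\<bar>exp (- x) - exp (- y)\<bar> \<le> \<bar>x - y\<bar>" if "0 \<le> x" "0 \<le> y" for x y :: real
proof -
  have one: "exp (- x) - exp (- y) \<le> \<bar>x - y\<bar>" if "0 \<le> x" "0 \<le> y" for x y :: real
  proof -
    have "exp (- x) - exp (- y) = exp (- x) * (1 - exp (x - y))" by (simp add: right_diff_distrib flip: exp_add)
    also have "\<dots> \<le> exp (- x) * \<bar>x - y\<bar>"
    proof (intro mult_left_mono)
      show "1 - exp (x - y) \<le> \<bar>x - y\<bar>" using exp_ge_add_one_self[of "x - y"] by linarith
    qed simp
    also have "\<dots> \<le> 1 * \<bar>x - y\<bar>" using that by (intro mult_right_mono) auto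
    finally show ?thesis by simp
  qed
  show ?thesis using one[OF that] one[OF that(2,1)] by linarith
qed

text \<open>With \<theta> equal to \<tau> over the standard deviation, L^m \<theta>^2 stays bounded,
  while L^m |\<theta>|^3 and |\<theta>| s are O(1 / sqrt L). All errors therefore vanish and Levy
  continuity applies.\<close>

lemma central_limit:
  "weak_conv_m (\<lambda>n. distr (measure_pmf (mb_unif d m p n)) borel
      (\<lambda>a. (real (mb_N m p b a) - mb_mean d m p b n) / sqrt (mb_var d m p b n))) std_normal_distribution"
proof (rule levy_continuity)
  let ?Y = "\<lambda>n a. (real (mb_N m p b a) - mb_mean d m p b n) / sqrt (mb_var d m p b n)"
  show "real_distribution (distr (measure_pmf (mb_unif d m p n)) borel (?Y n))" for n
    by (intro prob_space.real_distribution_distr[OF prob_space_measure_pmf]) simp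
  show "real_distribution std_normal_distribution" by (rule real_dist_normal_dist)
  fix \<tau> :: real
  obtain K where K: "1 \<le> K" and ev: "\<forall>\<^sub>F n in sequentially.
    \<bar>mb_mean d m p b n - mean_const * ln (real n) ^ m\<bar> \<le> K * log_error n \<and>
    \<bar>mb_var d m p b n - var_const * ln (real n) ^ m\<bar> \<le> K * log_error n \<and>
    (\<exists>\<mu> \<sigma>2 s. near_gaussian K (K * ln (real n) ^ m) n \<mu> \<sigma>2 s)"
    using moment_estimates by blast
  \<comment> \<open>Half of the leading constant: for large n the error in the variance is at most
    the other half, so the variance is at least D L^m and |\<theta>| L^(m/2) \<le> q.\<close>
  define D where "D = var_const / 2"
  have D: "0 < D" using var_const_pos by (simp add: D_def)
  define q where "q = \<bar>\<tau>\<bar> / sqrt D"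
  have q0: "0 \<le> q" using D by (simp add: q_def)
  define G where "G = K * q + K * (exp (K * q\<^sup>2) * (K * q\<^sup>2 * q + q)) + q\<^sup>2 * K"
  have "\<forall>\<^sub>F x in at_top. ln x / x < D / K"
    using order_tendstoD(2)[OF ln_x_over_x_tendsto_0, of "D / K"] D K by simp
  moreover have "filterlim (\<lambda>n. ln (real n)) at_top sequentially"
    by (intro filterlim_compose[OF ln_at_top] filterlim_real_sequentially)
  ultimately have ev2: "\<forall>\<^sub>F n in sequentially. ln (ln (real n)) / ln (real n) < D / K"
    by (rule eventually_compose_filterlim)
  have ev3: "\<forall>\<^sub>F n in sequentially. max 1 (max (q\<^sup>2) (K / D)) \<le> ln (real n)" by (rule eventually_ln_ge)
  have bound: "\<forall>\<^sub>F n in sequentially. dist (char (distr (measure_pmf (mb_unif d m p n)) borel (?Y n)) \<tau>) (of_real (exp (- (\<tau>\<^sup>2) / 2))) \<le> G / sqrt (ln (real n))"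
    using ev ev2 ev3
  proof eventually_elim
    case (elim n)
    define L where "L = ln (real n)"
    define V where "V = mb_var d m p b n"
    obtain \<mu> \<sigma>2 s where s: "1 \<le> s" "s\<^sup>2 \<le> L ^ (m - 1)"
      and mean: "\<bar>mb_mean d m p b n - \<mu>\<bar> \<le> K * s" and var: "\<bar>V - \<sigma>2\<bar> \<le> K * s\<^sup>2"
      and ch: "\<And>\<theta>. \<bar>\<theta>\<bar> \<le> 1 \<Longrightarrow> charfun_error n \<mu> \<sigma>2 \<theta> \<le> K * (exp (K * L ^ m * \<theta>\<^sup>2) * (K * L ^ m * \<bar>\<theta>\<bar> ^ 3 + \<bar>\<theta>\<bar> * s))"
      using elim(1) unfolding V_def L_def near_gaussian_def by blast
    have L: "1 \<le> L" "q\<^sup>2 \<le> L" "K / D \<le> L" using elim(3) by (auto simp: L_def)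
    have Lm: "L ^ m = L ^ (m - 1) * L" using m_ge_2 by (cases m) auto
    have Lm0: "0 < L ^ (m - 1)" using L by simp
    have V_ge: "D * L ^ m \<le> V"
    proof -
      have "K * ln L \<le> D * L" using elim(2) K L by (simp add: L_def[symmetric] field_simps)
      hence "L ^ (m - 1) * (K * ln L) \<le> L ^ (m - 1) * (D * L)" using Lm0 by (intro mult_left_mono) auto
      hence "K * (L ^ (m - 1) * ln L) \<le> D * L ^ m" by (simp add: Lm mult_ac)
      moreover have "\<bar>V - 2 * D * L ^ m\<bar> \<le> K * (L ^ (m - 1) * ln L)" using elim(1) by (simp add: V_def L_def D_def log_error_def)
      ultimately show ?thesis by linarith
    qed
    have DL: "0 < D * L ^ m" using D L by simp
    have V0: "0 < V" using V_ge DL by linarith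
    define \<theta> where "\<theta> = \<tau> / sqrt V"
    have th2: "\<theta>\<^sup>2 * V = \<tau>\<^sup>2" using V0 by (simp add: \<theta>_def power_divide)
    have th2_le: "\<theta>\<^sup>2 * L ^ m \<le> q\<^sup>2"
    proof -
      have "\<theta>\<^sup>2 * (D * L ^ m) \<le> \<theta>\<^sup>2 * V" using V_ge by (intro mult_left_mono) auto
      hence "\<theta>\<^sup>2 * L ^ m * D \<le> \<tau>\<^sup>2" unfolding th2 by (simp add: mult_ac)
      thus ?thesis using D by (simp add: q_def power_divide pos_le_divide_eq)
    qed
    have sL: "0 < sqrt L" using L by simp
    have th_s: "\<bar>\<theta>\<bar> * s \<le> q / sqrt L"
    proof (rule power2_le_imp_le)
      have "(\<bar>\<theta>\<bar> * s)\<^sup>2 * L \<le> \<theta>\<^sup>2 * L ^ (m - 1) * L"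
        unfolding power_mult_distrib power2_abs using s L by (intro mult_right_mono mult_left_mono) auto
      also have "\<dots> \<le> q\<^sup>2" using th2_le by (simp add: Lm mult_ac)
      finally show "(\<bar>\<theta>\<bar> * s)\<^sup>2 \<le> (q / sqrt L)\<^sup>2" using L by (simp add: power_divide pos_le_divide_eq)
    qed (use q0 sL in simp)
    have "\<bar>\<theta>\<bar> * 1 \<le> \<bar>\<theta>\<bar> * s" using s by (intro mult_left_mono) auto
    hence th: "\<bar>\<theta>\<bar> \<le> q / sqrt L" using th_s by simp
    have "q \<le> sqrt L" using L(2) q0 by (intro real_le_rsqrt)
    hence "q / sqrt L \<le> 1" using sL by simp
    hence th1: "\<bar>\<theta>\<bar> \<le> 1" using th by linarith
    let ?E = "\<lambda>f. measure_pmf.expectation (mb_unif d m p n) f"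
    \<comment> \<open>The phase that corrects the centre \<mu> of the product law to the true
      mean.\<close>
    define \<delta> where "\<delta> = \<theta> * (\<mu> - mb_mean d m p b n)"
    have "char (distr (measure_pmf (mb_unif d m p n)) borel (?Y n)) \<tau> = ?E (\<lambda>a. iexp (\<tau> * ?Y n a))"
      unfolding char_def by (subst integral_distr) auto
    also have "\<dots> = ?E (\<lambda>a. cis \<delta> * cis (\<theta> * (real (mb_N m p b a) - \<mu>)))"
    proof -
      have "\<tau> * ?Y n a = \<delta> + \<theta> * (real (mb_N m p b a) - \<mu>)" for a
        by (simp add: \<theta>_def \<delta>_def V_def algebra_simps flip: add_divide_distrib diff_divide_distrib)
      thus ?thesis by (simp only: cis_mult cis_conv_exp[symmetric])
    qed
    also have "\<dots> = cis \<delta> * ?E (\<lambda>a. cis (\<theta> * (real (mb_N m p b a) - \<mu>)))"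
      by (rule integral_mult_right_zero)
    finally have char_eq: "char (distr (measure_pmf (mb_unif d m p n)) borel (?Y n)) \<tau> = cis \<delta> * ?E (\<lambda>a. cis (\<theta> * (real (mb_N m p b a) - \<mu>)))" .
    define e where "e = ?E (\<lambda>a. cis (\<theta> * (real (mb_N m p b a) - \<mu>)))"
    define g where "g = exp (- (\<theta>\<^sup>2 * \<sigma>2 / 2))"
    define g0 where "g0 = exp (- (\<theta>\<^sup>2 * V / 2))"
    have e1: "cmod (e - of_real g) \<le> K * (exp (K * q\<^sup>2) * (K * q\<^sup>2 * q + q)) / sqrt L"
    proof -
      have "cmod (e - of_real g) = charfun_error n \<mu> \<sigma>2 \<theta>" by (simp add: charfun_error_def e_def g_def)
      also have "\<dots> \<le> K * (exp (K * L ^ m * \<theta>\<^sup>2) * (K * L ^ m * \<bar>\<theta>\<bar> ^ 3 + \<bar>\<theta>\<bar> * s))" by (rule ch[OF th1])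
      also have "\<dots> \<le> K * (exp (K * q\<^sup>2) * (K * q\<^sup>2 * (q / sqrt L) + q / sqrt L))"
      proof -
        have KL: "K * L ^ m * \<theta>\<^sup>2 \<le> K * q\<^sup>2"
        proof -
          have "K * (\<theta>\<^sup>2 * L ^ m) \<le> K * q\<^sup>2" using th2_le K by (intro mult_left_mono) auto
          thus ?thesis by (simp add: mult_ac)
        qed
        hence ex: "exp (K * L ^ m * \<theta>\<^sup>2) \<le> exp (K * q\<^sup>2)" by simp
        have "\<bar>\<theta>\<bar> ^ 3 = \<theta>\<^sup>2 * \<bar>\<theta>\<bar>" by (simp add: power2_eq_square power3_eq_cube abs_mult_self_eq)
        hence "K * L ^ m * \<bar>\<theta>\<bar> ^ 3 = (K * L ^ m * \<theta>\<^sup>2) * \<bar>\<theta>\<bar>" by simp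
        also have "\<dots> \<le> (K * q\<^sup>2) * (q / sqrt L)" using K by (intro mult_mono[OF KL th]) auto
        finally have cube: "K * L ^ m * \<bar>\<theta>\<bar> ^ 3 \<le> K * q\<^sup>2 * (q / sqrt L)" .
        show ?thesis
          using K L s by (intro mult_left_mono mult_mono[OF ex add_mono[OF cube th_s]] add_nonneg_nonneg) auto
      qed
      also have "\<dots> = K * (exp (K * q\<^sup>2) * (K * q\<^sup>2 * q + q)) / sqrt L" by (simp add: add_divide_distrib distrib_left)
      finally show ?thesis .
    qed
    have e2: "cmod (cis \<delta> - 1) \<le> K * q / sqrt L"
    proof -
      have "cmod (cis \<delta> - 1) \<le> \<bar>\<delta>\<bar>" by (rule norm_cis_minus_1)
      also have "\<dots> = \<bar>\<theta>\<bar> * \<bar>mb_mean d m p b n - \<mu>\<bar>" by (simp add: \<delta>_def abs_mult abs_minus_commute)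
      also have "\<dots> \<le> \<bar>\<theta>\<bar> * (K * s)" using mean by (intro mult_left_mono) auto
      also have "\<dots> = K * (\<bar>\<theta>\<bar> * s)" by simp
      also have "\<dots> \<le> K * (q / sqrt L)" using th_s K by (intro mult_left_mono) auto
      finally show ?thesis by simp
    qed
    have Ks: "K * s\<^sup>2 \<le> K * L ^ (m - 1)" using s K by (intro mult_left_mono) auto
    \<comment> \<open>Nonnegativity is not part of \<open>near_gaussian\<close>; it follows from |V
      - \<sigma>2| \<le> K L^(m-1) \<le> D L^m \<le> V.\<close>
    have \<sigma>2: "0 \<le> \<sigma>2"
    proof -
      have "K \<le> D * L" using L(3) D by (simp add: field_simps)
      hence "K * L ^ (m - 1) \<le> D * L * L ^ (m - 1)" using Lm0 by (intro mult_right_mono) auto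
      also have "\<dots> = D * L ^ m" by (simp add: Lm)
      finally show ?thesis using Ks var V_ge by linarith
    qed
    have e3: "\<bar>g - g0\<bar> \<le> q\<^sup>2 * K / sqrt L"
    proof -
      have "\<bar>g - g0\<bar> \<le> \<bar>\<theta>\<^sup>2 * \<sigma>2 / 2 - \<theta>\<^sup>2 * V / 2\<bar>"
        unfolding g_def g0_def using \<sigma>2 V0 by (intro exp_minus_lipschitz) auto
      also have "\<dots> = \<bar>(V - \<sigma>2) * (\<theta>\<^sup>2 / 2)\<bar>" 
      proof -
        have "\<theta>\<^sup>2 * \<sigma>2 / 2 - \<theta>\<^sup>2 * V / 2 = - ((V - \<sigma>2) * (\<theta>\<^sup>2 / 2))" by (simp add: field_simps)
        thus ?thesis by (simp only: abs_minus_cancel)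
      qed
      also have "\<dots> = \<bar>V - \<sigma>2\<bar> * (\<theta>\<^sup>2 / 2)" by (simp add: abs_mult)
      also have "\<dots> \<le> (K * L ^ (m - 1)) * \<theta>\<^sup>2" using var Ks by (intro mult_mono) auto
      also have "\<dots> = K * (\<theta>\<^sup>2 * L ^ m) / L" using L by (simp add: Lm)
      also have "\<dots> \<le> K * q\<^sup>2 / sqrt L"
      proof (rule frac_le)
        show "K * (\<theta>\<^sup>2 * L ^ m) \<le> K * q\<^sup>2" using th2_le K by (intro mult_left_mono) auto
        show "sqrt L \<le> L" using L(1) by (intro real_le_lsqrt) (auto simp: power2_eq_square)
      qed (use K sL in auto)
      finally show ?thesis by (simp add: mult.commute)
    qed
    have g01: "\<bar>g\<bar> \<le> 1" using \<sigma>2 by (simp add: g_def)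
    have "exp (- (\<tau>\<^sup>2) / 2) = g0" by (simp add: g0_def th2)
    hence "dist (char (distr (measure_pmf (mb_unif d m p n)) borel (?Y n)) \<tau>) (of_real (exp (- (\<tau>\<^sup>2) / 2))) = cmod (cis \<delta> * e - of_real g0)"
      by (simp only: char_eq e_def dist_norm)
    \<comment> \<open>Three errors: the conditioned characteristic function, the centre, and the
      variance.\<close>
    also have "cis \<delta> * e - of_real g0 = cis \<delta> * (e - of_real g) + ((cis \<delta> - 1) * of_real g + of_real (g - g0))"
      by (simp add: algebra_simps)
    also have "cmod \<dots> \<le> cmod (e - of_real g) + (cmod (cis \<delta> - 1) * 1 + \<bar>g - g0\<bar>)"
    proof (intro norm_triangle_mono)
      show "cmod (cis \<delta> * (e - of_real g)) \<le> cmod (e - of_real g)" by (simp add: norm_mult)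
      show "cmod ((cis \<delta> - 1) * of_real g) \<le> cmod (cis \<delta> - 1) * 1"
        unfolding norm_mult using g01 by (intro mult_left_mono) auto
      show "cmod (of_real (g - g0)) \<le> \<bar>g - g0\<bar>" by (simp only: norm_of_real)
    qed
    also have "\<dots> \<le> K * (exp (K * q\<^sup>2) * (K * q\<^sup>2 * q + q)) / sqrt L + (K * q / sqrt L * 1 + q\<^sup>2 * K / sqrt L)"
      using e1 e2 e3 by (intro add_mono mult_right_mono) auto
    also have "\<dots> = G / sqrt L" by (simp add: G_def add_divide_distrib)
    finally show ?case by (simp only: L_def)
  qed
  have "(\<lambda>n. G / sqrt (ln (real n))) \<longlonglongrightarrow> 0"
  proof -
    have "filterlim (\<lambda>n. sqrt (ln (real n))) at_top sequentially"
      by (intro filterlim_compose[OF sqrt_at_top] filterlim_compose[OF ln_at_top] filterlim_real_sequentially)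
    thus ?thesis by (intro tendsto_divide_0[OF tendsto_const] filterlim_at_top_imp_at_infinity)
  qed
  hence "(\<lambda>n. char (distr (measure_pmf (mb_unif d m p n)) borel (?Y n)) \<tau>) \<longlonglongrightarrow> of_real (exp (- (\<tau>\<^sup>2) / 2))"
    unfolding tendsto_dist_iff[of _ "complex_of_real (exp (- (\<tau>\<^sup>2) / 2))"]
    by (rule Lim_null_comparison[rotated]) (use bound in simp)
  thus "(\<lambda>n. char (distr (measure_pmf (mb_unif d m p n)) borel (?Y n)) \<tau>) \<longlonglongrightarrow> char std_normal_distribution \<tau>"
    by (simp add: char_std_normal_distribution)
qed

end

theorem mainTheorem5:
  fixes d m b :: nat and p :: "nat \<Rightarrow> nat"
  assumes "d \<ge> 2" and "m \<ge> 2"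
    and "1 < p 0" and "strict_mono_on {..<m} p"
    and "\<And>i j. i < m \<Longrightarrow> j < m \<Longrightarrow> i \<noteq> j \<Longrightarrow> coprime (p i) (p j)"
    and "1 \<le> b" and "b \<le> d - 1"
  shows "((\<lambda>n. mb_mean d m p b n - mb_kappa d m p / (real d * ln (real d)) * ln (real n) ^ m)
           \<in> O(\<lambda>n. ln (real n) ^ (m - 1) * ln (ln (real n))))
     \<and> ((\<lambda>n. mb_var d m p b n
              - mb_kappa d m p * (real d - 1) / ((real d)\<^sup>2 * ln (real d)) * ln (real n) ^ m)
           \<in> O(\<lambda>n. ln (real n) ^ (m - 1) * ln (ln (real n))))
     \<and> weak_conv_m
           (\<lambda>n. distr (measure_pmf (mb_unif d m p n)) borel
                  (\<lambda>a. (real (mb_N m p b a) - mb_mean d m p b n) / sqrt (mb_var d m p b n)))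
           std_normal_distribution"
proof -
  interpret multi_base m p d b
  proof unfold_locales
    fix i assume i: "i < m"
    show "1 < p i"
    proof (cases "i = 0")
      case False
      hence "p 0 < p i" using assms(2,4) i by (intro strict_mono_onD[OF assms(4)]) auto
      thus ?thesis using assms(3) by simp
    qed (use assms in simp)
  qed (use assms in auto)
  have lnd: "ln (real d) \<noteq> 0" using assms(1) by simp
  \<comment> \<open>The factor ln d cancels against the ln d in the denominators of both leading
    coefficients.\<close>
  have kappa: "mb_kappa d m p = ln (real d) * mb_density"
    by (simp add: mb_kappa_def mb_density_def prod_dividef)
  have mc: "mb_kappa d m p / (real d * ln (real d)) = mean_const"
    using lnd by (simp add: kappa mean_const_def)
  have vc: "mb_kappa d m p * (real d - 1) / ((real d)\<^sup>2 * ln (real d)) = var_const"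
    using lnd by (simp add: kappa var_const_def)
  obtain K where K: "1 \<le> K" and ev: "\<forall>\<^sub>F n in sequentially.
      \<bar>mb_mean d m p b n - mean_const * ln (real n) ^ m\<bar> \<le> K * log_error n \<and>
      \<bar>mb_var d m p b n - var_const * ln (real n) ^ m\<bar> \<le> K * log_error n"
    using moment_estimates by (elim exE conjE) (rule that, assumption, erule eventually_mono, blast)
  \<comment> \<open>\<open>log_error\<close> is only eventually nonnegative, whereas
    \<open>bigoI\<close> asks for a bound by its absolute value.\<close>
  have le_norm: "K * x \<le> K * \<bar>x\<bar>" for x :: real using K by (intro mult_left_mono) auto
  have "(\<lambda>n. mb_mean d m p b n - mean_const * ln (real n) ^ m) \<in> O(\<lambda>n. ln (real n) ^ (m - 1) * ln (ln (real n)))"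
    using ev unfolding log_error_def by (intro bigoI[of _ K]) (auto elim!: eventually_mono intro: order.trans[OF _ le_norm])
  moreover have "(\<lambda>n. mb_var d m p b n - var_const * ln (real n) ^ m) \<in> O(\<lambda>n. ln (real n) ^ (m - 1) * ln (ln (real n)))"
    using ev unfolding log_error_def by (intro bigoI[of _ K]) (auto elim!: eventually_mono intro: order.trans[OF _ le_norm])
  ultimately show ?thesis unfolding mc vc using central_limit by blast
qed

end
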